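(* Let $w$ be a solution of the variable coefficient thin obstacle problem $$\partial_i a^{ij}\partial_j w=0\ \text{ in }B_1^+,\qquad w\ge0,\ \ -\partial_{n+1}w\ge0,\ \ w\,\partial_{n+1}w=0\ \text{ on }B_1',$$ under the standing assumptions listed in the context. Let $K\subset B_1'$ be compact and suppose that for some finite $\bar\kappa>0$ the vanishing order of $w$ satisfies $\kappa_x<\bar\kappa$ for all $x\in K$. Then there exist a neighborhood $U$ of $K$ (in $B_1'$) and a radius $r_0=r_0(K,\bar\kappa,w)>0$ such that $$\sup_{B_r^+(x)}|w|\ge r^{\bar\kappa}\qquad\text{for all }0<r\le r_0\text{ and all }x\in U.$$
   Context: $n\ge1$, Einstein summation. $B_r^+(x_0)=\{x\in\mathbb{R}^{n+1}:x_{n+1}\ge0,\ |x-x_0|<r\}$ for $x_0=(x_0',0)$, $B_r^+=B_r^+(0)$, $B_r'=B_r^+\cap\{x_{n+1}=0\}$, $A_{r,R}^+(x_0)=B_R^+(x_0)\setminus B_r^+(x_0)$. Standing assumptions: (A0) $\|w\|_{L^2(B_1^+)}=1$; (A1) $a^{i,n+1}(x',0)=0$ on $\{x_{n+1}=0\}$ for $i=1,\dots,n$; (A2) $a^{ij}$ is symmetric and uniformly elliptic with eigenvalues in $[1/2,2]$; (A3) $a^{ij}\in W^{1,p}(B_1^+)$ for some $p\in(n+1,\infty]$; (A4) $a^{ij}(0)=\delta^{ij}$; (W) $w\in C^{1,\alpha}$ (locally up to $B_1'$) for some $\alpha\in(0,\frac12]$. The equation is understood weakly. Vanishing order: $$\kappa_{x_0}=\limsup_{r\to0_+}\frac{\ln\Big(\frac{1}{|A^+_{r/2,r}(x_0)|}\int_{A^+_{r/2,r}(x_0)}w^2\Big)^{1/2}}{\ln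 r}\in[-\infty,\infty].$$ *)

theory Defs
  imports "HOL-Analysis.Analysis"
begin

text \<open>
  The space $R^{n+1}$ is the Euclidean product type \<open>(real^'n) \<times> real\<close>, so that \<open>n = CARD('n) \<ge> 1\<close> and
  \<open>snd x\<close> is the last coordinate of \<open>x\<close>. A coordinate index is the corresponding standard basis
  vector: \<open>(axis k 1, 0)\<close> for the tangential directions and \<open>(0, 1)\<close> for the direction \<open>n + 1\<close>.
\<close>

type_synonym 'n pt = "(real^'n) \<times> real"

definition half_ball :: "'n::finite pt \<Rightarrow> real \<Rightarrow> 'n pt set" where
  "half_ball x\<^sub>0 r = {x. 0 \<le> snd x \<and> norm (x - x\<^sub>0) < r}"

definition thin_ball :: "real \<Rightarrow> 'n::finite pt set" where
  "thin_ball r = half_ball 0 r \<inter> {x. snd x = 0}"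

definition half_annulus :: "'n::finite pt \<Rightarrow> real \<Rightarrow> real \<Rightarrow> 'n pt set" where
  "half_annulus x\<^sub>0 r R = half_ball x\<^sub>0 R - half_ball x\<^sub>0 r"

subsection \<open>Derivatives and function spaces\<close>

text \<open>
  The derivative is taken within \<open>S\<close>. For \<open>S = half_ball 0 1\<close> it is the usual partial
  derivative at interior points and the one-sided one on the flat boundary; it is uniquely determined
  there, because the half ball is convex with nonempty interior.
\<close>

definition partial_within ::
    "'a::euclidean_space set \<Rightarrow> 'a \<Rightarrow> ('a \<Rightarrow> real) \<Rightarrow> 'a \<Rightarrow> real" where
  "partial_within S v f x = frechet_derivative f (at x within S) v"

text \<open>
  $C^{1,\alpha}$ on compact subsets of \<open>S\<close>. As \<open>half_ball 0 1\<close> contains its flat part, for this set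
  it means: locally up to the flat boundary, but not up to the spherical boundary.
\<close>

definition C1_holder_loc :: "real \<Rightarrow> 'a::euclidean_space set \<Rightarrow> ('a \<Rightarrow> real) \<Rightarrow> bool" where
  "C1_holder_loc \<alpha> S f \<longleftrightarrow>
     f differentiable_on S \<and>
     (\<forall>v\<in>Basis. \<forall>C. compact C \<and> C \<subseteq> S \<longrightarrow>
        (\<exists>L. \<forall>x\<in>C. \<forall>y\<in>C.
           \<bar>partial_within S v f x - partial_within S v f y\<bar> \<le> L * dist x y powr \<alpha>))"

primrec C_k :: "nat \<Rightarrow> ('a::euclidean_space \<Rightarrow> real) \<Rightarrow> bool" where
  "C_k 0 f \<longleftrightarrow> continuous_on UNIV f"
| "C_k (Suc k) f \<longleftrightarrow>
     f differentiable_on UNIV \<and> (\<forall>v\<in>Basis. C_k k (partial_within UNIV v f))"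

definition test_fun :: "'a::euclidean_space set \<Rightarrow> ('a \<Rightarrow> real) \<Rightarrow> bool" where
  "test_fun \<Omega> \<phi> \<longleftrightarrow>
     (\<forall>k. C_k k \<phi>) \<and> compact (closure {x. \<phi> x \<noteq> 0}) \<and> closure {x. \<phi> x \<noteq> 0} \<subseteq> \<Omega>"

definition in_Lp :: "ereal \<Rightarrow> 'a::euclidean_space set \<Rightarrow> ('a \<Rightarrow> real) \<Rightarrow> bool" where
  "in_Lp p \<Omega> f \<longleftrightarrow>
     f \<in> borel_measurable (lebesgue_on \<Omega>) \<and>
     (if p = \<infinity> then \<exists>C. AE x in lebesgue_on \<Omega>. \<bar>f x\<bar> \<le> C
      else integrable (lebesgue_on \<Omega>) (\<lambda>x. \<bar>f x\<bar> powr real_of_ereal p))"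

definition weak_partial ::
    "'a::euclidean_space set \<Rightarrow> 'a \<Rightarrow> ('a \<Rightarrow> real) \<Rightarrow> ('a \<Rightarrow> real) \<Rightarrow> bool" where
  "weak_partial \<Omega> v f g \<longleftrightarrow>
     (\<forall>\<phi>. test_fun \<Omega> \<phi> \<longrightarrow>
        (LINT x|lebesgue_on \<Omega>. f x * partial_within UNIV v \<phi> x)
          = - (LINT x|lebesgue_on \<Omega>. g x * \<phi> x))"

definition sobolev_W1 :: "ereal \<Rightarrow> 'a::euclidean_space set \<Rightarrow> ('a \<Rightarrow> real) \<Rightarrow> bool" where
  "sobolev_W1 p \<Omega> f \<longleftrightarrow>
     in_Lp p \<Omega> f \<and> (\<forall>v\<in>Basis. \<exists>g. in_Lp p \<Omega> g \<and> weak_partial \<Omega> v f g)"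

definition L2_norm_on :: "'a::euclidean_space set \<Rightarrow> ('a \<Rightarrow> real) \<Rightarrow> real" where
  "L2_norm_on S f = sqrt (LINT x|lebesgue_on S. (f x)\<^sup>2)"

subsection \<open>The coefficients and the equation\<close>

definition coeff_map ::
    "('a::euclidean_space \<Rightarrow> 'a \<Rightarrow> 'a \<Rightarrow> real) \<Rightarrow> 'a \<Rightarrow> 'a \<Rightarrow> 'a" where
  "coeff_map a x v = (\<Sum>i\<in>Basis. (\<Sum>j\<in>Basis. a i j x * (v \<bullet> j)) *\<^sub>R i)"

definition is_eigenvalue :: "('a::real_vector \<Rightarrow> 'a) \<Rightarrow> real \<Rightarrow> bool" where
  "is_eigenvalue T l \<longleftrightarrow> (\<exists>v. v \<noteq> 0 \<and> T v = l *\<^sub>R v)"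

text \<open>
  Standing conditions on the coefficients. Since $p > n+1$, each coefficient has a continuous
  representative up to the flat boundary; the pointwise conditions refer to that representative,
  and the third conjunct selects it.
\<close>

definition admissible_coeffs ::
    "ereal \<Rightarrow> ('n::finite pt \<Rightarrow> 'n pt \<Rightarrow> 'n pt \<Rightarrow> real) \<Rightarrow> bool" where
  "admissible_coeffs p a \<longleftrightarrow>
     ereal (real CARD('n) + 1) < p \<and>
     (\<forall>i\<in>Basis. \<forall>j\<in>Basis. sobolev_W1 p (interior (half_ball 0 1)) (a i j)) \<and>
     (\<forall>i\<in>Basis. \<forall>j\<in>Basis. continuous_on (half_ball 0 1) (a i j)) \<and>
     (\<forall>i\<in>Basis. \<forall>j\<in>Basis. \<forall>x\<in>half_ball 0 1. a i j x = a j i x) \<and>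
     (\<forall>x\<in>half_ball 0 1. \<forall>l. is_eigenvalue (coeff_map a x) l \<longrightarrow> l \<in> {1/2..2}) \<and>
     (\<forall>k. \<forall>x\<in>thin_ball 1. a (axis k 1, 0) (0, 1) x = 0) \<and>
     (\<forall>i\<in>Basis. \<forall>j\<in>Basis. a i j 0 = (if i = j then 1 else 0))"

definition weak_solution ::
    "('n::finite pt \<Rightarrow> 'n pt \<Rightarrow> 'n pt \<Rightarrow> real) \<Rightarrow> ('n pt \<Rightarrow> real) \<Rightarrow> bool" where
  "weak_solution a w \<longleftrightarrow>
     (\<forall>\<phi>. test_fun (interior (half_ball 0 1)) \<phi> \<longrightarrow>
        (LINT x|lebesgue_on (interior (half_ball 0 1)).
           (\<Sum>i\<in>Basis. \<Sum>j\<in>Basis.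
              a i j x * partial_within (half_ball 0 1) j w x * partial_within UNIV i \<phi> x)) = 0)"

definition thin_obstacle_solution ::
    "('n::finite pt \<Rightarrow> 'n pt \<Rightarrow> 'n pt \<Rightarrow> real) \<Rightarrow> ('n pt \<Rightarrow> real) \<Rightarrow> bool" where
  "thin_obstacle_solution a w \<longleftrightarrow>
     weak_solution a w \<and>
     (\<forall>x\<in>thin_ball 1.
        w x \<ge> 0 \<and>
        - partial_within (half_ball 0 1) (0, 1) w x \<ge> 0 \<and>
        w x * partial_within (half_ball 0 1) (0, 1) w x = 0)"

subsection \<open>Vanishing order\<close>

text \<open>
  The real logarithm of the library has \<open>ln 0 = 0\<close>; here the value must be $-\infty$, so that a function
  vanishing near \<open>x\<^sub>0\<close> has vanishing order $+\infty$.
\<close>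

definition ext_ln :: "real \<Rightarrow> ereal" where
  "ext_ln t = (if t \<le> 0 then -\<infinity> else ereal (ln t))"

definition vanishing_order :: "('n::finite pt \<Rightarrow> real) \<Rightarrow> 'n pt \<Rightarrow> ereal" where
  "vanishing_order w x\<^sub>0 =
     Limsup (at_right 0) (\<lambda>r.
       ext_ln (sqrt (1 / measure lebesgue (half_annulus x\<^sub>0 (r/2) r) *
                     (LINT x|lebesgue_on (half_annulus x\<^sub>0 (r/2) r). (w x)\<^sup>2)))
       / ereal (ln r))"

end

(* The idea is to use the Weiss energy.  By the weak formulation w minimises the energy of
   A = (a^ij) on half ellipsoids around a thin point z, among functions that are nonnegative on
   the thin set, and by Morrey's inequality A differs from A(z) by a power of the radius.
   Comparing w with the extension of its boundary values that is homogeneous of degree kappa > 1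
   gives a differential inequality for  D(rho) - kappa H(rho) / rho,  where D is the energy and H
   the boundary integral of w^2, both taken with respect to A(z).  With kappa decreasing slightly
   in rho to absorb the error, negativity of this quantity at one radius R persists at all smaller
   radii with a definite rate, and so bounds H(rho) from below by a multiple of rho^(n + 2 kappa).
   At fixed R negativity is an open condition on z, which makes the lower bound locally uniform.
   Conversely, if the quantity were nonnegative at all small radii around a point, then H would
   decay there faster than the vanishing order permits.  For kappa <= 1 there is nothing to
   compare: w is differentiable, so a vanishing order below 1 forces w to be nonzero at z. *)

theory Submission
  imports Defs
begin

section \<open>Flat exponentials, and a class of smooth functions stable under
  differentiation\<close>

subsection \<open>Smooth bump functions\<close>

definition exp_flat :: "nat \<Rightarrow> real \<Rightarrow> real" where
  "exp_flat m t = (if t \<le> 0 then 0 else exp (- 1 / t) / t ^ m)"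

lemma power_le_fact_exp:
  fixes u :: real
  assumes "0 \<le> u"
  shows "u ^ n \<le> fact n * exp u"
proof -
  have s: "(\<lambda>k. u ^ k /\<^sub>R fact k) sums exp u" by (rule exp_converges)
  have "(\<Sum>k\<in>{n}. u ^ k /\<^sub>R fact k) \<le> exp u"
    using sum_le_suminf[OF sums_summable[OF s], of "{n}"] sums_unique[OF s] assms by auto
  then show ?thesis by (simp add: field_simps)
qed

text \<open>The exponential bound at u = 1 / t with exponent m + 2 has two powers of 1 / t to spare
  over t^m. Being quadratically small at 0 makes the difference quotient there tend to 0.\<close>

lemma exp_flat_le_square: "\<bar>exp_flat m t\<bar> \<le> fact (m + 2) * t\<^sup>2"
proof (cases "t \<le> 0")
  case False
  have "(1 / t) ^ (m + 2) \<le> fact (m + 2) * exp (1 / t)"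
    using False by (intro power_le_fact_exp) auto
  then have "(1 / t) ^ (m + 2) / exp (1 / t) \<le> fact (m + 2)"
    by (subst pos_divide_le_eq) auto
  then have "(1 / t) ^ (m + 2) / exp (1 / t) * t\<^sup>2 \<le> fact (m + 2) * t\<^sup>2"
    by (rule mult_right_mono) auto
  moreover have "(1 / t) ^ (m + 2) / exp (1 / t) * t\<^sup>2 = exp (- (1 / t)) / t ^ m"
    using False by (simp add: exp_minus power_add power_divide power2_eq_square field_simps)
  ultimately have "exp (- (1 / t)) / t ^ m \<le> fact (m + 2) * t\<^sup>2" by simp
  then show ?thesis using False by (simp add: exp_flat_def)
qed (auto simp: exp_flat_def)

text \<open>Carrying the factor t^(-m) makes the family closed under differentiation up to linear
  combinations, so higher derivatives need no formula of their own.\<close>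

lemma exp_flat_has_derivative:
  "(exp_flat m has_real_derivative exp_flat (m + 2) t - m * exp_flat (m + 1) t) (at t)"
proof -
  consider "t < 0" | "t = 0" | "t > 0" by linarith
  then show ?thesis
  proof cases
    case 1
    have "((\<lambda>_. 0) has_real_derivative 0) (at t)" by simp
    then have "(exp_flat m has_real_derivative 0) (at t)"
      by (rule has_field_derivative_transform_within_open[where S="{..<0}"])
        (use 1 in \<open>auto simp: exp_flat_def\<close>)
    then show ?thesis using 1 by (simp add: exp_flat_def)
  next
    case 3
    have "((\<lambda>t. exp (- 1 / t) / t ^ m) has_real_derivative
        exp_flat (m + 2) t - m * exp_flat (m + 1) t) (at t)"
    proof -
      have p: "((\<lambda>t. t ^ m) has_real_derivative m * t ^ m / t) (at t)"
        using 3 DERIV_pow[of m t] by (cases m) auto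
      have e: "((\<lambda>t. exp (- 1 / t)) has_real_derivative exp (- 1 / t) / t\<^sup>2) (at t)"
        using 3 by (auto intro!: derivative_eq_intros simp: power2_eq_square)
      have "((\<lambda>t. exp (- 1 / t) / t ^ m) has_real_derivative
          (exp (- 1 / t) / t\<^sup>2 * t ^ m - exp (- 1 / t) * (m * t ^ m / t)) / (t ^ m * t ^ m)) (at t)"
        using 3 by (intro DERIV_divide p e) auto
      moreover have "(exp (- 1 / t) / t\<^sup>2 * t ^ m - exp (- 1 / t) * (m * t ^ m / t)) / (t ^ m * t ^ m) =
          exp_flat (m + 2) t - m * exp_flat (m + 1) t"
        using 3 by (simp add: exp_flat_def divide_simps power_add power2_eq_square) (simp add: algebra_simps)
      ultimately show ?thesis by simp
    qed
    then show ?thesis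
      by (rule has_field_derivative_transform_within_open[where S="{0<..}"])
        (use 3 in \<open>auto simp: exp_flat_def\<close>)
  next
    case 2
    have "((\<lambda>h. fact (m + 2) * \<bar>h\<bar>) \<longlongrightarrow> 0) (at (0::real))"
      by (auto intro!: tendsto_eq_intros)
    then have "((\<lambda>h. exp_flat m h / h) \<longlongrightarrow> 0) (at 0)"
    proof (rule Lim_null_comparison[rotated])
      show "\<forall>\<^sub>F h in at 0. norm (exp_flat m h / h) \<le> fact (m + 2) * \<bar>h\<bar>"
      proof (rule eventuallyI)
        fix h :: real
        show "norm (exp_flat m h / h) \<le> fact (m + 2) * \<bar>h\<bar>"
        proof (cases "h = 0")
          case False
          have "\<bar>exp_flat m h\<bar> \<le> (fact (m + 2) * \<bar>h\<bar>) * \<bar>h\<bar>"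
            using exp_flat_le_square[of m h] by (simp add: power2_eq_square abs_mult_self_eq mult.assoc)
          then show ?thesis using False by (simp add: abs_divide pos_divide_le_eq)
        qed simp
      qed
    qed
    then show ?thesis using 2 by (simp add: has_field_derivative_iff exp_flat_def)
  qed
qed

text \<open>A syntactic class of smooth functions: the generators of bumps, closed under sums and
  products, and by \<open>smooth_fn_grad\<close> under gradient components. Membership therefore
  gives all orders of differentiability at once.\<close>

inductive smooth_fn :: "('a::euclidean_space \<Rightarrow> real) \<Rightarrow> bool" where
  const: "smooth_fn (\<lambda>x. c)"
| lin: "smooth_fn (\<lambda>x. x \<bullet> v)"
| flat: "smooth_fn (\<lambda>x. exp_flat m (1 - ((x - c) \<bullet> (x - c)) / t\<^sup>2))"
| add: "smooth_fn f \<Longrightarrow> smooth_fn g \<Longrightarrow> smooth_fn (\<lambda>x. f x + g x)"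
| mult: "smooth_fn f \<Longrightarrow> smooth_fn g \<Longrightarrow> smooth_fn (\<lambda>x. f x * g x)"

lemma smooth_fn_grad:
  assumes "smooth_fn f"
  obtains G where "\<And>x. (f has_derivative (\<lambda>h. h \<bullet> G x)) (at x)" "\<And>v. smooth_fn (\<lambda>x. G x \<bullet> v)"
proof -
  from assms have "\<exists>G. (\<forall>x. (f has_derivative (\<lambda>h. h \<bullet> G x)) (at x)) \<and> (\<forall>v. smooth_fn (\<lambda>x. G x \<bullet> v))"
  proof induction
    case (const c)
    show ?case by (rule exI[where x="\<lambda>x. 0"]) (auto intro: smooth_fn.const)
  next
    case (lin v)
    show ?case by (rule exI[where x="\<lambda>x. v"]) (auto intro!: smooth_fn.const derivative_eq_intros)
  next
    case (flat m c t)
    define q where "q x = 1 - ((x - c) \<bullet> (x - c)) / t\<^sup>2" for x :: 'a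
    define G where "G x = ((exp_flat (m + 2) (q x) - m * exp_flat (m + 1) (q x)) * (- 2 / t\<^sup>2)) *\<^sub>R (x - c)" for x
    have q: "(q has_derivative (\<lambda>h. (- 2 / t\<^sup>2) * (h \<bullet> (x - c)))) (at x)" for x
    proof (cases "t = 0")
      case True
      then show ?thesis by (simp add: q_def[abs_def])
    next
      case False
      then show ?thesis unfolding q_def[abs_def]
        by (auto intro!: derivative_eq_intros simp: inner_commute field_simps)
    qed
    have "((\<lambda>x. exp_flat m (q x)) has_derivative (\<lambda>h. h \<bullet> G x)) (at x)" for x
    proof -
      have "((\<lambda>x. exp_flat m (q x)) has_derivative
          (\<lambda>h. (- 2 / t\<^sup>2) * (h \<bullet> (x - c)) * (exp_flat (m + 2) (q x) - m * exp_flat (m + 1) (q x)))) (at x)"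
        using has_derivative_compose[OF q exp_flat_has_derivative[of m, unfolded has_field_derivative_def], of x]
        by (simp add: mult.commute)
      then show ?thesis
        by (rule has_derivative_eq_rhs) (auto simp: G_def)
    qed
    moreover have "smooth_fn (\<lambda>x. G x \<bullet> v)" for v
    proof -
      have "smooth_fn (\<lambda>x. (exp_flat (m + 2) (1 - ((x - c) \<bullet> (x - c)) / t\<^sup>2) +
           (- real m) * exp_flat (m + 1) (1 - ((x - c) \<bullet> (x - c)) / t\<^sup>2)) * (- 2 / t\<^sup>2) * (x \<bullet> v + (- (c \<bullet> v))))"
        by (intro smooth_fn.intros)
      then show ?thesis by (simp add: G_def q_def inner_diff_left)
    qed
    ultimately show ?case unfolding q_def by blast
  next
    case (add f g)
    then obtain F G where "\<forall>x. (f has_derivative (\<lambda>h. h \<bullet> F x)) (at x)" "\<forall>v. smooth_fn (\<lambda>x. F x \<bullet> v)"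
      "\<forall>x. (g has_derivative (\<lambda>h. h \<bullet> G x)) (at x)" "\<forall>v. smooth_fn (\<lambda>x. G x \<bullet> v)" by blast
    note H = this
    have "((\<lambda>x. f x + g x) has_derivative (\<lambda>h. h \<bullet> (F x + G x))) (at x)" for x
      using has_derivative_add[OF H(1)[rule_format, of x] H(3)[rule_format, of x]]
      by (rule has_derivative_eq_rhs) (auto simp: inner_add_right)
    moreover have "smooth_fn (\<lambda>x. (F x + G x) \<bullet> v)" for v
      using smooth_fn.add[OF H(2)[rule_format, of v] H(4)[rule_format, of v]]
      by (simp add: inner_add_left)
    ultimately show ?case by (rule_tac exI[where x="\<lambda>x. F x + G x"]) blast
  next
    case (mult f g)
    then obtain F G where "\<forall>x. (f has_derivative (\<lambda>h. h \<bullet> F x)) (at x)" "\<forall>v. smooth_fn (\<lambda>x. F x \<bullet> v)"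
      "\<forall>x. (g has_derivative (\<lambda>h. h \<bullet> G x)) (at x)" "\<forall>v. smooth_fn (\<lambda>x. G x \<bullet> v)" by blast
    note H = this
    have "((\<lambda>x. f x * g x) has_derivative (\<lambda>h. h \<bullet> (f x *\<^sub>R G x + g x *\<^sub>R F x))) (at x)" for x
      using has_derivative_mult[OF H(1)[rule_format, of x] H(3)[rule_format, of x]]
      by (rule has_derivative_eq_rhs) (auto simp: inner_add_right)
    moreover have "smooth_fn (\<lambda>x. (f x *\<^sub>R G x + g x *\<^sub>R F x) \<bullet> v)" for v
      using smooth_fn.add[OF smooth_fn.mult[OF mult.hyps(1) H(4)[rule_format, of v]]
          smooth_fn.mult[OF mult.hyps(2) H(2)[rule_format, of v]]]
      by (simp add: inner_add_left)
    ultimately show ?case by (rule_tac exI[where x="\<lambda>x. f x *\<^sub>R G x + g x *\<^sub>R F x"]) blast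
  qed
  then show ?thesis using that by blast
qed

lemma grad_imp_continuous_on:
  assumes "\<And>x. x \<in> S \<Longrightarrow> (f has_derivative (\<lambda>h. h \<bullet> G x)) (at x within S)"
  shows "continuous_on S f"
  using assms by (meson continuous_on_eq_continuous_within has_derivative_continuous)

lemma smooth_fn_continuous: "smooth_fn f \<Longrightarrow> continuous_on S f"
  by (meson smooth_fn_grad grad_imp_continuous_on has_derivative_at_withinI)

lemma partial_UNIV_grad:
  assumes "(f has_derivative (\<lambda>h. h \<bullet> G)) (at x)"
  shows "partial_within UNIV v f x = v \<bullet> G"
  using frechet_derivative_at[OF assms, symmetric] by (simp add: partial_within_def)

text \<open>The recursion of \<open>C_k\<close> only ever passes to gradient components, so one step
  of closure settles every order. It is applied to \<open>smooth_fn\<close> and to convolutions of a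
  continuous function with a smooth kernel.\<close>

lemma C_k_coinduct:
  assumes step: "\<And>f. X f \<Longrightarrow> \<exists>G. (\<forall>x. (f has_derivative (\<lambda>h. h \<bullet> G x)) (at x)) \<and> (\<forall>v\<in>Basis. X (\<lambda>x. G x \<bullet> v))"
    and "X f"
  shows "C_k k f"
  using \<open>X f\<close>
proof (induction k arbitrary: f)
  case 0
  then show ?case using step[OF 0] grad_imp_continuous_on[of UNIV f] by auto
next
  case (Suc k)
  then obtain G where G: "\<And>x. (f has_derivative (\<lambda>h. h \<bullet> G x)) (at x)" "\<And>v. v \<in> Basis \<Longrightarrow> X (\<lambda>x. G x \<bullet> v)"
    using step by blast
  have "partial_within UNIV v f = (\<lambda>x. G x \<bullet> v)" for v
    by (auto simp: partial_UNIV_grad[OF G(1)] inner_commute)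
  then show ?case
    using Suc.IH G by (auto simp: differentiable_on_def differentiable_def)
qed

lemma smooth_fn_C_k: "smooth_fn f \<Longrightarrow> C_k k f"
  by (rule C_k_coinduct[where X=smooth_fn]) (metis smooth_fn_grad)

text \<open>The usual mollifier profile, not normalised: its integral is divided out where an
  average is wanted.\<close>

definition bump :: "'a::euclidean_space \<Rightarrow> real \<Rightarrow> 'a \<Rightarrow> real" where
  "bump c t x = exp_flat 0 (1 - ((x - c) \<bullet> (x - c)) / t\<^sup>2)"

lemma bump_smooth: "smooth_fn (bump c t)"
  unfolding bump_def[abs_def] by (rule smooth_fn.flat)

lemma bump_nonneg: "0 \<le> bump c t x"
  by (simp add: bump_def exp_flat_def)

lemma bump_le_1: "bump c t x \<le> 1"
  by (simp add: bump_def exp_flat_def)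

lemma bump_pos_iff:
  assumes "t > 0"
  shows "0 < bump c t x \<longleftrightarrow> dist c x < t"
proof -
  have "(x - c) \<bullet> (x - c) < t\<^sup>2 \<longleftrightarrow> dist c x < t"
    using assms power2_less_imp_less[of "norm (x - c)" t] power_strict_mono[of "norm (x - c)" t 2]
    by (auto simp: dist_norm norm_minus_commute[of c] simp flip: power2_norm_eq_inner)
  then show ?thesis using assms by (simp add: bump_def exp_flat_def not_le) (metis not_le)
qed

lemma bump_eq_0_iff: "t > 0 \<Longrightarrow> bump c t x = 0 \<longleftrightarrow> t \<le> dist c x"
  using bump_pos_iff[of t c x] bump_nonneg[of c t x] by linarith

section \<open>From smooth test functions to C^1 test functions of compact support\<close>

subsection \<open>Mollification\<close>

text \<open>The derivative falls on one factor and the other is only continuous. Exchanging the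
  roles of kernel and mollified function gives either smoothness of the convolution or a formula for
  its gradient.\<close>

lemma has_grad_convolution:
  fixes u :: "'a::euclidean_space \<Rightarrow> real"
  assumes u: "\<And>x. (u has_derivative (\<lambda>h. h \<bullet> U x)) (at x)"
    and U: "continuous_on UNIV U"
    and k: "continuous_on UNIV k"
  shows "((\<lambda>x. integral (cbox a b) (\<lambda>z. k z * u (x - z))) has_derivative
          (\<lambda>h. h \<bullet> integral (cbox a b) (\<lambda>z. k z *\<^sub>R U (x - z)))) (at x)"
proof -
  have cu: "continuous_on UNIV u"
    using u grad_imp_continuous_on[of UNIV u] by auto
  have c1: "continuous_on S (\<lambda>z. k (f z))" "continuous_on S (\<lambda>z. u (f z))" "continuous_on S (\<lambda>z. U (f z))"
    if "continuous_on S f" for S :: "'b::topological_space set" and f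
    using continuous_on_compose2[OF k that] continuous_on_compose2[OF cu that]
      continuous_on_compose2[OF U that] by auto
  have d: "((\<lambda>x. integral (cbox a b) (\<lambda>z. k z * u (x - z))) has_derivative
     blinfun_apply (integral (cbox a b) (\<lambda>z. blinfun_inner_left (k z *\<^sub>R U (x - z))))) (at x within UNIV)"
  proof (rule leibniz_rule)
    fix x t :: 'a
    show "((\<lambda>x. k t * u (x - t)) has_derivative blinfun_apply (blinfun_inner_left (k t *\<^sub>R U (x - t)))) (at x within UNIV)"
    proof -
      have "((\<lambda>x. x - t) has_derivative (\<lambda>h. h)) (at x)"
        by (auto intro!: derivative_eq_intros)
      from has_derivative_mult_right[OF has_derivative_compose[OF this u], of "k t"]
      show ?thesis by (simp add: blinfun_inner_left.rep_eq[abs_def])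
    qed
    show "(\<lambda>z. k z * u (x - z)) integrable_on cbox a b"
      by (intro integrable_continuous continuous_intros c1)
    show "continuous_on (UNIV \<times> cbox a b) (\<lambda>(x, t). blinfun_inner_left (k t *\<^sub>R U (x - t)))"
      unfolding split_beta by (intro bounded_linear.continuous_on[OF bounded_linear_blinfun_inner_left] continuous_intros c1)
  qed auto
  have "integral (cbox a b) (\<lambda>z. blinfun_inner_left (k z *\<^sub>R U (x - z))) =
        blinfun_inner_left (integral (cbox a b) (\<lambda>z. k z *\<^sub>R U (x - z)))"
    using integral_linear[OF _ bounded_linear_blinfun_inner_left, of "\<lambda>z. k z *\<^sub>R U (x - z)" "cbox a b"]
    by (simp add: o_def integrable_continuous continuous_intros c1)
  with d show ?thesis by simp
qed

text \<open>For a non-integrable function both sides are the default value 0, because an invertible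
  affine change of variables does not create integrability.\<close>

lemma lborel_integral_affine:
  fixes f :: "'a::euclidean_space \<Rightarrow> 'b::{banach, second_countable_topology}"
  assumes "c \<noteq> 0"
  shows "(\<integral>x. f x \<partial>lborel) = \<bar>c\<bar> ^ DIM('a) *\<^sub>R (\<integral>x. f (t + c *\<^sub>R x) \<partial>lborel)"
proof cases
  assume f[measurable]: "integrable lborel f"
  have [measurable]: "(\<lambda>x. t + c *\<^sub>R x) \<in> borel \<rightarrow>\<^sub>M borel" by simp
  show ?thesis
    by (subst lborel_affine[OF assms, of t], subst integral_density)
       (auto simp: integral_distr integral_scaleR_right)
next
  assume f: "\<not> integrable lborel f"
  have "\<not> integrable lborel (\<lambda>x. f (t + c *\<^sub>R x))"
  proof
    assume i: "integrable lborel (\<lambda>x. f (t + c *\<^sub>R x))"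
    have "f \<in> borel_measurable borel"
    proof -
      have "(\<lambda>y. f (t + c *\<^sub>R ((1/c) *\<^sub>R (y - t)))) \<in> borel_measurable borel"
        using borel_measurable_integrable[OF i] by (rule measurable_compose[rotated]) simp
      then show ?thesis using assms by simp
    qed
    note [measurable] = this
    have "integrable (density (distr lborel borel (\<lambda>x. t + c *\<^sub>R x)) (\<lambda>_. ennreal (\<bar>c\<bar> ^ DIM('a)))) f"
      by (subst integrable_density) (use i in \<open>auto simp: integrable_distr_eq\<close>)
    with f show False
      using lborel_affine[OF assms, of t] assms by (simp add: ennreal_power)
  qed
  with f show ?thesis by (simp add: not_integrable_integral_eq)
qed

text \<open>Passes from the completed measure, in which the problem is stated, to the Borel set
  integrals in which the estimates are done.\<close>

lemma lebesgue_on_eq_lborel: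
  fixes f :: "'a::euclidean_space \<Rightarrow> real"
  assumes "S \<in> sets borel" "set_borel_measurable borel S f"
  shows "(LINT x|lebesgue_on S. f x) = (LINT x:S|lborel. f x)"
  unfolding set_lebesgue_integral_def
  using assms by (subst integral_restrict_space)
    (auto simp: integral_completion set_borel_measurable_def)

lemma set_borel_measurable_continuous_borel:
  fixes f :: "'a::topological_space \<Rightarrow> 'b::real_normed_vector"
  assumes "S \<in> sets borel" "continuous_on S f"
  shows "set_borel_measurable borel S f"
  using borel_measurable_continuous_on_indicator[OF assms] by (simp add: set_borel_measurable_def)

lemma set_integral_eq_subset:
  fixes f :: "'a \<Rightarrow> 'b::{banach, second_countable_topology}"
  assumes "K \<subseteq> S" "\<And>x. x \<in> S - K \<Longrightarrow> f x = 0"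
  shows "(LINT x:S|M. f x) = (LINT x:K|M. f x)"
  unfolding set_lebesgue_integral_def
  using assms by (intro Bochner_Integration.integral_cong) (auto simp: indicator_def)

lemma integral_cbox_eq_lborel:
  fixes f :: "'a::euclidean_space \<Rightarrow> 'b::euclidean_space"
  assumes "continuous_on UNIV f" "\<And>x. x \<notin> cbox a b \<Longrightarrow> f x = 0"
  shows "integral (cbox a b) f = (\<integral>x. f x \<partial>lborel)"
proof -
  have "set_integrable lborel (cbox a b) f"
    unfolding set_integrable_def using continuous_on_subset[OF assms(1)]
    by (intro borel_integrable_compact) auto
  then have "integral (cbox a b) f = (LINT x:cbox a b|lborel. f x)"
    by (simp add: set_borel_integral_eq_integral)
  also have "\<dots> = (\<integral>x. f x \<partial>lborel)"
    unfolding set_lebesgue_integral_def using assms(2)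
    by (intro Bochner_Integration.integral_cong) (auto simp: indicator_def)
  finally show ?thesis .
qed

lemma bump_integral_pos:
  assumes "t > 0" "cball c t \<subseteq> cbox a b"
  shows "0 < integral (cbox a b) (bump c t)"
proof -
  have "0 \<le> integral (cbox a b) (bump c t)"
    by (intro integral_nonneg) (auto simp: bump_nonneg intro!: integrable_continuous smooth_fn_continuous bump_smooth)
  moreover have "integral (cbox a b) (bump c t) \<noteq> 0"
  proof
    assume "integral (cbox a b) (bump c t) = 0"
    have "ball c t \<subseteq> box a b"
      using assms(2) interior_mono[of "cball c t" "cbox a b"] by (simp add: interior_cbox)
    then have "box a b \<noteq> {}" using assms(1) by auto
    with \<open>integral (cbox a b) (bump c t) = 0\<close> have "\<forall>x\<in>cbox a b. bump c t x = 0"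
      by (subst (asm) integral_cbox_eq_0_iff) (auto simp: bump_nonneg intro!: smooth_fn_continuous bump_smooth)
    moreover have "c \<in> cbox a b" using assms by auto
    ultimately have "bump c t c = 0" by blast
    then show False using assms(1) by (simp add: bump_eq_0_iff)
  qed
  ultimately show ?thesis by linarith
qed

lemma convolution_C_k:
  assumes k: "continuous_on UNIV (k :: 'a::euclidean_space \<Rightarrow> real)" and "smooth_fn u"
  shows "C_k n (\<lambda>x. integral (cbox a b) (\<lambda>z. k z * u (x - z)))"
proof (rule C_k_coinduct[where X="\<lambda>f. \<exists>u. smooth_fn u \<and> f = (\<lambda>x. integral (cbox a b) (\<lambda>z. k z * u (x - z)))"])
  fix f :: "'a \<Rightarrow> real"
  assume "\<exists>u. smooth_fn u \<and> f = (\<lambda>x. integral (cbox a b) (\<lambda>z. k z * u (x - z)))"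
  then obtain u where u: "smooth_fn u" and f: "f = (\<lambda>x. integral (cbox a b) (\<lambda>z. k z * u (x - z)))" by blast
  obtain U where U: "\<And>x. (u has_derivative (\<lambda>h. h \<bullet> U x)) (at x)" "\<And>v. smooth_fn (\<lambda>x. U x \<bullet> v)"
    using smooth_fn_grad[OF u] by blast
  have cU: "continuous_on S U" for S
    using U(2) smooth_fn_continuous by (subst continuous_on_componentwise) auto
  have cU': "continuous_on S (\<lambda>z. U (x - z))" for S x
    by (rule continuous_on_compose2[OF cU[of UNIV]]) (auto intro!: continuous_intros)
  have "integral (cbox a b) (\<lambda>z. k z *\<^sub>R U (x - z)) \<bullet> v = integral (cbox a b) (\<lambda>z. k z * (U (x - z) \<bullet> v))" for x v
    by (subst integral_component_eq[symmetric]) 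
      (auto intro!: integrable_continuous continuous_intros cU' continuous_on_subset[OF k])
  then show "\<exists>G. (\<forall>x. (f has_derivative (\<lambda>h. h \<bullet> G x)) (at x)) \<and>
      (\<forall>v\<in>Basis. \<exists>u. smooth_fn u \<and> (\<lambda>x. G x \<bullet> v) = (\<lambda>x. integral (cbox a b) (\<lambda>z. k z * u (x - z))))"
    using has_grad_convolution[OF U(1) cU k, of a b] U(2) unfolding f
    by (intro exI[where x="\<lambda>x. integral (cbox a b) (\<lambda>z. k z *\<^sub>R U (x - z))"]) fastforce
qed (use assms in blast)

lemma lborel_integral_reflect_translate:
  fixes f :: "'a::euclidean_space \<Rightarrow> 'b::{banach, second_countable_topology}"
  shows "(\<integral>z. f (x - z) \<partial>lborel) = (\<integral>z. f z \<partial>lborel)"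
  using lborel_integral_affine[of "-1" f x] by simp

text \<open>Competitors built from \<open>w\<close> are only C^1. Mollifying \<phi> at a small scale
  gives a smooth test function supported in a slightly larger compact set, and its gradient is
  uniformly close to \<psi>. As \<open>F\<close> is integrable on that set, the equation for the
  mollified function passes to \<phi> in the limit.\<close>

lemma weak_eq_C1:
  fixes F :: "'a::euclidean_space \<Rightarrow> 'a" and \<phi> :: "'a \<Rightarrow> real"
  assumes "open \<Omega>" and F: "continuous_on \<Omega> F"
    and weak: "\<And>\<phi>. test_fun \<Omega> \<phi> \<Longrightarrow>
        (LINT x|lebesgue_on \<Omega>. (\<Sum>i\<in>Basis. (F x \<bullet> i) * partial_within UNIV i \<phi> x)) = 0"
    and \<phi>: "\<And>x. (\<phi> has_derivative (\<lambda>h. h \<bullet> \<psi> x)) (at x)"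
    and \<psi>: "continuous_on UNIV \<psi>"
    and C: "compact C" "C \<subseteq> \<Omega>" "\<And>x. x \<notin> C \<Longrightarrow> \<phi> x = 0"
  shows "(LINT x:\<Omega>|lborel. F x \<bullet> \<psi> x) = 0"
proof -
  have \<psi>0: "\<psi> x = 0" if "x \<notin> C" for x
  proof -
    have "((\<lambda>_. 0) has_derivative (\<lambda>h. h \<bullet> \<psi> x)) (at x)"
      by (rule has_derivative_transform_within_open[OF \<phi>, where s="- C"])
        (use that C in \<open>auto simp: compact_imp_closed open_Compl\<close>)
    then have "(\<lambda>h. h \<bullet> \<psi> x) = (\<lambda>h. 0)"
      using has_derivative_const has_derivative_unique by blast
    then have "\<psi> x \<bullet> \<psi> x = 0" by metis
    then show ?thesis by simp
  qed
  have c\<phi>: "continuous_on UNIV \<phi>" using \<phi> grad_imp_continuous_on[of UNIV] by auto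
  obtain \<epsilon>0 where \<epsilon>0: "\<epsilon>0 > 0" "\<And>x z. x \<in> C \<Longrightarrow> norm z \<le> \<epsilon>0 \<Longrightarrow> x + z \<in> \<Omega>"
  proof -
    obtain e where e: "e > 0" "(\<Union>x\<in>C. cball x e) \<subseteq> \<Omega>"
      using compact_subset_open_imp_cball_epsilon_subset[OF C(1) \<open>open \<Omega>\<close> C(2)] by blast
    have "x + z \<in> \<Omega>" if "x \<in> C" "norm z \<le> e" for x z
    proof -
      have "x + z \<in> cball x e" using that by (simp add: dist_norm)
      then show ?thesis using that e by blast
    qed
    with e show ?thesis using that by blast
  qed
  define K where "K = {x + z | x z. x \<in> C \<and> z \<in> cball 0 \<epsilon>0}"
  have K: "compact K" "K \<subseteq> \<Omega>" "C \<subseteq> K"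
  proof -
    show "compact K" unfolding K_def using C by (intro compact_sums) auto
    show "K \<subseteq> \<Omega>" unfolding K_def using \<epsilon>0 by auto
    show "C \<subseteq> K"
    proof
      fix x assume "x \<in> C"
      then show "x \<in> K" unfolding K_def using \<epsilon>0(1) by (intro CollectI exI[where x=x] exI[where x=0]) auto
    qed
  qed
  \<comment> \<open>A second enlargement: for x in \<open>K\<close> the point x - z may leave
    \<open>K\<close>, and the modulus of continuity of \<psi> is needed at both points.\<close>
  define K2 where "K2 = {x + z | x z. x \<in> K \<and> z \<in> cball 0 \<epsilon>0}"
  have K2: "compact K2" "K \<subseteq> K2"
  proof -
    show "compact K2" unfolding K2_def using K by (intro compact_sums) auto
    show "K \<subseteq> K2"
    proof
      fix x assume "x \<in> K"
      then show "x \<in> K2" unfolding K2_def using \<epsilon>0(1) by (intro CollectI exI[where x=x] exI[where x=0]) auto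
    qed
  qed
  have notK: "x \<notin> C \<and> x - z \<notin> C" if "x \<notin> K" "norm z \<le> \<epsilon>0" for x z
  proof -
    have "x - z \<notin> C"
    proof
      assume "x - z \<in> C"
      then have "x \<in> K" unfolding K_def using that(2) by (intro CollectI exI[where x="x - z"] exI[where x=z]) auto
      then show False using that by simp
    qed
    then show ?thesis using that K(3) by blast
  qed
  have intK: "set_integrable lborel K (\<lambda>x. F x \<bullet> G x)" if "continuous_on UNIV G" for G
    unfolding set_integrable_def using K continuous_on_subset[OF that] continuous_on_subset[OF F]
    by (intro borel_integrable_compact continuous_intros) auto
  have intF: "set_integrable lborel K (\<lambda>x. norm (F x))"
    unfolding set_integrable_def using K continuous_on_subset[OF F]
    by (intro borel_integrable_compact continuous_intros) auto
  have Kb: "K \<in> sets borel" using K by (simp add: borel_compact)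
  define I where "I = (LINT x:K|lborel. F x \<bullet> \<psi> x)"
  define M where "M = (LINT x:K|lborel. norm (F x))"
  have "M \<ge> 0" unfolding M_def set_lebesgue_integral_def by (intro integral_nonneg_AE) auto
  obtain a b :: 'a where ab: "C \<subseteq> cbox a b" "cball 0 \<epsilon>0 \<subseteq> cbox a b"
  proof -
    have "bounded (C \<union> cball 0 \<epsilon>0)" using C compact_imp_bounded by auto
    then obtain w where "C \<union> cball 0 \<epsilon>0 \<subseteq> cbox (- w) w"
      by (rule bounded_subset_cbox_symmetric)
    then show ?thesis by (intro that[of "- w" w]) simp_all
  qed
  have bound: "\<bar>I\<bar> \<le> e * M" if "e > 0" for e
  proof -
    have "uniformly_continuous_on K2 \<psi>"
      using K2 continuous_on_subset[OF \<psi>] by (intro compact_uniformly_continuous) auto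
    then obtain d where d: "d > 0" "\<And>x y. x \<in> K2 \<Longrightarrow> y \<in> K2 \<Longrightarrow> dist y x < d \<Longrightarrow> dist (\<psi> y) (\<psi> x) < e"
      using \<open>e > 0\<close> unfolding uniformly_continuous_on_def by metis
    define \<epsilon> where "\<epsilon> = min \<epsilon>0 d"
    have \<epsilon>: "\<epsilon> > 0" "\<epsilon> \<le> \<epsilon>0" "\<epsilon> \<le> d" using \<epsilon>0 d by (auto simp: \<epsilon>_def)
    have close: "norm (\<psi> (x - z) - \<psi> x) \<le> e" if z: "norm z < \<epsilon>" for x z
    proof (cases "x \<in> K")
      case True
      then have "x - z \<in> K2" unfolding K2_def using z \<epsilon>
        by (intro CollectI exI[where x=x] exI[where x="-z"]) auto
      then show ?thesis using d(2)[of x "x - z"] True K2 z \<epsilon> by (auto simp: dist_norm)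
    next
      case False
      then have "x \<notin> C" "x - z \<notin> C"
        using notK[OF False, of z] z \<epsilon> by auto
      then show ?thesis using \<psi>0 \<open>e > 0\<close> by simp
    qed
    define m where "m = integral (cbox a b) (bump 0 \<epsilon>)"
    have m: "m > 0" unfolding m_def using \<epsilon> ab by (intro bump_integral_pos) (auto simp: subset_iff)
    define \<eta> where "\<eta> x = bump 0 \<epsilon> x * (1 / m)" for x :: 'a
    have \<eta>: "smooth_fn \<eta>" unfolding \<eta>_def[abs_def] by (intro smooth_fn.mult smooth_fn.const bump_smooth)
    note c\<eta> = smooth_fn_continuous[OF \<eta>]
    have \<eta>0: "\<eta> z = 0" if "\<epsilon> \<le> norm z" for z
      using that \<epsilon> by (simp add: \<eta>_def bump_eq_0_iff)
    have \<eta>nn: "0 \<le> \<eta> z" for z using m by (simp add: \<eta>_def bump_nonneg)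
    have \<eta>1: "integral (cbox a b) \<eta> = 1"
      using m by (simp add: \<eta>_def[abs_def] m_def)
    define \<Phi> where "\<Phi> x = integral (cbox a b) (\<lambda>z. \<phi> z * \<eta> (x - z))" for x
    define G where "G x = integral (cbox a b) (\<lambda>z. \<eta> z *\<^sub>R \<psi> (x - z))" for x
    have c\<eta>': "continuous_on UNIV (\<lambda>z. \<eta> (x - z))" "continuous_on UNIV (\<lambda>z. \<phi> (x - z))"
        "continuous_on S (\<lambda>z. \<psi> (x - z))" for x S
      by (auto intro: continuous_on_compose2[OF c\<eta>[of UNIV] continuous_on_diff[OF continuous_on_const continuous_on_id]]
          continuous_on_compose2[OF c\<phi> continuous_on_diff[OF continuous_on_const continuous_on_id]]
          continuous_on_compose2[OF \<psi> continuous_on_diff[OF continuous_on_const continuous_on_id]])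
    \<comment> \<open>The defining formula, with the derivatives on the kernel, shows that \<Phi> is
      smooth. This one puts the derivative on \<phi> and identifies the gradient as the
      mollification \<open>G\<close> of \<psi>.\<close>
    have \<Phi>2: "\<Phi> x = integral (cbox a b) (\<lambda>z. \<eta> z * \<phi> (x - z))" for x
    proof -
      have "\<Phi> x = (\<integral>z. \<phi> z * \<eta> (x - z) \<partial>lborel)"
        unfolding \<Phi>_def using C ab by (intro integral_cbox_eq_lborel continuous_intros c\<phi> c\<eta>') auto
      also have "\<dots> = (\<integral>z. \<phi> (x - z) * \<eta> (x - (x - z)) \<partial>lborel)"
        by (rule lborel_integral_reflect_translate[symmetric])
      also have "\<dots> = (\<integral>z. \<eta> z * \<phi> (x - z) \<partial>lborel)" by (simp add: mult.commute)
      also have "\<dots> = integral (cbox a b) (\<lambda>z. \<eta> z * \<phi> (x - z))"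
      proof (rule integral_cbox_eq_lborel[symmetric])
        show "continuous_on UNIV (\<lambda>z. \<eta> z * \<phi> (x - z))" by (intro continuous_intros c\<eta> c\<eta>')
        fix z assume "z \<notin> cbox a b"
        then have "\<epsilon> \<le> norm z" using ab(2) \<epsilon>(2) by (cases "norm z \<le> \<epsilon>0") (auto simp: subset_iff)
        then show "\<eta> z * \<phi> (x - z) = 0" by (simp add: \<eta>0)
      qed
      finally show ?thesis .
    qed
    have grad: "(\<Phi> has_derivative (\<lambda>h. h \<bullet> G x)) (at x)" for x
      unfolding \<Phi>2[abs_def] G_def by (rule has_grad_convolution[OF \<phi> \<psi> c\<eta>])
    have Gc: "norm (G x - \<psi> x) \<le> e" for x
    proof -
      have i: "(\<lambda>z. \<eta> z *\<^sub>R \<psi> (x - z)) integrable_on cbox a b" "\<eta> integrable_on cbox a b"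
        by (auto intro!: integrable_continuous continuous_intros c\<eta>' c\<eta>)
      have "G x - \<psi> x = integral (cbox a b) (\<lambda>z. \<eta> z *\<^sub>R \<psi> (x - z)) - integral (cbox a b) (\<lambda>z. \<eta> z *\<^sub>R \<psi> x)"
        using integral_unique[OF has_integral_scaleR_left[OF integrable_integral[OF i(2)], of "\<psi> x"]]
        by (simp add: \<eta>1 G_def)
      also have "\<dots> = integral (cbox a b) (\<lambda>z. \<eta> z *\<^sub>R (\<psi> (x - z) - \<psi> x))"
        using i by (subst Henstock_Kurzweil_Integration.integral_diff[symmetric])
          (auto intro!: integrable_continuous continuous_intros c\<eta> simp: scaleR_diff_right)
      also have "norm \<dots> \<le> integral (cbox a b) (\<lambda>z. \<eta> z * e)"
      proof (rule integral_norm_bound_integral)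
        fix z assume "z \<in> cbox a b"
        show "norm (\<eta> z *\<^sub>R (\<psi> (x - z) - \<psi> x)) \<le> \<eta> z * e"
          using close[of z x] \<eta>0[of z] \<eta>nn[of z]
          by (cases "norm z < \<epsilon>") (auto intro!: mult_left_mono)
      qed (auto intro!: integrable_continuous continuous_intros c\<eta> c\<eta>')
      also have "\<dots> = e" using \<eta>1 by simp
      finally show ?thesis .
    qed
    have cG: "continuous_on UNIV G"
    proof -
      have "C_k 1 (\<lambda>x. integral (cbox a b) (\<lambda>z. \<phi> z * \<eta> (x - z)))"
        by (rule convolution_C_k[OF c\<phi> \<eta>])
      then have "\<forall>v\<in>Basis. continuous_on UNIV (partial_within UNIV v \<Phi>)"
        by (simp add: \<Phi>_def[abs_def])
      then show ?thesis
        by (subst continuous_on_componentwise) (simp add: partial_UNIV_grad[OF grad, abs_def] inner_commute)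
    qed
    have \<Phi>0: "\<Phi> x = 0" "G x = 0" if "x \<notin> K" for x
    proof -
      have nC: "x - z \<notin> C" if "norm z < \<epsilon>" for z
        using notK[OF \<open>x \<notin> K\<close>, of z] that \<epsilon> by auto
      have "(\<lambda>z. \<eta> z * \<phi> (x - z)) = (\<lambda>z. 0)" "(\<lambda>z. \<eta> z *\<^sub>R \<psi> (x - z)) = (\<lambda>z. 0)"
        using nC C(3) \<psi>0 \<eta>0 by (force simp: fun_eq_iff)+
      then show "\<Phi> x = 0" "G x = 0" by (simp_all only: \<Phi>2 G_def integral_0)
    qed
    have supp: "closure {x. \<Phi> x \<noteq> 0} \<subseteq> K"
      using \<Phi>0 K(1) by (intro closure_minimal compact_imp_closed) auto
    have "test_fun \<Omega> \<Phi>"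
      unfolding test_fun_def
    proof (intro conjI allI)
      show "C_k k \<Phi>" for k unfolding \<Phi>_def[abs_def] by (rule convolution_C_k[OF c\<phi> \<eta>])
      show "compact (closure {x. \<Phi> x \<noteq> 0})"
        using compact_Int_closed[OF K(1) closed_closure[of "{x. \<Phi> x \<noteq> 0}"]] supp by (simp add: Int_absorb1)
      show "closure {x. \<Phi> x \<noteq> 0} \<subseteq> \<Omega>" using supp K(2) by blast
    qed
    from weak[OF this] have "(LINT x|lebesgue_on \<Omega>. F x \<bullet> G x) = 0"
      by (simp add: partial_UNIV_grad[OF grad] euclidean_inner[of "F _"] inner_commute)
    moreover have "(LINT x|lebesgue_on \<Omega>. F x \<bullet> G x) = (LINT x:\<Omega>|lborel. F x \<bullet> G x)"
      using \<open>open \<Omega>\<close> continuous_on_subset[OF cG]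
      by (intro lebesgue_on_eq_lborel set_borel_measurable_continuous_borel continuous_intros F) auto
    moreover have "\<dots> = (LINT x:K|lborel. F x \<bullet> G x)"
      using K \<Phi>0 by (intro set_integral_eq_subset) auto
    ultimately have "I = (LINT x:K|lborel. F x \<bullet> \<psi> x) - (LINT x:K|lborel. F x \<bullet> G x)"
      by (simp add: I_def)
    also have "\<dots> = (LINT x:K|lborel. F x \<bullet> \<psi> x - F x \<bullet> G x)"
      by (rule set_integral_diff(2)[symmetric]) (intro intK \<psi> cG)+
    also have "\<bar>\<dots>\<bar> \<le> (LINT x:K|lborel. \<bar>F x \<bullet> \<psi> x - F x \<bullet> G x\<bar>)"
      using set_integral_norm_bound[OF set_integral_diff(1)[OF intK[OF \<psi>] intK[OF cG]]] by simp
    also have "\<dots> \<le> (LINT x:K|lborel. e * norm (F x))"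
    proof (rule set_integral_mono)
      show "set_integrable lborel K (\<lambda>x. \<bar>F x \<bullet> \<psi> x - F x \<bullet> G x\<bar>)"
        by (intro set_integrable_abs set_integral_diff(1) intK \<psi> cG)
      show "set_integrable lborel K (\<lambda>x. e * norm (F x))" using intF by simp
      fix x
      have "\<bar>F x \<bullet> \<psi> x - F x \<bullet> G x\<bar> \<le> norm (F x) * norm (G x - \<psi> x)"
        using Cauchy_Schwarz_ineq2[of "F x" "G x - \<psi> x"] by (simp add: inner_diff_right abs_minus_commute)
      also have "\<dots> \<le> norm (F x) * e" by (intro mult_left_mono Gc) auto
      finally show "\<bar>F x \<bullet> \<psi> x - F x \<bullet> G x\<bar> \<le> e * norm (F x)" by (simp add: mult.commute)
    qed
    also have "\<dots> = e * M" by (simp add: M_def)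
    finally show ?thesis .
  qed
  have "\<bar>I\<bar> \<le> 0 + e" if "e > 0" for e
  proof -
    have "\<bar>I\<bar> \<le> e / (M + 1) * M" using that \<open>M \<ge> 0\<close> by (intro bound) auto
    also have "\<dots> \<le> e" using that \<open>M \<ge> 0\<close> by (simp add: divide_simps)
    finally show ?thesis by simp
  qed
  then have "\<bar>I\<bar> \<le> 0" by (rule field_le_epsilon)
  then have "I = 0" by simp
  moreover have "\<psi> x = 0" if "x \<notin> K" for x using \<psi>0 K(3) that by blast
  then have "(LINT x:\<Omega>|lborel. F x \<bullet> \<psi> x) = I"
    unfolding I_def using K by (intro set_integral_eq_subset) auto
  ultimately show ?thesis by simp
qed

section \<open>Recovering the boundary inequality from the interior equation\<close>

subsection \<open>The weak equation up to the thin boundary\<close>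

text \<open>A transition from 0 to 1 that is only C^1, which suffices after
  \<open>weak_eq_C1\<close>; the explicit quotient makes the slope bound 2 elementary.\<close>

definition cutoff :: "real \<Rightarrow> real" where
  "cutoff u = (max 0 u)\<^sup>2 / ((max 0 u)\<^sup>2 + (max 0 (1 - u))\<^sup>2)"

definition cutoff' :: "real \<Rightarrow> real" where
  "cutoff' u = 2 * max 0 u * max 0 (1 - u) * (max 0 u + max 0 (1 - u)) / ((max 0 u)\<^sup>2 + (max 0 (1 - u))\<^sup>2)\<^sup>2"

lemma cutoff_denom_pos: "0 < (max 0 u)\<^sup>2 + (max 0 (1 - u))\<^sup>2" for u :: real
  by (cases "u > 0") (auto intro: add_pos_nonneg add_nonneg_pos simp: max_def)

lemma cutoff_denom_nz: "(max 0 u)\<^sup>2 + (max 0 (1 - u))\<^sup>2 \<noteq> 0" for u :: real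
  using cutoff_denom_pos[of u] by linarith

lemma max0_square_has_derivative: "((\<lambda>u. (max 0 u)\<^sup>2) has_real_derivative 2 * max 0 u) (at u)" for u :: real
proof -
  consider "u < 0" | "u = 0" | "u > 0" by linarith
  then show ?thesis
  proof cases
    case 1
    have "((\<lambda>_. 0) has_real_derivative 0) (at u)" by simp
    then have "((\<lambda>u. (max 0 u)\<^sup>2) has_real_derivative 0) (at u)"
      by (rule has_field_derivative_transform_within_open[where S="{..<0}"]) (use 1 in auto)
    then show ?thesis using 1 by simp
  next
    case 3
    have "((\<lambda>u. u\<^sup>2) has_real_derivative 2 * u) (at u)" by (auto intro!: derivative_eq_intros)
    then have "((\<lambda>u. (max 0 u)\<^sup>2) has_real_derivative 2 * u) (at u)"
      by (rule has_field_derivative_transform_within_open[where S="{0<..}"]) (use 3 in auto)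
    then show ?thesis using 3 by simp
  next
    case 2
    have "((\<lambda>h. \<bar>h\<bar>) \<longlongrightarrow> 0) (at (0::real))" by (auto intro!: tendsto_eq_intros)
    then have "((\<lambda>h. (max 0 h)\<^sup>2 / h) \<longlongrightarrow> 0) (at (0::real))"
      by (rule Lim_null_comparison[rotated])
        (auto intro!: eventuallyI simp: max_def power2_eq_square)
    then show ?thesis using 2 by (simp add: has_field_derivative_iff)
  qed
qed

lemma cutoff_has_derivative: "(cutoff has_real_derivative cutoff' u) (at u)"
proof -
  have r: "((\<lambda>u. (max 0 (1 - u))\<^sup>2) has_real_derivative - (2 * max 0 (1 - u))) (at u)"
  proof -
    have "((\<lambda>u. 1 - u) has_real_derivative -1) (at u)" by (auto intro!: derivative_eq_intros)
    from DERIV_chain2[OF max0_square_has_derivative this] show ?thesis by simp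
  qed
  have "(cutoff has_real_derivative
    ((2 * max 0 u) * ((max 0 u)\<^sup>2 + (max 0 (1 - u))\<^sup>2) -
     (max 0 u)\<^sup>2 * (2 * max 0 u + - (2 * max 0 (1 - u)))) /
    (((max 0 u)\<^sup>2 + (max 0 (1 - u))\<^sup>2) * ((max 0 u)\<^sup>2 + (max 0 (1 - u))\<^sup>2))) (at u)"
    unfolding cutoff_def[abs_def] using cutoff_denom_pos[of u]
    by (intro DERIV_divide DERIV_add max0_square_has_derivative r) auto
  then show ?thesis
    by (rule DERIV_cong) (simp add: cutoff'_def power2_eq_square algebra_simps)
qed

lemma cutoff_0: "u \<le> 0 \<Longrightarrow> cutoff u = 0" and cutoff'_0: "u \<le> 0 \<Longrightarrow> cutoff' u = 0"
  and cutoff_1: "1 \<le> u \<Longrightarrow> cutoff u = 1" and cutoff'_1: "1 \<le> u \<Longrightarrow> cutoff' u = 0"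
  by (auto simp: cutoff_def cutoff'_def)

lemma cutoff'_nonneg: "0 \<le> cutoff' u"
  by (simp add: cutoff'_def)

lemma cutoff_bounds: "0 \<le> cutoff u" "cutoff u \<le> 1"
  using cutoff_denom_pos[of u] by (auto simp: cutoff_def divide_le_eq_1)

lemma cutoff'_le: "cutoff' u \<le> 2"
proof (cases "0 < u \<and> u < 1")
  case True
  have "1/2 \<le> u\<^sup>2 + (1 - u)\<^sup>2"
    using zero_le_power2[of "2 * u - 1"] by (simp add: power2_eq_square algebra_simps)
  then have "(1/2)\<^sup>2 \<le> (u\<^sup>2 + (1 - u)\<^sup>2)\<^sup>2" by (intro power_mono) auto
  moreover have "u * (1 - u) \<le> 1/4"
    using zero_le_power2[of "2 * u - 1"] by (simp add: power2_eq_square algebra_simps)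
  ultimately have "2 * u * (1 - u) \<le> 2 * (u\<^sup>2 + (1 - u)\<^sup>2)\<^sup>2"
    by (simp add: power2_eq_square)
  then show ?thesis
    using True cutoff_denom_pos[of u] by (simp add: cutoff'_def divide_le_eq)
next
  case False
  then show ?thesis using cutoff'_0[of u] cutoff'_1[of u] by (cases "u \<le> 0") auto
qed

lemma continuous_on_cutoff' [continuous_intros]:
  "continuous_on S f \<Longrightarrow> continuous_on S (\<lambda>x. cutoff' (f x))"
  unfolding cutoff'_def by (intro continuous_on_divide continuous_intros ballI power_not_zero cutoff_denom_nz)

lemma continuous_on_cutoff [continuous_intros]:
  "continuous_on S f \<Longrightarrow> continuous_on S (\<lambda>x. cutoff (f x))"
  unfolding cutoff_def by (intro continuous_on_divide continuous_intros ballI power_not_zero cutoff_denom_nz)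

lemma half_ball_eq: "half_ball 0 1 = {x. (0, 1) \<bullet> x \<ge> 0} \<inter> ball (0 :: 'n::finite pt) 1"
  by (auto simp: half_ball_def inner_prod_def)

lemma interior_half_ball: "interior (half_ball (0 :: 'n::finite pt) 1) = {x. 0 < snd x \<and> norm x < 1}"
proof -
  have "interior {x :: 'n pt. (0, 1) \<bullet> x \<ge> 0} = {x. (0, 1) \<bullet> x > 0}"
    using interior_halfspace_ge[of "(0, 1) :: 'n pt" 0] by (simp add: zero_prod_def)
  then show ?thesis
    unfolding half_ball_eq interior_Int by (auto simp: inner_prod_def)
qed

lemma half_space_null: "{x :: 'n::finite pt. snd x = 0} \<in> null_sets lborel"
proof -
  have "negligible {x :: 'n pt. (0, 1) \<bullet> x = 0}"
    by (rule negligible_hyperplane) (simp add: zero_prod_def)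
  moreover have "{x :: 'n pt. (0, 1) \<bullet> x = 0} = {x. snd x = 0}"
    by (auto simp: inner_prod_def)
  moreover have "{x :: 'n pt. snd x = 0} \<in> sets borel"
    by (intro borel_closed closed_Collect_eq continuous_intros)
  ultimately show ?thesis
    by (simp add: negligible_iff_null_sets null_sets_def)
qed

text \<open>Formally the integral is minus the integral of \<open>\<phi> x * snd (F x)\<close> over
  the thin set, and \<open>sign\<close> makes that nonnegative. The test function is cut off below
  height h. The gradient of the cutoff lives in a slab of volume \<open>B * h\<close> and has size
  at most 2 / h, so it contributes at most \<open>2 * B\<close> times an upper bound of
  \<open>\<phi> x * snd (F x)\<close> on the slab, and by continuity such a bound can be taken
  arbitrarily small near the thin set.\<close>

lemma weak_ineq_up_to_boundary:
  fixes F :: "'n::finite pt \<Rightarrow> 'n pt" and \<phi> :: "'n pt \<Rightarrow> real"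
  defines "Hb \<equiv> half_ball (0 :: 'n pt) 1" and "P \<equiv> {x :: 'n pt. 0 \<le> snd x}"
  assumes F: "continuous_on Hb F"
    and weak: "\<And>\<phi>. test_fun (interior Hb) \<phi> \<Longrightarrow>
        (LINT x|lebesgue_on (interior Hb). (\<Sum>i\<in>Basis. (F x \<bullet> i) * partial_within UNIV i \<phi> x)) = 0"
    and \<phi>: "\<And>x. x \<in> P \<Longrightarrow> (\<phi> has_derivative (\<lambda>h. h \<bullet> \<psi> x)) (at x within P)"
    and \<psi>: "continuous_on P \<psi>"
    and C: "compact C" "C \<subseteq> Hb" "\<And>x. x \<in> P - C \<Longrightarrow> \<phi> x = 0" "\<And>x. x \<in> P - C \<Longrightarrow> \<psi> x = 0"
    and sign: "\<And>x. x \<in> C \<Longrightarrow> snd x = 0 \<Longrightarrow> \<phi> x * snd (F x) \<le> 0"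
  shows "0 \<le> (LINT x:Hb|lborel. F x \<bullet> \<psi> x)"
proof -
  define \<Omega> where "\<Omega> = interior Hb"
  have \<Omega>: "\<Omega> = {x. 0 < snd x \<and> norm x < 1}" unfolding \<Omega>_def Hb_def by (rule interior_half_ball)
  have [simp]: "open \<Omega>" by (simp add: \<Omega>_def)
  have sub: "\<Omega> \<subseteq> Hb" "Hb \<subseteq> P" by (auto simp: \<Omega> Hb_def P_def half_ball_def)
  have c\<phi>: "continuous_on P \<phi>" using \<phi> by (rule grad_imp_continuous_on)
  have CP: "C \<subseteq> P" using C sub by blast
  define f where "f x = \<phi> x * snd (F x)" for x
  have cf: "continuous_on C f" unfolding f_def
    using continuous_on_subset[OF c\<phi> CP] continuous_on_subset[OF F C(2)] by (intro continuous_intros)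
  \<comment> \<open>The cutoff is 0 up to height h and 1 from height 2 * h on, so the cut test
    function has compact support in the open half ball.\<close>
  define \<theta> where "\<theta> h x = cutoff (snd x / h - 1)" for h and x :: "'n pt"
  define \<theta>' where "\<theta>' h x = cutoff' (snd x / h - 1) / h" for h and x :: "'n pt"
  define J where "J = (LINT x:C|lborel. F x \<bullet> \<psi> x)"
  define B where "B = measure lborel (cbox (- One) (One) :: (real^'n) set)"
  have iC: "set_integrable lborel C g" if "continuous_on C g" for g :: "'n pt \<Rightarrow> real"
    unfolding set_integrable_def using borel_integrable_compact[OF C(1) that] .
  have cF: "continuous_on C (\<lambda>x. F x \<bullet> \<psi> x)"
    using continuous_on_subset[OF \<psi> CP] continuous_on_subset[OF F C(2)] by (intro continuous_intros)
  have c\<theta>: "continuous_on S (\<theta> h)" "continuous_on S (\<theta>' h)" if "h > 0" for h S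
    unfolding \<theta>_def[abs_def] \<theta>'_def[abs_def] using that by (auto intro!: continuous_intros)
  have split: "(LINT x:C|lborel. \<theta> h x * (F x \<bullet> \<psi> x)) = - (LINT x:C|lborel. \<theta>' h x * f x)" if h: "h > 0" for h
  proof -
    define \<Phi> where "\<Phi> x = (if 0 < snd x then \<theta> h x * \<phi> x else 0)" for x
    define \<Psi> where "\<Psi> x = (if 0 < snd x then \<theta> h x *\<^sub>R \<psi> x + (\<theta>' h x * \<phi> x) *\<^sub>R (0, 1) else 0)" for x
    have z: "\<theta> h x = 0" "\<theta>' h x = 0" if "snd x < h" for x
      using that h by (auto simp: \<theta>_def \<theta>'_def field_simps intro!: cutoff_0 cutoff'_0)
    have op: "open {x :: 'n pt. 0 < snd x}" "open {x :: 'n pt. snd x < h}"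
      by (auto intro!: open_Collect_less continuous_intros)
    have d\<theta>: "(\<theta> h has_derivative (\<lambda>k. snd k * \<theta>' h x)) (at x)" for x
    proof -
      have "((\<lambda>x :: 'n pt. snd x / h - 1) has_derivative (\<lambda>k. snd k / h)) (at x)"
        using h by (auto intro!: derivative_eq_intros)
      from has_derivative_compose[OF this cutoff_has_derivative[unfolded has_field_derivative_def]]
      show ?thesis by (simp add: \<theta>_def[abs_def] \<theta>'_def mult.commute)
    qed
    have "(\<Phi> has_derivative (\<lambda>k. k \<bullet> \<Psi> x)) (at x)" for x
    proof (cases "0 < snd x")
      case True
      have iP: "x \<in> interior P"
        by (rule interiorI[OF op(1)]) (use True in \<open>auto simp: P_def\<close>)
      then have xP: "x \<in> P" using interior_subset by (rule_tac subsetD)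
      have d\<phi>: "(\<phi> has_derivative (\<lambda>h. h \<bullet> \<psi> x)) (at x)"
        using \<phi>[OF xP] unfolding at_within_interior[OF iP] .
      have "((\<lambda>x. \<theta> h x * \<phi> x) has_derivative (\<lambda>k. k \<bullet> \<Psi> x)) (at x)"
        by (rule has_derivative_eq_rhs[OF has_derivative_mult[OF d\<theta> d\<phi>]])
          (use True in \<open>auto simp: \<Psi>_def inner_add_right inner_prod_def algebra_simps\<close>)
      then show ?thesis
        by (rule has_derivative_transform_within_open[OF _ op(1)]) (use True in \<open>auto simp: \<Phi>_def\<close>)
    next
      case False
      have "((\<lambda>_. 0) has_derivative (\<lambda>k. k \<bullet> \<Psi> x)) (at x)" using False by (simp add: \<Psi>_def)
      then show ?thesis
        by (rule has_derivative_transform_within_open[OF _ op(2)]) (use False h z in \<open>auto simp: \<Phi>_def\<close>)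
    qed
    moreover have "continuous_on UNIV \<Psi>"
    proof -
      have "continuous_on {x. 0 < snd x} \<Psi>"
      proof (rule continuous_on_eq)
        show "continuous_on {x. 0 < snd x} (\<lambda>x. \<theta> h x *\<^sub>R \<psi> x + (\<theta>' h x * \<phi> x) *\<^sub>R (0, 1))"
          by (intro continuous_intros c\<theta> h continuous_on_subset[OF \<psi>] continuous_on_subset[OF c\<phi>])
            (auto simp: P_def)
      qed (auto simp: \<Psi>_def)
      moreover have "continuous_on {x. snd x < h} \<Psi>"
        by (rule continuous_on_eq[of _ "\<lambda>_. 0"]) (auto simp: \<Psi>_def z zero_prod_def)
      ultimately have "continuous_on ({x. 0 < snd x} \<union> {x. snd x < h}) \<Psi>"
        by (intro continuous_on_open_Un op)
      moreover have "{x. 0 < snd x} \<union> {x. snd x < h} = (UNIV :: 'n pt set)" using h by auto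
      ultimately show ?thesis by simp
    qed
    moreover have "compact (C \<inter> {x. h \<le> snd x})"
      by (intro compact_Int_closed C closed_Collect_le continuous_intros)
    moreover have "C \<inter> {x. h \<le> snd x} \<subseteq> \<Omega>"
      using C(2) h by (auto simp: \<Omega> Hb_def half_ball_def)
    moreover have "\<Phi> x = 0" if "x \<notin> C \<inter> {x. h \<le> snd x}" for x
      using that C(3)[of x] z[of x] by (auto simp: \<Phi>_def P_def not_le)
    ultimately have "(LINT x:\<Omega>|lborel. F x \<bullet> \<Psi> x) = 0"
      using F weak sub(1) unfolding \<Omega>_def
      by (intro weak_eq_C1[where \<phi>=\<Phi> and C="C \<inter> {x. h \<le> snd x}"]) (auto intro: continuous_on_subset)
    moreover have "(LINT x:\<Omega>|lborel. F x \<bullet> \<Psi> x) = (LINT x:C \<inter> \<Omega>|lborel. F x \<bullet> \<Psi> x)"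
    proof (rule set_integral_eq_subset)
      fix x assume "x \<in> \<Omega> - C \<inter> \<Omega>"
      then have "x \<in> P - C" using sub by blast
      then show "F x \<bullet> \<Psi> x = 0" using C(3,4) by (simp add: \<Psi>_def zero_prod_def[symmetric])
    qed simp
    moreover have "(LINT x:C|lborel. \<theta> h x * (F x \<bullet> \<psi> x) + \<theta>' h x * f x) = 
        (LINT x:C \<inter> \<Omega>|lborel. \<theta> h x * (F x \<bullet> \<psi> x) + \<theta>' h x * f x)"
    proof (intro set_integral_eq_subset)
      fix x assume "x \<in> C - C \<inter> \<Omega>"
      then have "snd x < h" using C(2) h by (auto simp: \<Omega> Hb_def half_ball_def)
      then show "\<theta> h x * (F x \<bullet> \<psi> x) + \<theta>' h x * f x = 0" by (simp add: z)
    qed auto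
    moreover have "(LINT x:C \<inter> \<Omega>|lborel. F x \<bullet> \<Psi> x) = (LINT x:C \<inter> \<Omega>|lborel. \<theta> h x * (F x \<bullet> \<psi> x) + \<theta>' h x * f x)"
    proof (rule set_lebesgue_integral_cong)
      show "C \<inter> \<Omega> \<in> sets lborel" using C(1) by (simp add: sets.Int borel_compact)
      show "\<forall>x. x \<in> C \<inter> \<Omega> \<longrightarrow> F x \<bullet> \<Psi> x = \<theta> h x * (F x \<bullet> \<psi> x) + \<theta>' h x * f x"
        by (auto simp: \<Psi>_def f_def \<Omega> inner_add_right inner_prod_def algebra_simps)
    qed
    ultimately have "(LINT x:C|lborel. \<theta> h x * (F x \<bullet> \<psi> x) + \<theta>' h x * f x) = 0" by simp
    then show ?thesis
      by (subst (asm) set_integral_add) (auto intro!: iC continuous_intros c\<theta> h cF cf)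
  qed
  have small: "- (e * (2 * B)) \<le> J" if e: "e > 0" for e
  proof -
    \<comment> \<open>On the compact set where \<open>f\<close> is at least \<open>e\<close> the
      height attains its minimum, which is positive because \<open>f\<close> is nonpositive at
      height 0.\<close>
    obtain h0 where h0: "h0 > 0" "\<And>x. x \<in> C \<Longrightarrow> snd x < h0 \<Longrightarrow> f x \<le> e"
    proof (cases "{x \<in> C. e \<le> f x} = {}")
      case True
      then have "f x \<le> e" if "x \<in> C" for x
        using that by (metis (mono_tags, lifting) empty_iff mem_Collect_eq linear)
      then show ?thesis using that[of 1] by auto
    next
      case False
      have "{x \<in> C. e \<le> f x} = C \<inter> f -` {e..}" by auto
      moreover have "compact (C \<inter> f -` {e..})"
        using cf C(1) compact_Int_closed[OF C(1)]
        by (metis closed_atLeast compact_imp_closed continuous_on_closed_vimage Int_absorb inf_commute inf_assoc inf_left_idem)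
      ultimately have "compact {x \<in> C. e \<le> f x}" by simp
      from continuous_attains_inf[OF this False, of snd] obtain x0 where x0: "x0 \<in> C" "e \<le> f x0"
        "\<And>y. y \<in> C \<Longrightarrow> e \<le> f y \<Longrightarrow> snd x0 \<le> snd y"
        using continuous_on_snd[OF continuous_on_id] by blast
      have "snd x0 > 0"
        using sign[OF x0(1)] x0(1,2) e CP unfolding f_def by (cases "snd x0 = 0") (auto simp: P_def)
      then show ?thesis using that[of "snd x0"] x0(3) by force
    qed
    \<comment> \<open>The factor 3 keeps 2 * \<open>hk k\<close> below \<open>h0\<close>, so the
      whole transition slab lies where \<open>f\<close> is at most \<open>e\<close>.\<close>
    define hk where "hk k = h0 / (3 * (1 + real k))" for k
    have hk: "hk k > 0" "2 * hk k < h0" for k using h0 by (auto simp: hk_def divide_simps)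
    have hk0: "hk \<longlonglongrightarrow> 0"
    proof -
      have "(\<lambda>k. (h0 / 3) * inverse (real (Suc k))) \<longlonglongrightarrow> (h0 / 3) * 0"
        by (intro tendsto_mult tendsto_const LIMSEQ_inverse_real_of_nat)
      then show ?thesis by (simp add: hk_def[abs_def] field_simps)
    qed
    have lower: "- (e * (2 * B)) \<le> (LINT x:C|lborel. \<theta> (hk k) x * (F x \<bullet> \<psi> x))" for k
    proof -
      define h where "h = hk k"
      have h: "h > 0" "2 * h < h0" using hk by (auto simp: h_def)
      define Sl where "Sl = cbox (- One, h) (One :: real^'n, 2 * h)"
      have mSl: "measure lborel Sl = B * h" unfolding Sl_def content_Pair B_def using h by simp
      have "(LINT x:C|lborel. \<theta>' h x * f x) \<le> (LINT x:Sl|lborel. 2 / h * e)"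
        unfolding set_lebesgue_integral_def
      proof (rule integral_mono)
        show "integrable lborel (\<lambda>x. indicat_real C x *\<^sub>R (\<theta>' h x * f x))"
          by (intro iC[unfolded set_integrable_def] continuous_intros c\<theta> cf h(1))
        show "integrable lborel (\<lambda>x. indicat_real Sl x *\<^sub>R (2 / h * e))"
          unfolding Sl_def by (intro borel_integrable_compact) auto
        fix x :: "'n pt"
        show "indicat_real C x *\<^sub>R (\<theta>' h x * f x) \<le> indicat_real Sl x *\<^sub>R (2 / h * e)"
        proof (cases "x \<in> C \<and> h \<le> snd x \<and> snd x \<le> 2 * h")
          case True
          have "norm x < 1" using True C(2) by (auto simp: Hb_def half_ball_def)
          have "x \<in> Sl"
          proof -
            have "norm (fst x) \<le> 1" using \<open>norm x < 1\<close> norm_fst_le[of "fst x" "snd x"] by simp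
            then have "\<bar>fst x \<bullet> i\<bar> \<le> 1" if "i \<in> Basis" for i
              using that Basis_le_norm order_trans by blast
            then have "fst x \<in> cbox (- One) One" by (auto simp: mem_box abs_le_iff)
            then have "(fst x, snd x) \<in> Sl" using True by (auto simp: Sl_def cbox_Pair_eq simp del: prod.collapse)
            then show ?thesis by simp
          qed
          moreover have "\<theta>' h x * f x \<le> 2 / h * e"
          proof -
            have "f x \<le> e" using h0(2)[of x] True h by auto
            moreover have "0 \<le> \<theta>' h x" "\<theta>' h x \<le> 2 / h"
              using h cutoff'_nonneg cutoff'_le by (auto simp: \<theta>'_def intro!: divide_right_mono)
            ultimately have "\<theta>' h x * f x \<le> \<theta>' h x * e" "\<theta>' h x * e \<le> 2 / h * e"
              using e mult_left_mono[of "f x" e "\<theta>' h x"] mult_right_mono[of "\<theta>' h x" "2 / h" e] by linarith+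
            then show ?thesis by linarith
          qed
          ultimately show ?thesis using True by simp
        next
          case False
          have "\<theta>' h x = 0" if "\<not> (h \<le> snd x \<and> snd x \<le> 2 * h)"
          proof -
            have "snd x / h - 1 \<le> 0 \<or> 1 \<le> snd x / h - 1"
              using that h(1) by (auto simp: field_simps not_le)
            then show ?thesis using cutoff'_0 cutoff'_1 by (auto simp: \<theta>'_def)
          qed
          then show ?thesis using False e h by (auto simp: indicator_def)
        qed
      qed
      also have "\<dots> = e * (2 * B)" proof -
        have "(LINT x:Sl|lborel. 2 / h * e) = measure lborel Sl * (2 / h * e)"
          unfolding set_lebesgue_integral_def Sl_def by simp
        then show ?thesis using h mSl by (simp add: field_simps)
      qed
      finally show ?thesis using split[OF h(1)] by (simp add: h_def)
    qed
    have "(\<lambda>k. LINT x:C|lborel. \<theta> (hk k) x * (F x \<bullet> \<psi> x)) \<longlonglongrightarrow> J"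
      unfolding J_def set_lebesgue_integral_def
    proof (rule integral_dominated_convergence[where w="\<lambda>x. indicat_real C x *\<^sub>R \<bar>F x \<bullet> \<psi> x\<bar>"])
      have "AE x in (lborel :: 'n pt measure). snd x \<noteq> 0"
        using AE_not_in[OF half_space_null] by eventually_elim simp
      then show "AE x in lborel. (\<lambda>k. indicat_real C x *\<^sub>R (\<theta> (hk k) x * (F x \<bullet> \<psi> x))) \<longlonglongrightarrow> indicat_real C x *\<^sub>R (F x \<bullet> \<psi> x)"
      proof eventually_elim
        case (elim x)
        show ?case
        proof (cases "x \<in> C")
          case True
          then have s: "snd x > 0" using elim CP by (auto simp: P_def order_le_less)
          have "eventually (\<lambda>k. hk k < snd x / 2) sequentially"
            using hk0 s by (intro order_tendstoD) auto
          then have "eventually (\<lambda>k. \<theta> (hk k) x = 1) sequentially"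
          proof eventually_elim
            case (elim k)
            then show ?case using hk(1)[of k] by (auto simp: \<theta>_def field_simps intro!: cutoff_1)
          qed
          then have "eventually (\<lambda>k. indicat_real C x *\<^sub>R (\<theta> (hk k) x * (F x \<bullet> \<psi> x)) = indicat_real C x *\<^sub>R (F x \<bullet> \<psi> x)) sequentially"
            by eventually_elim simp
          then show ?thesis by (rule tendsto_eventually)
        qed simp
      qed
      show "AE x in lborel. norm (indicat_real C x *\<^sub>R (\<theta> (hk k) x * (F x \<bullet> \<psi> x))) \<le> indicat_real C x *\<^sub>R \<bar>F x \<bullet> \<psi> x\<bar>" for k
        using cutoff_bounds by (intro AE_I2) (auto simp: \<theta>_def abs_mult indicator_def intro!: mult_left_le_one_le)
      show "(\<lambda>x. indicat_real C x *\<^sub>R (F x \<bullet> \<psi> x)) \<in> borel_measurable lborel"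
        by (intro borel_measurable_integrable iC[unfolded set_integrable_def] cF)
      show "(\<lambda>x. indicat_real C x *\<^sub>R (\<theta> (hk k) x * (F x \<bullet> \<psi> x))) \<in> borel_measurable lborel" for k
        by (intro borel_measurable_integrable iC[unfolded set_integrable_def] continuous_intros c\<theta> cF hk(1))
      show "integrable lborel (\<lambda>x. indicat_real C x *\<^sub>R \<bar>F x \<bullet> \<psi> x\<bar>)"
        by (intro iC[unfolded set_integrable_def] continuous_intros cF)
    qed
    then show ?thesis using lower by (intro LIMSEQ_le_const) auto
  qed
  have "B \<ge> 0" unfolding B_def by (rule measure_nonneg)
  have "0 \<le> J + e" if "e > 0" for e
  proof -
    have "- (e / (2 * B + 1) * (2 * B)) \<le> J" using that \<open>B \<ge> 0\<close> by (intro small) auto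
    moreover have "e / (2 * B + 1) * (2 * B) \<le> e" using that \<open>B \<ge> 0\<close> by (simp add: divide_simps)
    ultimately show ?thesis by linarith
  qed
  then have "0 \<le> J" by (rule field_le_epsilon)
  moreover have "(LINT x:Hb|lborel. F x \<bullet> \<psi> x) = J"
    unfolding J_def using C sub by (intro set_integral_eq_subset) auto
  ultimately show ?thesis by simp
qed

section \<open>Balls, spheres and homogeneous extensions for the norm of the inverse matrix\<close>

subsection \<open>Polar integration with respect to an anisotropic gauge\<close>

locale gauge_cone =
  fixes P :: "'a::euclidean_space set" and A0 B :: "'a \<Rightarrow> 'a" and d :: nat
  assumes d_eq: "d = DIM('a)"
    and closed_P: "closed P"
    and cone_P: "\<And>x t. x \<in> P \<Longrightarrow> 0 \<le> t \<Longrightarrow> t *\<^sub>R x \<in> P"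
    and lin_A0: "linear A0" and lin_B: "linear B"
    and sym_A0: "\<And>x y. A0 x \<bullet> y = x \<bullet> A0 y"
    and A0_B: "\<And>x. A0 (B x) = x"
    and B_lower: "\<And>x. x \<bullet> x \<le> 2 * (B x \<bullet> x)"
    and B_upper: "\<And>x. B x \<bullet> x \<le> 2 * (x \<bullet> x)"
begin

definition r :: "'a \<Rightarrow> real" where "r x = sqrt (B x \<bullet> x)"

text \<open>The origin is left out because the radial projection to a sphere is junk there.\<close>

definition E :: "real \<Rightarrow> 'a set" where "E \<rho> = {y \<in> P. 0 < r y \<and> r y < \<rho>}"

definition S :: "real \<Rightarrow> 'a set" where "S \<rho> = {y \<in> P. r y = \<rho>}"

definition I :: "('a \<Rightarrow> real) \<Rightarrow> real \<Rightarrow> real" where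
  "I f \<rho> = (LINT y:E \<rho>|lborel. f y)"

text \<open>The derivative of \<open>I f\<close>: the integral of \<open>f\<close> over \<open>S \<rho>\<close> with weight \<open>1 / \<bar>\<nabla>r\<bar>\<close>,
  written without surface measure through the extension of \<open>f\<close> that is homogeneous of degree 0.\<close>

definition \<sigma> :: "('a \<Rightarrow> real) \<Rightarrow> real \<Rightarrow> real" where
  "\<sigma> f \<rho> = real d * \<rho> ^ (d - 1) * (LINT y:E 1|lborel. f ((\<rho> / r y) *\<^sub>R y))"

text \<open>Continuity is asked only off the origin, with bounds on the smaller balls, since
  functions involving the unit normal are discontinuous at the origin.\<close>

definition adm :: "real \<Rightarrow> ('a \<Rightarrow> real) \<Rightarrow> bool" where
  "adm R f \<longleftrightarrow> continuous_on (E R) f \<and> (\<forall>\<rho><R. \<exists>M. \<forall>y\<in>E \<rho>. \<bar>f y\<bar> \<le> M)"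

lemma B_nonneg: "0 \<le> B x \<bullet> x"
  using B_lower[of x] inner_ge_zero[of x] by linarith

lemma r_nonneg [simp]: "0 \<le> r x" by (simp add: r_def B_nonneg)

lemma r_square: "(r x)\<^sup>2 = B x \<bullet> x" by (simp add: r_def B_nonneg)

lemma r_zero [simp]: "r 0 = 0" by (simp add: r_def)

lemma r_scale: "r (c *\<^sub>R x) = \<bar>c\<bar> * r x"
  by (simp add: r_def linear_scale[OF lin_B] real_sqrt_mult)

lemma norm_le_r: "norm x \<le> 2 * r x"
proof (rule power2_le_imp_le)
  have "(norm x)\<^sup>2 \<le> 2 * (r x)\<^sup>2" using B_lower[of x] by (simp add: power2_norm_eq_inner r_square)
  moreover have "(2 * r x)\<^sup>2 = 4 * (r x)\<^sup>2" by (simp add: power_mult_distrib)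
  ultimately show "(norm x)\<^sup>2 \<le> (2 * r x)\<^sup>2" using zero_le_power2[of "r x"] by linarith
qed simp

lemma r_le_norm: "r x \<le> 2 * norm x"
proof (rule power2_le_imp_le)
  have "(r x)\<^sup>2 \<le> 2 * (norm x)\<^sup>2" using B_upper[of x] by (simp add: power2_norm_eq_inner r_square)
  moreover have "(2 * norm x)\<^sup>2 = 4 * (norm x)\<^sup>2" by (simp add: power_mult_distrib)
  ultimately show "(r x)\<^sup>2 \<le> (2 * norm x)\<^sup>2" using zero_le_power2[of "norm x"] by linarith
qed simp

lemma r_eq_0_iff [simp]: "r x = 0 \<longleftrightarrow> x = 0"
  using norm_le_r[of x] by auto

lemma r_pos_iff: "0 < r x \<longleftrightarrow> x \<noteq> 0"
  using r_nonneg[of x] r_eq_0_iff[of x] by linarith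

lemma continuous_on_r [continuous_intros]: "continuous_on T f \<Longrightarrow> continuous_on T (\<lambda>x. r (f x))"
proof -
  assume f: "continuous_on T f"
  show ?thesis unfolding r_def
    using bounded_linear.continuous_on[OF linear_conv_bounded_linear[THEN iffD1, OF lin_B] f] f by (intro continuous_intros)
qed

lemma r_has_derivative:
  assumes "x \<noteq> 0"
  shows "(r has_derivative (\<lambda>h. h \<bullet> ((1 / r x) *\<^sub>R B x))) (at x)"
proof -
  have symB: "B y \<bullet> x = B x \<bullet> y" for x y
    by (metis A0_B sym_A0 inner_commute)
  have d1: "((\<lambda>x. B x \<bullet> x) has_derivative (\<lambda>h. B h \<bullet> x + B x \<bullet> h)) (at x)"
    using lin_B by (auto intro!: derivative_eq_intros linear_imp_has_derivative)
  have "B x \<bullet> x > 0" using assms r_pos_iff[of x] r_square[of x] by (metis zero_less_power)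
  from has_derivative_compose[OF d1 DERIV_real_sqrt[OF this, unfolded has_field_derivative_def]]
  have "(r has_derivative (\<lambda>h. (inverse (sqrt (B x \<bullet> x)) / 2) * (B h \<bullet> x + B x \<bullet> h))) (at x)"
    unfolding r_def[abs_def] .
  then show ?thesis
  proof (rule has_derivative_eq_rhs, intro ext)
    fix h
    have "B h \<bullet> x = h \<bullet> B x" "B x \<bullet> h = h \<bullet> B x" using symB[of h x] by (auto simp: inner_commute)
    then show "(inverse (sqrt (B x \<bullet> x)) / 2) * (B h \<bullet> x + B x \<bullet> h) = h \<bullet> ((1 / r x) *\<^sub>R B x)"
      by (simp add: r_def inverse_eq_divide)
  qed
qed

lemma A0_grad_r: "A0 ((1 / r x) *\<^sub>R B x) = (1 / r x) *\<^sub>R x"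
  by (simp add: linear_scale[OF lin_A0] A0_B)

lemma E_borel [measurable]: "E \<rho> \<in> sets borel"
proof -
  have "E \<rho> = P \<inter> {y. 0 < r y} \<inter> {y. r y < \<rho>}" by (auto simp: E_def)
  moreover have "open {y. 0 < r y}" "open {y. r y < \<rho>}"
    by (intro open_Collect_less continuous_intros)+
  ultimately show ?thesis using closed_P by auto
qed

lemma E_mono: "s \<le> t \<Longrightarrow> E s \<subseteq> E t" by (auto simp: E_def)

lemma shell_compact: "0 < a \<Longrightarrow> compact {y \<in> P. a \<le> r y \<and> r y \<le> b}"
proof -
  have "{y \<in> P. a \<le> r y \<and> r y \<le> b} = P \<inter> {y. a \<le> r y} \<inter> {y. r y \<le> b}" by auto
  moreover have "closed {y. a \<le> r y}" "closed {y. r y \<le> b}"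
    by (intro closed_Collect_le continuous_intros)+
  moreover have "bounded {y \<in> P. a \<le> r y \<and> r y \<le> b}"
    using norm_le_r by (intro boundedI[where B="2 * b"]) (force intro: order_trans)
  ultimately show ?thesis using closed_P by (auto simp: compact_eq_bounded_closed)
qed

lemma emeasure_E_finite: "emeasure lborel (E \<rho>) < \<infinity>"
proof -
  have "E \<rho> \<subseteq> cball 0 (2 * \<rho>)"
    using norm_le_r by (force simp: E_def intro: order_trans)
  then have "emeasure lborel (E \<rho>) \<le> emeasure lborel (cball (0 :: 'a) (2 * \<rho>))"
    by (intro emeasure_mono) auto
  also have "\<dots> < \<infinity>" using emeasure_lborel_cball_finite by (simp add: top.not_eq_extremum)
  finally show ?thesis .
qed

lemma set_integrable_E:
  assumes "continuous_on (E \<rho>) f" "\<And>y. y \<in> E \<rho> \<Longrightarrow> \<bar>f y\<bar> \<le> M"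
  shows "set_integrable lborel (E \<rho>) (f :: 'a \<Rightarrow> real)"
proof -
  have "integrable lborel (\<lambda>x. indicat_real (E \<rho>) x *\<^sub>R (indicat_real (E \<rho>) x *\<^sub>R f x))"
    using borel_measurable_continuous_on_indicator[OF E_borel assms(1)] assms(2) emeasure_E_finite
    by (intro integrableI_bounded_set_indicator[where B=M]) auto
  moreover have "(\<lambda>x. indicat_real (E \<rho>) x *\<^sub>R (indicat_real (E \<rho>) x *\<^sub>R f x)) = (\<lambda>x. indicat_real (E \<rho>) x *\<^sub>R f x)"
    by (auto simp: indicator_def)
  ultimately show ?thesis by (simp only: set_integrable_def)
qed

lemma adm_set_integrable: "adm R f \<Longrightarrow> \<rho> < R \<Longrightarrow> set_integrable lborel (E \<rho>) f"
  using set_integrable_E[of \<rho> f] continuous_on_subset[OF _ E_mono[of \<rho> R]]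
  unfolding adm_def by (meson less_imp_le)

lemma I_scale:
  assumes "0 < c"
  shows "I f (c * \<rho>) = c ^ d * I (\<lambda>y. f (c *\<^sub>R y)) \<rho>"
proof -
  have "c *\<^sub>R y \<in> E (c * \<rho>) \<longleftrightarrow> y \<in> E \<rho>" for y
    using assms cone_P[of "c *\<^sub>R y" "1 / c"] cone_P[of y c] by (auto simp: E_def r_scale zero_less_mult_iff)
  then have "indicat_real (E (c * \<rho>)) (c *\<^sub>R y) = indicat_real (E \<rho>) y" for y
    by (simp add: indicator_def)
  then show ?thesis
    using lborel_integral_affine[of c "\<lambda>y. indicat_real (E (c * \<rho>)) y *\<^sub>R f y" 0] assms
    by (simp add: I_def set_lebesgue_integral_def d_eq)
qed

definition m1 :: real where "m1 = measure lborel (E 1)"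

lemma I_const: "0 < \<rho> \<Longrightarrow> I (\<lambda>_. c) \<rho> = c * m1 * \<rho> ^ d"
  using I_scale[of \<rho> "\<lambda>_. c" 1] emeasure_E_finite[of 1]
  by (auto simp: I_def m1_def set_lebesgue_integral_def mult_ac)

lemma m1_nonneg: "0 \<le> m1" unfolding m1_def by (rule measure_nonneg)

lemma radial_in_S: "y \<in> P \<Longrightarrow> y \<noteq> 0 \<Longrightarrow> 0 \<le> \<rho> \<Longrightarrow> (\<rho> / r y) *\<^sub>R y \<in> S \<rho>"
  using cone_P[of y "\<rho> / r y"] r_nonneg[of y] r_pos_iff[of y] by (auto simp: S_def r_scale)

lemma E_nz: "y \<in> E \<rho> \<Longrightarrow> y \<in> P \<and> y \<noteq> 0"
  by (auto simp: E_def)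

lemma S_compact: "0 < \<rho> \<Longrightarrow> compact (S \<rho>)"
proof -
  assume "0 < \<rho>"
  have "S \<rho> = {y \<in> P. \<rho> \<le> r y \<and> r y \<le> \<rho>}" by (auto simp: S_def)
  then show ?thesis using shell_compact[OF \<open>0 < \<rho>\<close>] by simp
qed

lemma continuous_radial:
  assumes "continuous_on (S \<rho>) f" "0 < \<rho>"
  shows "continuous_on (P - {0}) (\<lambda>y. f ((\<rho> / r y) *\<^sub>R y))"
proof (rule continuous_on_compose2[OF assms(1)])
  show "continuous_on (P - {0}) (\<lambda>y. (\<rho> / r y) *\<^sub>R y)" by (intro continuous_intros) auto
  show "(\<lambda>y. (\<rho> / r y) *\<^sub>R y) ` (P - {0}) \<subseteq> S \<rho>" using radial_in_S assms(2) by fastforce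
qed

lemma bounded_on_S:
  assumes "continuous_on (S \<rho>) (f :: 'a \<Rightarrow> real)" "0 < \<rho>"
  shows "\<exists>M. \<forall>y \<in> S \<rho>. \<bar>f y\<bar> \<le> M"
proof -
  have "bounded (f ` S \<rho>)" using compact_continuous_image[OF assms(1) S_compact[OF assms(2)]] by (rule compact_imp_bounded)
  then show ?thesis by (auto simp: bounded_iff)
qed

lemma set_integrable_radial:
  assumes "continuous_on (S \<rho>) f" "0 < \<rho>"
  shows "set_integrable lborel (E t) (\<lambda>y. f ((\<rho> / r y) *\<^sub>R y) :: real)"
proof -
  obtain M where M: "\<And>y. y \<in> S \<rho> \<Longrightarrow> \<bar>f y\<bar> \<le> M" using bounded_on_S[OF assms] by blast
  show ?thesis
  proof (rule set_integrable_E[where M=M])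
    show "continuous_on (E t) (\<lambda>y. f ((\<rho> / r y) *\<^sub>R y))"
      by (rule continuous_on_subset[OF continuous_radial[OF assms]]) (auto dest: E_nz)
    fix y assume "y \<in> E t"
    then show "\<bar>f ((\<rho> / r y) *\<^sub>R y)\<bar> \<le> M" using E_nz[of y t] assms(2) by (intro M radial_in_S) auto
  qed
qed

lemma sigma_add:
  assumes "0 < \<rho>" "continuous_on (S \<rho>) f" "continuous_on (S \<rho>) g"
  shows "\<sigma> (\<lambda>y. f y + g y) \<rho> = \<sigma> f \<rho> + \<sigma> g \<rho>"
  using set_integral_add(2)[OF set_integrable_radial[OF assms(2,1), of 1] set_integrable_radial[OF assms(3,1), of 1]]
  by (simp add: \<sigma>_def distrib_left)

lemma sigma_cmult: "\<sigma> (\<lambda>y. c * f y) \<rho> = c * \<sigma> f \<rho>"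
  by (simp add: \<sigma>_def)

lemma sigma_cong:
  assumes "0 < \<rho>" "\<And>y. y \<in> S \<rho> \<Longrightarrow> f y = g y"
  shows "\<sigma> f \<rho> = \<sigma> g \<rho>"
  unfolding \<sigma>_def using assms radial_in_S E_nz
  by (intro arg_cong2[where f="(*)"] refl set_lebesgue_integral_cong) (auto simp: less_imp_le)

lemma sigma_mono:
  assumes "0 < \<rho>" "continuous_on (S \<rho>) f" "continuous_on (S \<rho>) g" "\<And>y. y \<in> S \<rho> \<Longrightarrow> f y \<le> g y"
  shows "\<sigma> f \<rho> \<le> \<sigma> g \<rho>"
  unfolding \<sigma>_def using assms radial_in_S E_nz
  by (intro mult_left_mono set_integral_mono set_integrable_radial) (auto simp: less_imp_le)

lemma sigma_const: "0 < \<rho> \<Longrightarrow> \<sigma> (\<lambda>_. c) \<rho> = c * real d * m1 * \<rho> ^ (d - 1)"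
  using I_const[of 1 c] by (simp add: \<sigma>_def I_def)

text \<open>Uniform continuity on a compact shell around radius \<rho> gives one modulus for all
  directions y; this uniformity is behind the continuity and differentiability in \<rho> of all
  spherical integrals.\<close>

lemma radial_close:
  assumes f: "continuous_on (E R) f" and \<rho>: "0 < \<rho>" "\<rho> < R" and e: "0 < (e :: real)"
  obtains \<delta> where "0 < \<delta>" "\<delta> < \<rho>" "\<rho> + \<delta> < R"
    "\<And>y t. y \<in> P \<Longrightarrow> y \<noteq> 0 \<Longrightarrow> \<bar>t - \<rho>\<bar> < \<delta> \<Longrightarrow> \<bar>f ((t / r y) *\<^sub>R y) - f ((\<rho> / r y) *\<^sub>R y)\<bar> \<le> e"
proof -
  define a where "a = \<rho> / 2"
  define b where "b = (\<rho> + R) / 2"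
  have ab: "0 < a" "a < \<rho>" "\<rho> < b" "b < R" using \<rho> by (auto simp: a_def b_def)
  define K where "K = {y \<in> P. a \<le> r y \<and> r y \<le> b}"
  have "compact K" "K \<subseteq> E R" unfolding K_def using shell_compact ab by (auto simp: E_def)
  then have "uniformly_continuous_on K f"
    using f by (intro compact_uniformly_continuous continuous_on_subset[OF f])
  then obtain \<delta>1 where d1: "\<delta>1 > 0" "\<And>x y. x \<in> K \<Longrightarrow> y \<in> K \<Longrightarrow> dist y x < \<delta>1 \<Longrightarrow> dist (f y) (f x) < e"
    using e unfolding uniformly_continuous_on_def by metis
  define \<delta> where "\<delta> = min (\<delta>1 / 2) (min (\<rho> - a) (b - \<rho>))"
  have d: "\<delta> > 0" "\<delta> \<le> \<delta>1 / 2" "\<delta> \<le> \<rho> - a" "\<delta> \<le> b - \<rho>" 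
  proof -
    show "\<delta> \<le> \<delta>1 / 2" unfolding \<delta>_def by (rule min.cobounded1)
  qed (use d1 ab in \<open>auto simp: \<delta>_def\<close>)
  show ?thesis
  proof (rule that[of \<delta>])
    fix y t assume y: "y \<in> P" "y \<noteq> 0" and t: "\<bar>t - \<rho>\<bar> < \<delta>"
    have r: "r y > 0" using y by (simp add: r_pos_iff)
    have t0: "a \<le> t" "t \<le> b" using t d by linarith+
    have "(t / r y) *\<^sub>R y \<in> K" "(\<rho> / r y) *\<^sub>R y \<in> K"
      using cone_P[of y "t / r y"] cone_P[of y "\<rho> / r y"] y r t0 ab by (auto simp: K_def r_scale)
    moreover have "dist ((t / r y) *\<^sub>R y) ((\<rho> / r y) *\<^sub>R y) < \<delta>1"
    proof -
      have "dist ((t / r y) *\<^sub>R y) ((\<rho> / r y) *\<^sub>R y) = \<bar>t - \<rho>\<bar> / r y * norm y"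
        using r by (simp add: dist_norm abs_divide flip: scaleR_diff_left diff_divide_distrib)
      also have "\<dots> \<le> \<bar>t - \<rho>\<bar> / r y * (2 * r y)"
        using norm_le_r[of y] r by (intro mult_left_mono) auto
      also have "\<dots> = 2 * \<bar>t - \<rho>\<bar>" using r y by simp
      also have "\<dots> < \<delta>1" using t d by simp
      finally show ?thesis .
    qed
    ultimately show "\<bar>f ((t / r y) *\<^sub>R y) - f ((\<rho> / r y) *\<^sub>R y)\<bar> \<le> e"
      using d1(2) by (force simp: dist_real_def)
  qed (use d ab in auto)
qed

lemma adm_continuous_S: "adm R f \<Longrightarrow> 0 < \<rho> \<Longrightarrow> \<rho> < R \<Longrightarrow> continuous_on (S \<rho>) f"
  by (auto simp: adm_def E_def S_def intro: continuous_on_subset)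

lemma I_diff:
  assumes "s \<le> t" "set_integrable lborel (E t) f"
  shows "I f t - I f s = (LINT y:E t - E s|lborel. f y)"
proof -
  have "set_integrable lborel (E s) f"
    by (rule set_integrable_subset[OF assms(2)]) (use E_mono[OF assms(1)] in auto)
  moreover have "set_integrable lborel (E t - E s) f"
    by (rule set_integrable_subset[OF assms(2)]) auto
  ultimately have "I f (t :: real) = I f s + (LINT y:E t - E s|lborel. f y)"
    unfolding I_def using set_integral_Un[of "E s" "E t - E s" lborel f] E_mono[OF assms(1)]
    by (simp add: Un_absorb1)
  then show ?thesis by simp
qed

text \<open>The degree-0 extension \<open>f0\<close> of the values on the sphere has integral
  exactly \<open>J * t ^ d\<close> by dilation. Between nearby radii \<open>f\<close> and
  \<open>f0\<close> differ by at most e', and the volume of the shell is linear in its thickness to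
  first order, so the difference of the integrals has derivative 0. This takes the place of the
  coarea formula.\<close>

lemma I_has_derivative:
  assumes f: "adm R f" and \<rho>: "0 < \<rho>" "\<rho> < R"
  shows "(I f has_real_derivative \<sigma> f \<rho>) (at \<rho>)"
proof -
  define f0 where "f0 y = f ((\<rho> / r y) *\<^sub>R y)" for y
  have cS: "continuous_on (S \<rho>) f" using adm_continuous_S[OF f \<rho>] .
  have i0: "set_integrable lborel (E t) f0" for t
    unfolding f0_def using set_integrable_radial[OF cS \<rho>(1)] .
  define J where "J = I f0 1"
  have f0s: "f0 (c *\<^sub>R y) = f0 y" if "c > 0" for c y
    using that by (simp add: f0_def r_scale)
  have I0: "I f0 t = J * t ^ d" if "t > 0" for t
    using I_scale[OF that, of f0 1] f0s[OF that] by (simp add: J_def)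
  have dp: "((\<lambda>t. J * t ^ d) has_real_derivative \<sigma> f \<rho>) (at \<rho>)"
    by (auto intro!: derivative_eq_intros simp: \<sigma>_def J_def I_def f0_def)
  have "((\<lambda>t. I f t - J * t ^ d) has_derivative (\<lambda>h. 0)) (at \<rho>)"
    unfolding has_derivative_at_alt
  proof (intro conjI allI impI)
    fix e :: real assume e: "0 < e"
    define C where "C = 1 + real d * \<rho> ^ (d - 1)"
    have C: "C > 0" using \<rho> by (auto simp: C_def intro: add_pos_nonneg)
    have "((\<lambda>t :: real. t ^ d) has_derivative (\<lambda>h. h * (real d * \<rho> ^ (d - 1)))) (at \<rho>)"
      by (auto intro!: derivative_eq_intros)
    from this[unfolded has_derivative_at_alt, THEN conjunct2, rule_format, of 1]
    obtain \<delta>2 where d2: "\<delta>2 > 0" "\<And>t. \<bar>t - \<rho>\<bar> < \<delta>2 \<Longrightarrow> \<bar>t ^ d - \<rho> ^ d - (t - \<rho>) * (real d * \<rho> ^ (d - 1))\<bar> \<le> \<bar>t - \<rho>\<bar>"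
      by auto
    have pd: "\<bar>t ^ d - \<rho> ^ d\<bar> \<le> C * \<bar>t - \<rho>\<bar>" if "\<bar>t - \<rho>\<bar> < \<delta>2" for t
    proof -
      have "\<bar>(t - \<rho>) * (real d * \<rho> ^ (d - 1))\<bar> = real d * \<rho> ^ (d - 1) * \<bar>t - \<rho>\<bar>"
        using \<rho> by (simp add: abs_mult)
      moreover have "\<bar>a\<bar> \<le> \<bar>a - b\<bar> + \<bar>b\<bar>" for a b :: real by linarith
      from this[of "t ^ d - \<rho> ^ d" "(t - \<rho>) * (real d * \<rho> ^ (d - 1))"]
      have "\<bar>t ^ d - \<rho> ^ d\<bar> \<le> \<bar>t - \<rho>\<bar> + \<bar>(t - \<rho>) * (real d * \<rho> ^ (d - 1))\<bar>"
        using d2(2)[OF that] by linarith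
      ultimately show ?thesis unfolding C_def distrib_right by linarith
    qed
    define e' where "e' = e / (C * (m1 + 1))"
    have e': "e' > 0" "e' * m1 * C \<le> e"
    proof -
      have m: "m1 + 1 > 0" using m1_nonneg by linarith
      then show "e' > 0" using e C by (simp add: e'_def)
      have "e' * m1 * C = e * (m1 / (m1 + 1))" using C m by (simp add: e'_def divide_simps)
      also have "\<dots> \<le> e * 1" using e m m1_nonneg by (intro mult_left_mono) auto
      finally show "e' * m1 * C \<le> e" by simp
    qed
    obtain \<delta> where \<delta>: "0 < \<delta>" "\<delta> < \<rho>" "\<rho> + \<delta> < R"
      "\<And>y t. y \<in> P \<Longrightarrow> y \<noteq> 0 \<Longrightarrow> \<bar>t - \<rho>\<bar> < \<delta> \<Longrightarrow> \<bar>f ((t / r y) *\<^sub>R y) - f ((\<rho> / r y) *\<^sub>R y)\<bar> \<le> e'"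
      using radial_close[OF _ \<rho> e'(1)] f unfolding adm_def by metis
    have key: "\<bar>(I f t - J * t ^ d) - (I f s - J * s ^ d)\<bar> \<le> e' * m1 * (t ^ d - s ^ d)"
      if st: "s \<le> t" "\<rho> - \<delta> < s" "t < \<rho> + \<delta>" for s t
    proof -
      have pos: "0 < s" "0 < t" "t < R" using st \<delta> by auto
      have it: "set_integrable lborel (E t) f" using adm_set_integrable[OF f] pos by simp
      have sub: "set_integrable lborel (E t - E s) h" if "set_integrable lborel (E t) h" for h :: "'a \<Rightarrow> real"
        by (rule set_integrable_subset[OF that]) auto
      have ic: "set_integrable lborel (E t) (\<lambda>_. e')" 
        by (rule set_integrable_E[where M="\<bar>e'\<bar>"]) auto
      have "(I f t - J * t ^ d) - (I f s - J * s ^ d) = (I f t - I f s) - (I f0 t - I f0 s)"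
        using pos by (simp add: I0)
      also have "\<dots> = (LINT y:E t - E s|lborel. f y - f0 y)"
        unfolding I_diff[OF st(1) it] I_diff[OF st(1) i0]
        by (rule set_integral_diff(2)[symmetric]) (intro sub it i0)+
      also have "\<bar>\<dots>\<bar> \<le> (LINT y:E t - E s|lborel. \<bar>f y - f0 y\<bar>)"
        using set_integral_norm_bound[OF set_integral_diff(1)[OF sub[OF it] sub[OF i0]]] by simp
      also have "\<dots> \<le> (LINT y:E t - E s|lborel. e')"
      proof (rule set_integral_mono)
        show "set_integrable lborel (E t - E s) (\<lambda>y. \<bar>f y - f0 y\<bar>)"
          by (intro set_integrable_abs set_integral_diff(1) sub it i0)
        show "set_integrable lborel (E t - E s) (\<lambda>y. e')" by (intro sub ic)
        fix y assume "y \<in> E t - E s"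
        then have y: "y \<in> P" "y \<noteq> 0" "s \<le> r y" "r y < t" by (auto simp: E_def)
        then have "\<bar>r y - \<rho>\<bar> < \<delta>" using st by auto
        from \<delta>(4)[OF y(1,2) this] show "\<bar>f y - f0 y\<bar> \<le> e'" using y by (simp add: f0_def)
      qed
      also have "\<dots> = I (\<lambda>_. e') t - I (\<lambda>_. e') s" by (rule I_diff[OF st(1) ic, symmetric])
      also have "\<dots> = e' * m1 * (t ^ d - s ^ d)" using pos by (simp add: I_const right_diff_distrib)
      finally show ?thesis .
    qed
    show "\<exists>\<delta>>0. \<forall>t. norm (t - \<rho>) < \<delta> \<longrightarrow> norm (I f t - J * t ^ d - (I f \<rho> - J * \<rho> ^ d) - 0) \<le> e * norm (t - \<rho>)"
    proof (intro exI[where x="min \<delta> \<delta>2"] conjI allI impI)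
      fix t assume "norm (t - \<rho>) < min \<delta> \<delta>2"
      then have t: "\<bar>t - \<rho>\<bar> < \<delta>" "\<bar>t - \<rho>\<bar> < \<delta>2" by auto
      have "\<bar>(I f t - J * t ^ d) - (I f \<rho> - J * \<rho> ^ d)\<bar> \<le> e' * m1 * \<bar>t ^ d - \<rho> ^ d\<bar>"
      proof (cases "\<rho> \<le> t")
        case True
        have "e' * m1 * (t ^ d - \<rho> ^ d) \<le> e' * m1 * \<bar>t ^ d - \<rho> ^ d\<bar>"
          using e' m1_nonneg by (intro mult_left_mono) auto
        then show ?thesis using key[of \<rho> t] True t \<delta> by linarith
      next
        case False
        have "e' * m1 * (\<rho> ^ d - t ^ d) \<le> e' * m1 * \<bar>t ^ d - \<rho> ^ d\<bar>"
          using e' m1_nonneg by (intro mult_left_mono) auto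
        then show ?thesis using key[of t \<rho>] False t \<delta> by linarith
      qed
      also have "\<dots> \<le> e' * m1 * (C * \<bar>t - \<rho>\<bar>)"
        using pd[OF t(2)] e' m1_nonneg by (intro mult_left_mono) auto
      also have "\<dots> \<le> e * \<bar>t - \<rho>\<bar>" using e'(2) by (simp add: mult.assoc[symmetric] mult_right_mono)
      finally show "norm (I f t - J * t ^ d - (I f \<rho> - J * \<rho> ^ d) - 0) \<le> e * norm (t - \<rho>)" by simp
    qed (use \<delta> d2 in auto)
  qed auto
  then have "((\<lambda>t. I f t - J * t ^ d) has_real_derivative 0) (at \<rho>)"
    by (simp add: has_field_derivative_def lambda_zero)
  from DERIV_add[OF this dp] show ?thesis by simp
qed

text \<open>On each ray the mean value theorem expresses the increment through the radial derivative
  at an intermediate radius, and \<open>radial_close\<close> makes the error uniform over rays, so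
  the derivative passes under the integral.\<close>

lemma radial_mean_has_derivative:
  assumes u: "\<And>y. y \<in> E R \<Longrightarrow> (u has_derivative (\<lambda>h. h \<bullet> U y)) (at y within P)"
    and U: "continuous_on (E R) U" and \<rho>: "0 < \<rho>" "\<rho> < R"
  shows "((\<lambda>t. LINT y:E 1|lborel. u ((t / r y) *\<^sub>R y)) has_real_derivative
          (LINT y:E 1|lborel. (\<lambda>z. (z \<bullet> U z) / r z) ((\<rho> / r y) *\<^sub>R y))) (at \<rho>)"
proof -
  define V where "V z = (z \<bullet> U z) / r z" for z
  have cV: "continuous_on (E R) V" unfolding V_def
    by (intro continuous_intros U) (auto simp: E_def)
  have ER: "E R \<subseteq> P" by (auto simp: E_def)
  have cu: "continuous_on (E R) u"
    by (rule grad_imp_continuous_on) (rule has_derivative_subset[OF u ER])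
  have SE: "S t \<subseteq> E R" if "0 < t" "t < R" for t using that by (auto simp: S_def E_def)
  have iu: "set_integrable lborel (E 1) (\<lambda>y. u ((t / r y) *\<^sub>R y))" 
    and iV: "set_integrable lborel (E 1) (\<lambda>y. V ((t / r y) *\<^sub>R y))" if "0 < t" "t < R" for t
    using that SE continuous_on_subset[OF cu] continuous_on_subset[OF cV] by (auto intro!: set_integrable_radial)
  have ray: "((\<lambda>t. u ((t / r y) *\<^sub>R y)) has_real_derivative V ((t / r y) *\<^sub>R y)) (at t)"
    if y: "y \<in> P" "y \<noteq> 0" and t: "0 < t" "t < R" for y t
  proof -
    have z: "(t / r y) *\<^sub>R y \<in> E R" using radial_in_S[OF y, of t] SE[OF t] t by auto
    have r: "r y > 0" using y by (simp add: r_pos_iff)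
    have dr: "((\<lambda>t. (t / r y) *\<^sub>R y) has_derivative (\<lambda>h. (h / r y) *\<^sub>R y)) (at t within {0<..})"
      using r by (auto intro!: derivative_eq_intros)
    have im: "(\<lambda>t. (t / r y) *\<^sub>R y) ` {0<..} \<subseteq> P" using cone_P[OF y(1)] r by auto
    have "((\<lambda>t. u ((t / r y) *\<^sub>R y)) has_derivative (\<lambda>h. ((h / r y) *\<^sub>R y) \<bullet> U ((t / r y) *\<^sub>R y))) (at t within {0<..})"
      using has_derivative_in_compose[OF dr has_derivative_subset[OF u[OF z] im]] .
    moreover have "(\<lambda>h. ((h / r y) *\<^sub>R y) \<bullet> U ((t / r y) *\<^sub>R y)) = (*) (V ((t / r y) *\<^sub>R y))"
      using r t by (auto simp: V_def r_scale fun_eq_iff)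
    moreover have "at t within {0<..} = at t" using t by (simp add: at_within_open[of t "{0<..}"])
    ultimately show ?thesis by (simp add: has_field_derivative_def)
  qed
  have "((\<lambda>t. LINT y:E 1|lborel. u ((t / r y) *\<^sub>R y)) has_derivative
      (\<lambda>h. h * (LINT y:E 1|lborel. V ((\<rho> / r y) *\<^sub>R y)))) (at \<rho>)"
    unfolding has_derivative_at_alt
  proof (intro conjI allI impI)
    show "bounded_linear (\<lambda>h. h * (LINT y:E 1|lborel. V ((\<rho> / r y) *\<^sub>R y)))" by (rule bounded_linear_mult_left)
    fix e :: real assume e: "0 < e"
    define e' where "e' = e / (m1 + 1)"
    have m: "m1 + 1 > 0" using m1_nonneg by linarith
    have e': "e' > 0" "e' * m1 \<le> e" using e m m1_nonneg by (auto simp: e'_def field_simps)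
    obtain \<delta> where \<delta>: "0 < \<delta>" "\<delta> < \<rho>" "\<rho> + \<delta> < R"
      "\<And>y t. y \<in> P \<Longrightarrow> y \<noteq> 0 \<Longrightarrow> \<bar>t - \<rho>\<bar> < \<delta> \<Longrightarrow> \<bar>V ((t / r y) *\<^sub>R y) - V ((\<rho> / r y) *\<^sub>R y)\<bar> \<le> e'"
      using radial_close[OF cV \<rho> e'(1)] by metis
    show "\<exists>\<delta>>0. \<forall>t. norm (t - \<rho>) < \<delta> \<longrightarrow>
        norm ((LINT y:E 1|lborel. u ((t / r y) *\<^sub>R y)) - (LINT y:E 1|lborel. u ((\<rho> / r y) *\<^sub>R y)) -
           (t - \<rho>) * (LINT y:E 1|lborel. V ((\<rho> / r y) *\<^sub>R y))) \<le> e * norm (t - \<rho>)"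
    proof (intro exI[where x=\<delta>] conjI allI impI)
      fix t assume "norm (t - \<rho>) < \<delta>"
      then have t: "\<bar>t - \<rho>\<bar> < \<delta>" by simp
      then have t': "0 < t" "t < R" using \<delta> by auto
      define h where "h y = u ((t / r y) *\<^sub>R y) - u ((\<rho> / r y) *\<^sub>R y) - (t - \<rho>) * V ((\<rho> / r y) *\<^sub>R y)" for y
      have ih: "set_integrable lborel (E 1) h" unfolding h_def
        by (intro set_integral_diff(1) set_integrable_mult_right iu iV t' \<rho>)
      have "(LINT y:E 1|lborel. u ((t / r y) *\<^sub>R y)) - (LINT y:E 1|lborel. u ((\<rho> / r y) *\<^sub>R y)) -
           (t - \<rho>) * (LINT y:E 1|lborel. V ((\<rho> / r y) *\<^sub>R y)) = (LINT y:E 1|lborel. h y)"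
        unfolding h_def
        by (subst set_integral_diff(2), (intro set_integral_diff(1) set_integrable_mult_right iu iV t' \<rho>)+,
            subst set_integral_diff(2), (intro set_integral_diff(1) set_integrable_mult_right iu iV t' \<rho>)+, simp)
      also have "norm \<dots> \<le> (LINT y:E 1|lborel. norm (h y))" by (rule set_integral_norm_bound[OF ih])
      also have "\<dots> \<le> (LINT y:E 1|lborel. e' * \<bar>t - \<rho>\<bar>)"
      proof (rule set_integral_mono)
        show "set_integrable lborel (E 1) (\<lambda>y. norm (h y))" using ih by (rule set_integrable_norm)
        show "set_integrable lborel (E 1) (\<lambda>y. e' * \<bar>t - \<rho>\<bar>)"
          by (rule set_integrable_E[where M="\<bar>e' * \<bar>t - \<rho>\<bar>\<bar>"]) auto
        fix y assume "y \<in> E 1"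
        then have y: "y \<in> P" "y \<noteq> 0" using E_nz by auto
        obtain \<xi> where \<xi>: "\<bar>\<xi> - \<rho>\<bar> < \<delta>" "u ((t / r y) *\<^sub>R y) - u ((\<rho> / r y) *\<^sub>R y) = (t - \<rho>) * V ((\<xi> / r y) *\<^sub>R y)"
        proof (cases t \<rho> rule: linorder_cases)
          case less
          then obtain z where "t < z" "z < \<rho>" "u ((\<rho> / r y) *\<^sub>R y) - u ((t / r y) *\<^sub>R y) = (\<rho> - t) * V ((z / r y) *\<^sub>R y)"
            using MVT2[of t \<rho> "\<lambda>t. u ((t / r y) *\<^sub>R y)" "\<lambda>t. V ((t / r y) *\<^sub>R y)"] ray[OF y] t' \<rho> by force
          then show ?thesis using that[of z] t by (auto simp: algebra_simps)
        next
          case greater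
          then obtain z where "\<rho> < z" "z < t" "u ((t / r y) *\<^sub>R y) - u ((\<rho> / r y) *\<^sub>R y) = (t - \<rho>) * V ((z / r y) *\<^sub>R y)"
            using MVT2[of \<rho> t "\<lambda>t. u ((t / r y) *\<^sub>R y)" "\<lambda>t. V ((t / r y) *\<^sub>R y)"] ray[OF y] t' \<rho> by force
          then show ?thesis using that[of z] t by auto
        qed (use that[of \<rho>] \<delta> in auto)
        have "norm (h y) = \<bar>t - \<rho>\<bar> * \<bar>V ((\<xi> / r y) *\<^sub>R y) - V ((\<rho> / r y) *\<^sub>R y)\<bar>"
          unfolding h_def \<xi>(2) by (simp flip: right_diff_distrib abs_mult)
        also have "\<dots> \<le> \<bar>t - \<rho>\<bar> * e'" using \<delta>(4)[OF y \<xi>(1)] by (intro mult_left_mono) auto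
        finally show "norm (h y) \<le> e' * \<bar>t - \<rho>\<bar>" by (simp add: mult.commute)
      qed
      also have "\<dots> = (e' * m1) * \<bar>t - \<rho>\<bar>"
        using I_const[of 1 "e' * \<bar>t - \<rho>\<bar>"] by (simp add: I_def mult_ac)
      also have "\<dots> \<le> e * norm (t - \<rho>)" using e'(2) by (simp add: mult_right_mono)
      finally show "norm ((LINT y:E 1|lborel. u ((t / r y) *\<^sub>R y)) - (LINT y:E 1|lborel. u ((\<rho> / r y) *\<^sub>R y)) -
           (t - \<rho>) * (LINT y:E 1|lborel. V ((\<rho> / r y) *\<^sub>R y))) \<le> e * norm (t - \<rho>)" .
    qed (rule \<delta>)
  qed
  then show ?thesis unfolding V_def has_field_derivative_def mult.commute[of "LINT y:E 1|lborel. _ y" "_ :: real"] .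
qed

lemma sigma_has_derivative:
  assumes u: "\<And>y. y \<in> E R \<Longrightarrow> (u has_derivative (\<lambda>h. h \<bullet> U y)) (at y within P)"
    and U: "continuous_on (E R) U" and \<rho>: "0 < \<rho>" "\<rho> < R"
  shows "(\<sigma> u has_real_derivative (real d - 1) / \<rho> * \<sigma> u \<rho> + \<sigma> (\<lambda>z. (z \<bullet> U z) / r z) \<rho>) (at \<rho>)"
proof -
  have p: "((\<lambda>t. real d * t ^ (d - 1)) has_real_derivative (real d - 1) / \<rho> * (real d * \<rho> ^ (d - 1))) (at \<rho>)"
  proof -
    have "((\<lambda>t. t ^ (d - 1)) has_real_derivative (real d - 1) * \<rho> ^ (d - 1) / \<rho>) (at \<rho>)"
    proof (cases "d - 1")
      case 0
      then have "d = 1" using DIM_positive[where 'a='a] d_eq by linarith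
      then show ?thesis by simp
    next
      case (Suc k)
      then have "d = Suc (Suc k)" by linarith
      then show ?thesis using \<rho> DERIV_pow[of "d - 1" \<rho>] by simp
    qed
    from DERIV_cmult[OF this, of "real d"] show ?thesis by (simp add: field_simps)
  qed
  from DERIV_mult[OF p radial_mean_has_derivative[OF u U \<rho>]]
  show ?thesis unfolding \<sigma>_def[abs_def] by (simp add: algebra_simps)
qed

lemma sigma_continuous:
  assumes f: "continuous_on (E R) f" and \<rho>: "0 < \<rho>" "\<rho> < R"
  shows "isCont (\<sigma> f) \<rho>"
proof -
  have SE: "S t \<subseteq> E R" if "0 < t" "t < R" for t using that by (auto simp: S_def E_def)
  have i: "set_integrable lborel (E 1) (\<lambda>y. f ((t / r y) *\<^sub>R y))" if "0 < t" "t < R" for t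
    using that SE continuous_on_subset[OF f] by (auto intro!: set_integrable_radial)
  have "isCont (\<lambda>t. LINT y:E 1|lborel. f ((t / r y) *\<^sub>R y)) \<rho>"
    unfolding continuous_at_eps_delta
  proof (intro allI impI)
    fix e :: real assume e: "0 < e"
    define e' where "e' = e / (m1 + 2)"
    have m: "m1 + 2 > 0" using m1_nonneg by linarith
    have e': "e' > 0" "e' * m1 < e" using e m m1_nonneg by (auto simp: e'_def field_simps)
    obtain \<delta> where \<delta>: "0 < \<delta>" "\<delta> < \<rho>" "\<rho> + \<delta> < R"
      "\<And>y t. y \<in> P \<Longrightarrow> y \<noteq> 0 \<Longrightarrow> \<bar>t - \<rho>\<bar> < \<delta> \<Longrightarrow> \<bar>f ((t / r y) *\<^sub>R y) - f ((\<rho> / r y) *\<^sub>R y)\<bar> \<le> e'"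
      using radial_close[OF f \<rho> e'(1)] by metis
    show "\<exists>\<delta>>0. \<forall>t. dist t \<rho> < \<delta> \<longrightarrow> dist (LINT y:E 1|lborel. f ((t / r y) *\<^sub>R y)) (LINT y:E 1|lborel. f ((\<rho> / r y) *\<^sub>R y)) < e"
    proof (intro exI[where x=\<delta>] conjI allI impI)
      fix t assume "dist t \<rho> < \<delta>"
      then have t: "\<bar>t - \<rho>\<bar> < \<delta>" by (simp add: dist_real_def)
      then have t': "0 < t" "t < R" using \<delta> by auto
      have "(LINT y:E 1|lborel. f ((t / r y) *\<^sub>R y)) - (LINT y:E 1|lborel. f ((\<rho> / r y) *\<^sub>R y)) =
          (LINT y:E 1|lborel. f ((t / r y) *\<^sub>R y) - f ((\<rho> / r y) *\<^sub>R y))"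
        by (rule set_integral_diff(2)[symmetric]) (intro i t' \<rho>)+
      also have "norm \<dots> \<le> (LINT y:E 1|lborel. norm (f ((t / r y) *\<^sub>R y) - f ((\<rho> / r y) *\<^sub>R y)))"
        by (intro set_integral_norm_bound set_integral_diff(1) i t' \<rho>)
      also have "\<dots> \<le> (LINT y:E 1|lborel. e')"
      proof (rule set_integral_mono)
        show "set_integrable lborel (E 1) (\<lambda>y. norm (f ((t / r y) *\<^sub>R y) - f ((\<rho> / r y) *\<^sub>R y)))"
          by (intro set_integrable_norm set_integral_diff(1) i t' \<rho>)
        show "set_integrable lborel (E 1) (\<lambda>y. e')" by (rule set_integrable_E[where M="\<bar>e'\<bar>"]) auto
      qed (use \<delta>(4) t E_nz in auto)
      also have "\<dots> = e' * m1" using I_const[of 1 "e'"] by (simp add: I_def)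
      finally show "dist (LINT y:E 1|lborel. f ((t / r y) *\<^sub>R y)) (LINT y:E 1|lborel. f ((\<rho> / r y) *\<^sub>R y)) < e"
        using e'(2) by (simp add: dist_real_def)
    qed (rule \<delta>)
  qed
  then show ?thesis unfolding \<sigma>_def[abs_def] by (intro continuous_intros)
qed

text \<open>By homogeneity the integral over radius t is (t / \<rho>)^(\<beta> + d) times the one
  over radius \<rho>. Differentiating at \<rho> and comparing with \<open>I_has_derivative\<close>
  yields the factor \<rho> / (\<beta> + d).\<close>

lemma I_homogeneous_extension:
  assumes f: "continuous_on (S \<rho>) f" and \<rho>: "0 < \<rho>" and \<beta>: "0 \<le> \<beta>"
  shows "I (\<lambda>y. (r y / \<rho>) powr \<beta> * f ((\<rho> / r y) *\<^sub>R y)) \<rho> = \<rho> / (\<beta> + d) * \<sigma> f \<rho>"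
    and "adm R (\<lambda>y. (r y / \<rho>) powr \<beta> * f ((\<rho> / r y) *\<^sub>R y))"
proof -
  define g where "g y = (r y / \<rho>) powr \<beta> * f ((\<rho> / r y) *\<^sub>R y)" for y
  obtain M where M: "\<And>y. y \<in> S \<rho> \<Longrightarrow> \<bar>f y\<bar> \<le> M" using bounded_on_S[OF f \<rho>] by blast
  have adm: "adm R g" for R
    unfolding adm_def
  proof (intro conjI allI impI)
    show "continuous_on (E R) g" unfolding g_def
      by (intro continuous_intros continuous_on_subset[OF continuous_radial[OF f \<rho>]] continuous_on_powr)
         (use \<rho> in \<open>auto simp: E_def\<close>)
    fix t
    show "\<exists>N. \<forall>y\<in>E t. \<bar>g y\<bar> \<le> N"
    proof (intro exI ballI)
      fix y assume y: "y \<in> E t"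
      have "\<bar>f ((\<rho> / r y) *\<^sub>R y)\<bar> \<le> M" using y E_nz[OF y] \<rho> by (intro M radial_in_S) auto
      moreover have "(r y / \<rho>) powr \<beta> \<le> (t / \<rho>) powr \<beta>"
        using y \<rho> \<beta> by (intro powr_mono2) (auto simp: E_def r_nonneg divide_right_mono)
      ultimately show "\<bar>g y\<bar> \<le> (t / \<rho>) powr \<beta> * M"
        unfolding g_def abs_mult by (intro mult_mono) auto
    qed
  qed
  then show "adm R (\<lambda>y. (r y / \<rho>) powr \<beta> * f ((\<rho> / r y) *\<^sub>R y))" by (simp add: g_def[abs_def])
  have s: "I g (c * \<rho>) = c powr (\<beta> + d) * I g \<rho>" if c: "c > 0" for c
  proof -
    have "g (c *\<^sub>R y) = c powr \<beta> * g y" for y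
      using c \<rho> r_nonneg[of y] by (simp add: g_def r_scale powr_mult powr_divide)
    then have "I g (c * \<rho>) = c ^ d * (c powr \<beta> * I g \<rho>)"
      unfolding I_scale[OF c] by (simp add: I_def)
    then show ?thesis using c by (simp add: powr_add powr_realpow mult_ac)
  qed
  have a1: "I g t = (t / \<rho>) powr (\<beta> + d) * I g \<rho>" if "t > 0" for t
    using s[of "t / \<rho>"] that \<rho> by simp
  have a2: "((\<lambda>t. (t / \<rho>) powr (\<beta> + d) * I g \<rho>) has_real_derivative (\<beta> + d) / \<rho> * I g \<rho>) (at \<rho>)"
    using \<rho> by (auto intro!: derivative_eq_intros simp: field_simps)
  have "(I g has_real_derivative (\<beta> + d) / \<rho> * I g \<rho>) (at \<rho>)"
    by (rule has_field_derivative_transform_within_open[OF a2, where S="{0<..}"]) (use \<rho> a1[symmetric] in auto)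
  moreover have "(I g has_real_derivative \<sigma> g \<rho>) (at \<rho>)"
    using I_has_derivative[OF adm[of "\<rho> + 1"]] \<rho> by simp
  ultimately have "(\<beta> + d) / \<rho> * I g \<rho> = \<sigma> g \<rho>" by (rule DERIV_unique)
  moreover have "\<sigma> g \<rho> = \<sigma> f \<rho>"
    by (rule sigma_cong[OF \<rho>]) (use \<rho> in \<open>auto simp: g_def S_def\<close>)
  moreover have "\<beta> + d > 0" using \<beta> DIM_positive[where 'a='a] d_eq by (intro add_nonneg_pos) auto
  ultimately have "I g \<rho> = \<rho> / (\<beta> + d) * \<sigma> f \<rho>" using \<rho> by (simp add: field_simps)
  then show "I (\<lambda>y. (r y / \<rho>) powr \<beta> * f ((\<rho> / r y) *\<^sub>R y)) \<rho> = \<rho> / (\<beta> + d) * \<sigma> f \<rho>"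
    by (simp add: g_def[abs_def])
qed

end

section \<open>Testing the equation on a gauge ball, with the flux through its sphere as boundary
  term\<close>

subsection \<open>Green's inequality on gauge balls\<close>

lemma cutoff'_pos: "0 < u \<Longrightarrow> u < 1 \<Longrightarrow> 0 < cutoff' u"
  using cutoff_denom_pos[of u] by (simp add: cutoff'_def)

context gauge_cone
begin

definition D_ball :: "real \<Rightarrow> 'a set" where "D_ball \<rho> = {y \<in> P. r y < \<rho>}"

text \<open>The gradient of \<open>r\<close> off the origin; at the origin the formula gives
  0.\<close>

definition \<nu> :: "'a \<Rightarrow> 'a" where "\<nu> y = (1 / r y) *\<^sub>R B y"

lemma E_subset_D_ball: "E \<rho> \<subseteq> D_ball \<rho>" by (auto simp: E_def D_ball_def)

lemma compact_gauge_ball: "compact {y \<in> P. r y \<le> \<rho>}"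
proof -
  have "{y \<in> P. r y \<le> \<rho>} = P \<inter> {y. r y \<le> \<rho>}" by auto
  moreover have "closed {y. r y \<le> \<rho>}"
    by (intro closed_Collect_le continuous_intros)
  moreover have "bounded {y \<in> P. r y \<le> \<rho>}"
    using norm_le_r by (intro boundedI[where B="2 * \<rho>"]) (force intro: order_trans)
  ultimately show ?thesis using closed_P by (auto simp: compact_eq_bounded_closed)
qed

lemma bounded_on_D_ball:
  fixes f :: "'a \<Rightarrow> 'b::real_normed_vector"
  assumes "continuous_on (D_ball R) f" "\<rho> < R"
  shows "\<exists>M. \<forall>y\<in>D_ball \<rho>. norm (f y) \<le> M"
proof -
  have "compact (f ` {y \<in> P. r y \<le> \<rho>})"
    using assms by (intro compact_continuous_image compact_gauge_ball continuous_on_subset[OF assms(1)])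
      (auto simp: D_ball_def)
  then have "bounded (f ` {y \<in> P. r y \<le> \<rho>})" by (rule compact_imp_bounded)
  then show ?thesis by (force simp: bounded_iff D_ball_def)
qed

lemma adm_continuous:
  assumes "continuous_on (D_ball R) f"
  shows "adm R f"
  unfolding adm_def
proof (intro conjI allI impI)
  show "continuous_on (E R) f" using continuous_on_subset[OF assms E_subset_D_ball] .
  fix \<rho> assume "\<rho> < R"
  from bounded_on_D_ball[OF assms this] show "\<exists>M. \<forall>y\<in>E \<rho>. \<bar>f y\<bar> \<le> M"
    using E_subset_D_ball[of \<rho>] by auto
qed

lemma adm_mult:
  assumes "adm R f" "adm R g"
  shows "adm R (\<lambda>y. f y * g y)"
  unfolding adm_def
proof (intro conjI allI impI)
  show "continuous_on (E R) (\<lambda>y. f y * g y)" using assms by (auto simp: adm_def intro!: continuous_intros)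
  fix \<rho> assume "\<rho> < R"
  then obtain M N where "\<forall>y\<in>E \<rho>. \<bar>f y\<bar> \<le> M" "\<forall>y\<in>E \<rho>. \<bar>g y\<bar> \<le> N" using assms unfolding adm_def by blast
  then have "\<forall>y\<in>E \<rho>. \<bar>f y * g y\<bar> \<le> M * N"
    unfolding abs_mult by (intro ballI mult_mono) (auto intro: order_trans[OF abs_ge_zero])
  then show "\<exists>M. \<forall>y\<in>E \<rho>. \<bar>f y * g y\<bar> \<le> M" by blast
qed

lemma adm_add:
  assumes "adm R f" "adm R g"
  shows "adm R (\<lambda>y. f y + g y)"
  unfolding adm_def
proof (intro conjI allI impI)
  show "continuous_on (E R) (\<lambda>y. f y + g y)" using assms by (auto simp: adm_def intro!: continuous_intros)
  fix \<rho> assume "\<rho> < R"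
  then obtain M N where MN: "\<forall>y\<in>E \<rho>. \<bar>f y\<bar> \<le> M" "\<forall>y\<in>E \<rho>. \<bar>g y\<bar> \<le> N" using assms unfolding adm_def by blast
  have "\<bar>f y + g y\<bar> \<le> M + N" if "y \<in> E \<rho>" for y
    using MN[rule_format, OF that] abs_triangle_ineq[of "f y" "g y"] by linarith
  then show "\<exists>M. \<forall>y\<in>E \<rho>. \<bar>f y + g y\<bar> \<le> M" by blast
qed

lemma adm_radial:
  assumes "continuous_on UNIV c"
  shows "adm R (\<lambda>y. c (r y))"
  by (intro adm_continuous continuous_on_compose2[OF assms] continuous_intros) auto

lemma continuous_nu: "continuous_on (- {0}) \<nu>"
  unfolding \<nu>_def
  by (intro continuous_intros bounded_linear.continuous_on[OF linear_conv_bounded_linear[THEN iffD1, OF lin_B]]) auto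

lemma nu_bounded: "\<exists>K. \<forall>y. norm (\<nu> y) \<le> K"
proof -
  obtain K where K: "\<And>y. norm (B y) \<le> K * norm y" "K > 0" 
    using linear_bounded_pos[OF lin_B] by blast
  have "norm (\<nu> y) \<le> 2 * K" for y
  proof (cases "y = 0")
    case False
    then have r: "r y > 0" by (simp add: r_pos_iff)
    have "norm (B y) \<le> K * (2 * r y)"
      using K(1)[of y] norm_le_r[of y] K(2) by (meson mult_left_mono less_imp_le order_trans)
    then show ?thesis using r by (simp add: \<nu>_def divide_le_eq mult_ac)
  qed (use K in \<open>simp add: \<nu>_def\<close>)
  then show ?thesis by blast
qed

lemma adm_inner_nu:
  assumes "continuous_on (D_ball R) V"
  shows "adm R (\<lambda>y. V y \<bullet> \<nu> y)"
  unfolding adm_def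
proof (intro conjI allI impI)
  show "continuous_on (E R) (\<lambda>y. V y \<bullet> \<nu> y)"
    by (intro continuous_intros continuous_on_subset[OF assms E_subset_D_ball] continuous_on_subset[OF continuous_nu])
      (auto simp: E_def)
  fix \<rho> assume "\<rho> < R"
  from bounded_on_D_ball[OF assms this] obtain M where M: "\<forall>y\<in>D_ball \<rho>. norm (V y) \<le> M" by blast
  obtain K where K: "\<And>y. norm (\<nu> y) \<le> K" using nu_bounded by blast
  have "\<bar>V y \<bullet> \<nu> y\<bar> \<le> M * K" if "y \<in> E \<rho>" for y
  proof -
    have "norm (V y) \<le> M" using M that E_subset_D_ball by blast
    then have "norm (V y) * norm (\<nu> y) \<le> M * K"
      using K[of y] norm_ge_zero[of "V y"] norm_ge_zero[of "\<nu> y"] by (intro mult_mono) linarith+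
    then show ?thesis using Cauchy_Schwarz_ineq2[of "V y" "\<nu> y"] by linarith
  qed
  then show "\<exists>M. \<forall>y\<in>E \<rho>. \<bar>V y \<bullet> \<nu> y\<bar> \<le> M" by blast
qed

lemma I_add:
  assumes "adm R f" "adm R h" "\<rho> < R"
  shows "I (\<lambda>y. f y + h y) \<rho> = I f \<rho> + I h \<rho>"
  unfolding I_def by (rule set_integral_add(2)) (use adm_set_integrable assms in auto)

lemma I_cmult: "I (\<lambda>y. c * f y) \<rho> = c * I f \<rho>"
  by (simp add: I_def)

lemma I_mono:
  assumes "adm R f" "adm R h" "\<rho> < R" "\<And>y. y \<in> E \<rho> \<Longrightarrow> f y \<le> h y"
  shows "I f \<rho> \<le> I h \<rho>"
  unfolding I_def by (intro set_integral_mono) (use adm_set_integrable assms in auto)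

lemma I_cong: "(\<And>y. y \<in> E \<rho> \<Longrightarrow> f y = h y) \<Longrightarrow> I f \<rho> = I h \<rho>"
  unfolding I_def by (intro set_lebesgue_integral_cong) auto

lemma sigma_radial_mult: "0 < s \<Longrightarrow> \<sigma> (\<lambda>y. c (r y) * f y) s = c s * \<sigma> f s"
  using sigma_cong[of s "\<lambda>y. c (r y) * f y" "\<lambda>y. c s * f y"] by (simp add: sigma_cmult S_def)

end

text \<open>What remains of the problem after moving a thin point to the origin: \<open>A0\<close>
  is the matrix frozen there, \<open>T\<close> the thin hyperplane and \<open>b\<close> the normal
  component of the flux. \<open>A_close\<close> measures the oscillation of the coefficients in the
  norm of \<open>A0\<close>, so the errors compare directly with frozen energies.\<close>

locale thin_center = gauge_cone P A0 B d
  for P :: "'a::euclidean_space set" and A0 B :: "'a \<Rightarrow> 'a" and d +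
  fixes A :: "'a \<Rightarrow> 'a \<Rightarrow> 'a" and w :: "'a \<Rightarrow> real" and g :: "'a \<Rightarrow> 'a"
    and T :: "'a set" and b :: "'a \<Rightarrow> real" and R0 \<gamma> C0 :: real
  assumes R0: "0 < R0" and \<gamma>: "0 < \<gamma>" and C0: "0 \<le> C0"
    and w_grad: "\<And>y. y \<in> D_ball R0 \<Longrightarrow> (w has_derivative (\<lambda>h. h \<bullet> g y)) (at y within P)"
    and g_cont: "continuous_on (D_ball R0) g"
    and A_cont: "\<And>X V. X \<subseteq> D_ball R0 \<Longrightarrow> continuous_on X V \<Longrightarrow> continuous_on X (\<lambda>y. A y (V y))"
    and A_lin: "\<And>y. linear (A y)"
    and A_sym: "\<And>y p q. y \<in> D_ball R0 \<Longrightarrow> A y p \<bullet> q = p \<bullet> A y q"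
    and A_nonneg: "\<And>y p. y \<in> D_ball R0 \<Longrightarrow> 0 \<le> A y p \<bullet> p"
    and A0_nonneg: "\<And>p. 0 \<le> A0 p \<bullet> p"
    and A_close: "\<And>y p q. y \<in> D_ball R0 \<Longrightarrow>
        \<bar>A y p \<bullet> q - A0 p \<bullet> q\<bar> \<le> C0 * r y powr \<gamma> * (sqrt (A0 p \<bullet> p) * sqrt (A0 q \<bullet> q))"
    and T_cone: "\<And>y t. y \<in> T \<Longrightarrow> 0 \<le> t \<Longrightarrow> t *\<^sub>R y \<in> T"
    and thin: "\<And>y. y \<in> T \<Longrightarrow> y \<in> D_ball R0 \<Longrightarrow> 0 \<le> w y \<and> b y \<le> 0 \<and> w y * b y = 0"
    and weak: "\<And>\<phi> \<psi> \<rho>. 0 < \<rho> \<Longrightarrow> \<rho> < R0 \<Longrightarrow>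
        (\<And>y. y \<in> P \<Longrightarrow> (\<phi> has_derivative (\<lambda>h. h \<bullet> \<psi> y)) (at y within P)) \<Longrightarrow>
        continuous_on P \<psi> \<Longrightarrow>
        (\<And>y. y \<in> P \<Longrightarrow> \<rho> \<le> r y \<Longrightarrow> \<phi> y = 0 \<and> \<psi> y = 0) \<Longrightarrow>
        (\<And>y. y \<in> T \<Longrightarrow> y \<in> D_ball R0 \<Longrightarrow> \<phi> y * b y \<le> 0) \<Longrightarrow>
        0 \<le> I (\<lambda>y. A y (g y) \<bullet> \<psi> y) R0"
begin

lemma flux_cont: "continuous_on (D_ball R0) (\<lambda>y. A y (g y))"
  by (intro A_cont g_cont) auto

lemma w_cont: "continuous_on (D_ball R0) w"
  by (rule grad_imp_continuous_on) (rule has_derivative_subset[OF w_grad], auto simp: D_ball_def)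

lemma open_gauge_ball: "open {y. r y < \<rho>}" "open {y. \<rho> < r y}"
  by (intro open_Collect_less continuous_intros)+

text \<open>Formally the equation is tested with \<open>u\<close> times the indicator of the gauge
  ball, which leaves the flux through the sphere. The indicator becomes a radial cutoff. If the
  inequality failed at \<rho>, it would fail strictly on an interval of radii, and there the cutoff
  is made to vary.\<close>

lemma green_inequality:
  assumes u: "\<And>y. y \<in> D_ball R0 \<Longrightarrow> (u has_derivative (\<lambda>h. h \<bullet> U y)) (at y within P)"
    and U: "continuous_on (D_ball R0) U"
    and sgn: "\<And>y. y \<in> T \<Longrightarrow> y \<in> D_ball R0 \<Longrightarrow> u y * b y \<le> 0"
    and \<rho>: "0 < \<rho>" "\<rho> < R0"
  shows "\<sigma> (\<lambda>y. u y * (A y (g y) \<bullet> \<nu> y)) \<rho> \<le> I (\<lambda>y. A y (g y) \<bullet> U y) \<rho>"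
proof (rule ccontr)
  define f1 where "f1 y = A y (g y) \<bullet> U y" for y
  define f2 where "f2 y = u y * (A y (g y) \<bullet> \<nu> y)" for y
  assume "\<not> ?thesis"
  then have neg: "I f1 \<rho> - \<sigma> f2 \<rho> < 0" by (simp add: f1_def[abs_def] f2_def[abs_def])
  have uc: "continuous_on (D_ball R0) u"
    by (rule grad_imp_continuous_on) (rule has_derivative_subset[OF u], auto simp: D_ball_def)
  have a1: "adm R0 f1" unfolding f1_def by (intro adm_continuous continuous_intros flux_cont U)
  have a2: "adm R0 f2"
  proof -
    have "adm R0 (\<lambda>y. (u y *\<^sub>R A y (g y)) \<bullet> \<nu> y)" by (intro adm_inner_nu continuous_intros flux_cont uc)
    then show ?thesis by (simp add: f2_def[abs_def])
  qed
  have "isCont (\<lambda>s. I f1 s - \<sigma> f2 s) \<rho>"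
    using I_has_derivative[OF a1 \<rho>] sigma_continuous[OF _ \<rho>, of f2] a2
    by (intro continuous_intros) (auto simp: adm_def DERIV_isCont)
  then have "((\<lambda>s. I f1 s - \<sigma> f2 s) \<longlongrightarrow> I f1 \<rho> - \<sigma> f2 \<rho>) (nhds \<rho>)"
    using tendsto_at_iff_tendsto_nhds[of "\<lambda>s. I f1 s - \<sigma> f2 s" \<rho>] unfolding isCont_def by blast
  from order_tendstoD(2)[OF this neg] have "eventually (\<lambda>s. I f1 s - \<sigma> f2 s < 0) (nhds \<rho>)" .
  then obtain h0 where h0: "h0 > 0" "\<And>s. dist s \<rho> < h0 \<Longrightarrow> I f1 s - \<sigma> f2 s < 0"
    unfolding eventually_nhds_metric by blast
  \<comment> \<open>Taking h < \<rho> keeps the cutoff constant near the origin, where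
    \<open>r\<close> is not differentiable; h < \<open>h0\<close> confines the transition to radii
    at which the inequality fails.\<close>
  define h where "h = min (h0 / 2) (\<rho> / 2)"
  have h: "h > 0" "h < \<rho>" "h < h0" using h0 \<rho> by (auto simp: h_def)
  define \<eta> where "\<eta> s = cutoff ((\<rho> - s) / h)" for s
  define \<eta>' where "\<eta>' s = - cutoff' ((\<rho> - s) / h) / h" for s
  have d\<eta>: "(\<eta> has_real_derivative \<eta>' s) (at s)" for s
  proof -
    have "((\<lambda>s. (\<rho> - s) / h) has_real_derivative - 1 / h) (at s)"
      using h by (auto intro!: derivative_eq_intros)
    from DERIV_chain2[OF cutoff_has_derivative this] show ?thesis by (simp add: \<eta>_def[abs_def] \<eta>'_def)
  qed
  have \<eta>0: "\<eta> s = 0" "\<eta>' s = 0" if "\<rho> \<le> s" for s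
    using that h by (auto simp: \<eta>_def \<eta>'_def divide_nonpos_pos intro!: cutoff_0 cutoff'_0)
  have \<eta>1: "\<eta> s = 1" "\<eta>' s = 0" if "s \<le> \<rho> - h" for s
    using that h by (auto simp: \<eta>_def \<eta>'_def le_divide_eq intro!: cutoff_1 cutoff'_1)
  have c\<eta>: "continuous_on X \<eta>" "continuous_on X \<eta>'" for X
    unfolding \<eta>_def[abs_def] \<eta>'_def[abs_def] using h by (auto intro!: continuous_intros)
  have c\<eta>r: "continuous_on X (\<lambda>y. \<eta> (r y))" "continuous_on X (\<lambda>y. \<eta>' (r y))" for X
    by (auto intro!: continuous_on_compose2[OF c\<eta>(1)[of UNIV]] continuous_on_compose2[OF c\<eta>(2)[of UNIV]] continuous_intros)
  define \<eta>g where "\<eta>g y = \<eta>' (r y) *\<^sub>R \<nu> y" for y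
  have d\<eta>r: "((\<lambda>y. \<eta> (r y)) has_derivative (\<lambda>k. k \<bullet> \<eta>g y)) (at y)" for y
  proof (cases "y = 0")
    case False
    from has_derivative_compose[OF r_has_derivative[OF this] d\<eta>[unfolded has_field_derivative_def]]
    show ?thesis by (simp add: \<eta>g_def \<nu>_def mult_ac)
  next
    case True
    have "((\<lambda>_. 1) has_derivative (\<lambda>k. k \<bullet> \<eta>g y)) (at y)" using True by (simp add: \<eta>g_def \<nu>_def)
    then show ?thesis
      by (rule has_derivative_transform_within_open[OF _ open_gauge_ball(1)[of "\<rho> - h"]])
        (use True h \<eta>1 in auto)
  qed
  have c\<eta>g: "continuous_on UNIV \<eta>g"
  proof -
    have "continuous_on ({y. r y \<le> \<rho> - h} \<union> {y. \<rho> - h \<le> r y}) \<eta>g"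
    proof (rule continuous_on_closed_Un)
      show "closed {y. r y \<le> \<rho> - h}" "closed {y. \<rho> - h \<le> r y}"
        by (intro closed_Collect_le continuous_intros)+
      show "continuous_on {y. r y \<le> \<rho> - h} \<eta>g"
        by (rule continuous_on_eq[of _ "\<lambda>_. 0"]) (auto simp: \<eta>g_def \<eta>1)
      show "continuous_on {y. \<rho> - h \<le> r y} \<eta>g"
        unfolding \<eta>g_def using h by (intro continuous_intros c\<eta>r continuous_on_subset[OF continuous_nu]) auto
    qed
    moreover have "{y. r y \<le> \<rho> - h} \<union> {y. \<rho> - h \<le> r y} = UNIV" by auto
    ultimately show ?thesis by simp
  qed
  define \<phi> where "\<phi> y = (if r y < R0 then \<eta> (r y) * u y else 0)" for y
  define \<psi> where "\<psi> y = (if r y < R0 then \<eta> (r y) *\<^sub>R U y + u y *\<^sub>R \<eta>g y else 0)" for y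
  have "0 \<le> I (\<lambda>y. A y (g y) \<bullet> \<psi> y) R0"
  proof (rule weak[OF \<rho>, of \<phi>])
    fix y assume y: "y \<in> P"
    show "(\<phi> has_derivative (\<lambda>h. h \<bullet> \<psi> y)) (at y within P)"
    proof (cases "r y < R0")
      case True
      have "((\<lambda>y. \<eta> (r y) * u y) has_derivative (\<lambda>h. h \<bullet> \<psi> y)) (at y within P)"
        using has_derivative_mult[OF has_derivative_at_withinI[OF d\<eta>r] u[of y]] y True
        by (simp add: D_ball_def \<psi>_def inner_add_right mult_ac)
      then show ?thesis
        by (rule has_derivative_transform_within_open[OF _ open_gauge_ball(1)[of R0]])
          (use True y in \<open>auto simp: \<phi>_def\<close>)
    next
      case False
      have "((\<lambda>_. 0) has_derivative (\<lambda>h. h \<bullet> \<psi> y)) (at y within P)"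
        using False by (simp add: \<psi>_def)
      then show ?thesis
        by (rule has_derivative_transform_within_open[OF _ open_gauge_ball(2)[of \<rho>]])
          (use False y \<rho> \<eta>0 in \<open>auto simp: \<phi>_def\<close>)
    qed
    show "\<phi> y = 0 \<and> \<psi> y = 0" if "\<rho> \<le> r y" using that by (simp add: \<phi>_def \<psi>_def \<eta>0 \<eta>g_def)
  next
    define \<rho>1 where "\<rho>1 = (\<rho> + R0) / 2"
    have "continuous_on ({y \<in> P. r y \<le> \<rho>1} \<union> {y \<in> P. \<rho> \<le> r y}) \<psi>"
    proof (rule continuous_on_closed_Un)
      have "{y \<in> P. r y \<le> \<rho>1} = P \<inter> {y. r y \<le> \<rho>1}" "{y \<in> P. \<rho> \<le> r y} = P \<inter> {y. \<rho> \<le> r y}" by auto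
      moreover have "closed {y. r y \<le> \<rho>1}" "closed {y. \<rho> \<le> r y}"
        by (intro closed_Collect_le continuous_intros)+
      ultimately show "closed {y \<in> P. r y \<le> \<rho>1}" "closed {y \<in> P. \<rho> \<le> r y}"
        using closed_P by auto
      have sub: "{y \<in> P. r y \<le> \<rho>1} \<subseteq> D_ball R0" using \<rho> by (auto simp: D_ball_def \<rho>1_def)
      have "continuous_on {y \<in> P. r y \<le> \<rho>1} (\<lambda>y. \<eta> (r y) *\<^sub>R U y + u y *\<^sub>R \<eta>g y)"
        by (intro continuous_intros c\<eta>r continuous_on_subset[OF U sub] continuous_on_subset[OF uc sub]
            continuous_on_subset[OF c\<eta>g]) auto
      then show "continuous_on {y \<in> P. r y \<le> \<rho>1} \<psi>"
        by (rule continuous_on_eq) (use sub in \<open>auto simp: \<psi>_def D_ball_def\<close>)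
      show "continuous_on {y \<in> P. \<rho> \<le> r y} \<psi>"
        by (rule continuous_on_eq[of _ "\<lambda>_. 0"]) (auto simp: \<psi>_def \<eta>0 \<eta>g_def)
    qed
    moreover have "{y \<in> P. r y \<le> \<rho>1} \<union> {y \<in> P. \<rho> \<le> r y} = P" using \<rho> by (auto simp: \<rho>1_def)
    ultimately show "continuous_on P \<psi>" by simp
  next
    fix y assume y: "y \<in> T" "y \<in> D_ball R0"
    have "\<eta> (r y) * (u y * b y) \<le> 0"
      unfolding \<eta>_def by (rule mult_nonneg_nonpos[OF cutoff_bounds(1) sgn[OF y]])
    then show "\<phi> y * b y \<le> 0" using y by (simp add: \<phi>_def D_ball_def mult.assoc)
  qed
  also have "I (\<lambda>y. A y (g y) \<bullet> \<psi> y) R0 = I (\<lambda>y. \<eta> (r y) * f1 y + \<eta>' (r y) * f2 y) \<rho>"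
  proof -
    have "I (\<lambda>y. A y (g y) \<bullet> \<psi> y) R0 = I (\<lambda>y. A y (g y) \<bullet> \<psi> y) \<rho>"
      unfolding I_def
    proof (rule set_integral_eq_subset)
      show "E \<rho> \<subseteq> E R0" using E_mono \<rho> by simp
      fix y assume "y \<in> E R0 - E \<rho>"
      then have "\<rho> \<le> r y" by (auto simp: E_def)
      then show "A y (g y) \<bullet> \<psi> y = 0" by (simp add: \<psi>_def \<eta>0 \<eta>g_def)
    qed
    also have "\<dots> = I (\<lambda>y. \<eta> (r y) * f1 y + \<eta>' (r y) * f2 y) \<rho>"
    proof (rule I_cong)
      fix y assume "y \<in> E \<rho>"
      then have "r y < R0" using \<rho> by (simp add: E_def)
      then show "A y (g y) \<bullet> \<psi> y = \<eta> (r y) * f1 y + \<eta>' (r y) * f2 y"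
        by (simp add: \<psi>_def f1_def f2_def \<eta>g_def inner_add_right)
    qed
    finally show ?thesis .
  qed
  finally have pos: "0 \<le> I (\<lambda>y. \<eta> (r y) * f1 y + \<eta>' (r y) * f2 y) \<rho>" .
  have b1: "adm R0 (\<lambda>y. \<eta> (r y) * f1 y)" and b2: "adm R0 (\<lambda>y. \<eta>' (r y) * f2 y)"
    by (intro adm_mult adm_radial c\<eta> a1 a2)+
  \<comment> \<open>The derivative of \<open>M\<close> is - \<eta>'(s) * (I f1 s - \<sigma> f2 s),
    as the terms with \<open>\<sigma> f1\<close> cancel. On the transition zone this is negative,
    yet \<open>M\<close> is 0 at \<rho> - h and nonnegative at \<rho>. The mean value theorem thus
    replaces writing the \<eta>' term as an integral over spheres.\<close>
  define M where "M s = I (\<lambda>y. \<eta> (r y) * f1 y + \<eta>' (r y) * f2 y) s - \<eta> s * I f1 s" for s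
  have dM: "(M has_real_derivative - \<eta>' s * (I f1 s - \<sigma> f2 s)) (at s)" if s: "0 < s" "s < R0" for s
  proof -
    have S: "continuous_on (S s) (\<lambda>y. \<eta> (r y) * f1 y)" "continuous_on (S s) (\<lambda>y. \<eta>' (r y) * f2 y)"
      using adm_continuous_S b1 b2 s by auto
    have "(M has_real_derivative \<sigma> (\<lambda>y. \<eta> (r y) * f1 y + \<eta>' (r y) * f2 y) s - (\<eta>' s * I f1 s + \<sigma> f1 s * \<eta> s)) (at s)"
      unfolding M_def[abs_def]
      by (intro DERIV_diff DERIV_mult d\<eta> I_has_derivative[OF adm_add[OF b1 b2] s] I_has_derivative[OF a1 s])
    then show ?thesis
      unfolding sigma_add[OF s(1) S] sigma_radial_mult[OF s(1)] by (simp add: algebra_simps)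
  qed
  obtain z where z: "\<rho> - h < z" "z < \<rho>" "M \<rho> - M (\<rho> - h) = (\<rho> - (\<rho> - h)) * (- \<eta>' z * (I f1 z - \<sigma> f2 z))"
    using MVT2[of "\<rho> - h" \<rho> M "\<lambda>s. - \<eta>' s * (I f1 s - \<sigma> f2 s)"] dM h \<rho> by force
  have "- \<eta>' z > 0" using z h cutoff'_pos[of "(\<rho> - z) / h"] by (simp add: \<eta>'_def)
  moreover have "I f1 z - \<sigma> f2 z < 0" using z h by (intro h0(2)) (auto simp: dist_real_def)
  ultimately have "- \<eta>' z * (I f1 z - \<sigma> f2 z) < 0" by (rule mult_pos_neg)
  from mult_pos_neg[OF h(1) this] z(3) have "M \<rho> < M (\<rho> - h)" by simp
  moreover have "M (\<rho> - h) = 0"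
  proof -
    have "I (\<lambda>y. \<eta> (r y) * f1 y + \<eta>' (r y) * f2 y) (\<rho> - h) = I f1 (\<rho> - h)"
      by (rule I_cong) (auto simp: E_def \<eta>1)
    then show ?thesis by (simp add: M_def \<eta>1)
  qed
  moreover have "0 \<le> M \<rho>" using pos by (simp add: M_def \<eta>0)
  ultimately show False by simp
qed

text \<open>Complementarity makes \<open>w y * b y\<close> vanish on the thin set, so both
  \<open>w\<close> and \<open>- w\<close> are admissible in Green's inequality, and the two results
  are opposite.\<close>

lemma energy_identity:
  assumes \<rho>: "0 < \<rho>" "\<rho> < R0"
  shows "I (\<lambda>y. A y (g y) \<bullet> g y) \<rho> = \<sigma> (\<lambda>y. w y * (A y (g y) \<bullet> \<nu> y)) \<rho>"
proof (rule antisym)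
  have "\<sigma> (\<lambda>y. (- w y) * (A y (g y) \<bullet> \<nu> y)) \<rho> \<le> I (\<lambda>y. A y (g y) \<bullet> (- g y)) \<rho>"
  proof (rule green_inequality[OF _ _ _ \<rho>])
    fix y assume y: "y \<in> D_ball R0"
    show "((\<lambda>y. - w y) has_derivative (\<lambda>h. h \<bullet> - g y)) (at y within P)"
      using has_derivative_minus[OF w_grad[OF y]] by simp
    show "- w y * b y \<le> 0" if "y \<in> T"
    proof -
      have "w y * b y = 0" using thin[OF that y] by blast
      then show ?thesis by linarith
    qed
  qed (intro continuous_intros g_cont)
  then show "I (\<lambda>y. A y (g y) \<bullet> g y) \<rho> \<le> \<sigma> (\<lambda>y. w y * (A y (g y) \<bullet> \<nu> y)) \<rho>"
    using sigma_cmult[of "-1" "\<lambda>y. w y * (A y (g y) \<bullet> \<nu> y)" \<rho>] I_cmult[of "-1" "\<lambda>y. A y (g y) \<bullet> g y" \<rho>]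
    by simp
  show "\<sigma> (\<lambda>y. w y * (A y (g y) \<bullet> \<nu> y)) \<rho> \<le> I (\<lambda>y. A y (g y) \<bullet> g y) \<rho>"
  proof (rule green_inequality[OF w_grad g_cont _ \<rho>])
    fix y assume "y \<in> T" "y \<in> D_ball R0"
    then have "w y * b y = 0" using thin by blast
    then show "w y * b y \<le> 0" by linarith
  qed
qed

end

section \<open>Differential inequalities for the energy and the height, and their growth
  consequences\<close>

subsection \<open>Almost monotonicity of the Weiss energy\<close>

text \<open>The inequality is available only where \<open>Q\<close> is nonpositive. There Q(t) *
  t^(-M) is nondecreasing, hence towards smaller radii it cannot climb from its negative value at
  \<open>R\<close>, and so never reaches the region where the inequality is lost.\<close>

lemma ode_stays_negative:
  fixes Q Q' :: "real \<Rightarrow> real"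
  assumes dQ: "\<And>s. 0 < s \<Longrightarrow> s \<le> R \<Longrightarrow> (Q has_real_derivative Q' s) (at s)"
    and ineq: "\<And>s. 0 < s \<Longrightarrow> s \<le> R \<Longrightarrow> Q s \<le> 0 \<Longrightarrow> M / s * Q s \<le> Q' s"
    and R: "0 < R" "Q R < 0" and s: "0 < s" "s \<le> R"
  shows "Q s \<le> Q R * (s / R) powr M"
proof -
  define Y where "Y t = Q t * t powr (- M)" for t
  define Y' where "Y' t = (Q' t - M / t * Q t) * t powr (- M)" for t
  have dY: "(Y has_real_derivative Y' t) (at t)" if "0 < t" "t \<le> R" for t
  proof -
    have "((\<lambda>t. t powr (- M)) has_real_derivative (- M) * t powr (- M - 1)) (at t)"
      using that by (auto intro!: derivative_eq_intros)
    from DERIV_mult[OF dQ[OF that] this]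
    have "(Y has_real_derivative Q' t * t powr (- M) + (- M) * t powr (- M - 1) * Q t) (at t)"
      unfolding Y_def[abs_def] .
    moreover have "t powr (- M - 1) = t powr (- M) / t" using that by (simp add: powr_diff)
    ultimately show ?thesis by (simp add: Y'_def algebra_simps)
  qed
  have Y'0: "0 \<le> Y' t" if "0 < t" "t \<le> R" "Y t \<le> 0" for t
    using ineq[of t] that by (auto simp: Y'_def Y_def mult_le_0_iff intro!: mult_nonneg_nonneg)
  have YR: "Y R < 0" using R by (simp add: Y_def mult_neg_pos)
  have "Y s \<le> Y R"
  proof (rule ccontr)
    assume "\<not> Y s \<le> Y R"
    then have Ys: "Y R < Y s" by simp
    \<comment> \<open>A negative level strictly between \<open>Y R\<close> and \<open>Y s\<close>.
      To the right of the last radius at which \<open>Y\<close> reaches it \<open>Y\<close> is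
      negative, hence nondecreasing up to \<open>R\<close>, which contradicts \<open>Y R\<close> <
      \<open>c\<close>.\<close>
    define c where "c = (Y R + min 0 (Y s)) / 2"
    have c: "Y R < c" "c < 0" "c < Y s" using YR Ys by (auto simp: c_def min_def)
    define X where "X = {t \<in> {s..R}. c \<le> Y t}"
    have cY: "continuous_on {s..R} Y"
      using s by (intro continuous_at_imp_continuous_on ballI DERIV_isCont[OF dY]) auto
    have "compact X"
    proof -
      have "X = {s..R} \<inter> Y -` {c..}" by (auto simp: X_def)
      moreover have "closed ({s..R} \<inter> Y -` {c..})" by (rule continuous_closed_preimage[OF cY]) auto
      moreover have "bounded ({s..R} \<inter> Y -` {c..})"
        by (rule bounded_subset[of "{s..R}"]) auto
      ultimately show ?thesis by (simp add: compact_eq_bounded_closed)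
    qed
    moreover have "s \<in> X" using s c by (simp add: X_def)
    then have "X \<noteq> {}" by blast
    ultimately obtain t where t: "t \<in> X" "\<And>u. u \<in> X \<Longrightarrow> u \<le> t" using compact_attains_sup[of X] by blast
    have "t \<noteq> R" using t(1) c(1) by (auto simp: X_def)
    then have tR: "s \<le> t" "t < R" using t(1) by (auto simp: X_def)
    have neg: "Y u < c" if "t < u" "u \<le> R" for u
      using t(2)[of u] that tR by (force simp: X_def)
    obtain z where z: "t < z" "z < R" "Y R - Y t = (R - t) * Y' z"
      using MVT2[OF tR(2), of Y Y'] dY s tR by force
    have "0 \<le> Y' z" using neg[of z] z c s tR by (intro Y'0) auto
    then have "Y t \<le> Y R" using z(3) tR mult_nonneg_nonneg[of "R - t" "Y' z"] by linarith
    then show False using t(1) c by (simp add: X_def)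
  qed
  then have "Q s * s powr (- M) * s powr M \<le> Q R * R powr (- M) * s powr M"
    unfolding Y_def by (rule mult_right_mono) simp
  then show ?thesis using s R by (simp add: powr_minus powr_divide field_simps)
qed

context thin_center
begin

lemma continuous_radial_vec:
  assumes "continuous_on (S \<rho>) m" "0 < \<rho>"
  shows "continuous_on (P - {0}) (\<lambda>y. m ((\<rho> / r y) *\<^sub>R y))"
proof (rule continuous_on_compose2[OF assms(1)])
  show "continuous_on (P - {0}) (\<lambda>y. (\<rho> / r y) *\<^sub>R y)" by (intro continuous_intros) auto
  show "(\<lambda>y. (\<rho> / r y) *\<^sub>R y) ` (P - {0}) \<subseteq> S \<rho>" using radial_in_S assms(2) by fastforce
qed

definition e :: "'a \<Rightarrow> real" where "e y = A0 (g y) \<bullet> g y"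
definition wn :: "'a \<Rightarrow> real" where "wn y = (g y \<bullet> y) / r y"
definition energy :: "real \<Rightarrow> real" where "energy = I e"
definition height :: "real \<Rightarrow> real" where "height = \<sigma> (\<lambda>y. (w y)\<^sup>2)"

lemma A0_nu: "A0 (\<nu> y) = (1 / r y) *\<^sub>R y"
  unfolding \<nu>_def by (rule A0_grad_r)

lemma A0_inner_nu: "A0 p \<bullet> \<nu> y = (p \<bullet> y) / r y"
  by (simp add: sym_A0 A0_nu)

lemma A0_nu_nu: "y \<noteq> 0 \<Longrightarrow> A0 (\<nu> y) \<bullet> \<nu> y = 1"
  using r_square[of y] r_pos_iff[of y]
  by (simp add: A0_nu) (simp add: \<nu>_def inner_commute power2_eq_square field_simps)

lemma A0_cont: "continuous_on X V \<Longrightarrow> continuous_on X (\<lambda>y. A0 (V y))"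
  by (intro bounded_linear.continuous_on[OF linear_conv_bounded_linear[THEN iffD1, OF lin_A0]])

lemma S_subset_D_ball: "\<rho> < R0 \<Longrightarrow> S \<rho> \<subseteq> D_ball R0"
  by (auto simp: S_def D_ball_def)

lemma continuous_on_S:
  assumes "0 < \<rho>" "\<rho> < R0"
  shows "continuous_on (S \<rho>) w" "continuous_on (S \<rho>) g" "continuous_on (S \<rho>) \<nu>"
    "continuous_on (S \<rho>) e" "continuous_on (S \<rho>) wn" "continuous_on (S \<rho>) (\<lambda>y. A y (g y))"
proof -
  note sub = S_subset_D_ball[OF assms(2)]
  have nz: "y \<noteq> 0" "r y \<noteq> 0" if "y \<in> S \<rho>" for y using that assms by (auto simp: S_def)
  show w: "continuous_on (S \<rho>) w" and g: "continuous_on (S \<rho>) g"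
    "continuous_on (S \<rho>) (\<lambda>y. A y (g y))"
    using continuous_on_subset[OF w_cont sub] continuous_on_subset[OF g_cont sub] continuous_on_subset[OF flux_cont sub] by auto
  show "continuous_on (S \<rho>) \<nu>" by (rule continuous_on_subset[OF continuous_nu]) (use nz in auto)
  show "continuous_on (S \<rho>) e" "continuous_on (S \<rho>) wn"
    unfolding e_def[abs_def] wn_def[abs_def] using nz by (auto intro!: continuous_intros A0_cont g)
qed

lemma adm_e: "adm R0 e"
  unfolding e_def[abs_def] by (intro adm_continuous continuous_intros A0_cont g_cont)

lemma energy_has_derivative:
  assumes "0 < \<rho>" "\<rho> < R0"
  shows "(energy has_real_derivative \<sigma> e \<rho>) (at \<rho>)"
  unfolding energy_def by (rule I_has_derivative[OF adm_e assms])

lemma height_has_derivative: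
  assumes "0 < \<rho>" "\<rho> < R0"
  shows "(height has_real_derivative (real d - 1) / \<rho> * height \<rho> + 2 * \<sigma> (\<lambda>y. w y * wn y) \<rho>) (at \<rho>)"
proof -
  have "(\<sigma> (\<lambda>y. (w y)\<^sup>2) has_real_derivative (real d - 1) / \<rho> * \<sigma> (\<lambda>y. (w y)\<^sup>2) \<rho> +
      \<sigma> (\<lambda>z. (z \<bullet> ((2 * w z) *\<^sub>R g z)) / r z) \<rho>) (at \<rho>)"
  proof (rule sigma_has_derivative[OF _ _ assms])
    fix y assume "y \<in> E R0"
    then have "y \<in> D_ball R0" using E_subset_D_ball by blast
    from w_grad[OF this] show "((\<lambda>y. (w y)\<^sup>2) has_derivative (\<lambda>h. h \<bullet> ((2 * w y) *\<^sub>R g y))) (at y within P)"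
      by (auto intro!: derivative_eq_intros)
  next
    show "continuous_on (E R0) (\<lambda>y. (2 * w y) *\<^sub>R g y)"
      by (intro continuous_intros continuous_on_subset[OF w_cont E_subset_D_ball] continuous_on_subset[OF g_cont E_subset_D_ball])
  qed
  moreover have "(\<lambda>z. (z \<bullet> ((2 * w z) *\<^sub>R g z)) / r z) = (\<lambda>z. 2 * (w z * wn z))"
    by (auto simp: wn_def inner_commute)
  ultimately show ?thesis by (simp add: height_def sigma_cmult)
qed

lemma energy_nonneg: "0 \<le> energy \<rho>"
  unfolding energy_def I_def set_lebesgue_integral_def
  by (intro integral_nonneg_AE) (auto simp: e_def A0_nonneg)

lemma sigma_nonneg:
  assumes "0 < \<rho>" "continuous_on (S \<rho>) f" "\<And>y. y \<in> S \<rho> \<Longrightarrow> 0 \<le> f y"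
  shows "0 \<le> \<sigma> f \<rho>"
  using sigma_mono[OF assms(1) continuous_on_const assms(2), of 0] assms sigma_const[OF assms(1), of 0] by simp

lemma height_nonneg: "0 < \<rho> \<Longrightarrow> \<rho> < R0 \<Longrightarrow> 0 \<le> height \<rho>"
  unfolding height_def by (intro sigma_nonneg continuous_intros continuous_on_S) auto

text \<open>The competitor is the extension of \<open>w\<close> from the sphere \<open>S \<rho>\<close> that is homogeneous of degree \<open>\<kappa>\<close>.\<close>

lemma competitor_energy:
  fixes \<kappa> \<rho> :: real
  assumes \<kappa>: "1 < \<kappa>" and \<rho>: "0 < \<rho>" "\<rho> < R0"
  shows "(1 - C0 * \<rho> powr \<gamma>) * energy \<rho> \<le> (1 + C0 * \<rho> powr \<gamma>) *
    (\<rho> / (2 * \<kappa> - 2 + d) * (\<sigma> e \<rho> + (\<kappa> / \<rho>)\<^sup>2 * height \<rho> - \<sigma> (\<lambda>y. (wn y)\<^sup>2) \<rho>))"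
proof -
  define \<delta> where "\<delta> = C0 * \<rho> powr \<gamma>"
  have \<delta>: "0 \<le> \<delta>" using C0 by (simp add: \<delta>_def)
  define N where "N y = (\<rho> / r y) *\<^sub>R y" for y
  \<comment> \<open>On the sphere, \<open>m\<close> is \<open>g\<close> with its radial derivative
    changed to \<kappa> * w / \<rho>, the value that homogeneity prescribes; the part orthogonal to
    \<nu> in the form of \<open>A0\<close> is kept. \<open>V\<close> extends \<open>m\<close> with
    degree \<kappa> - 1.\<close>
  define m where "m z = g z + ((\<kappa> * w z - g z \<bullet> z) / \<rho>) *\<^sub>R \<nu> z" for z
  define q where "q y = (r y / \<rho>) powr (\<kappa> - 1)" for y
  define v where "v y = (r y / \<rho>) powr \<kappa> * w (N y)" for y
  define V where "V y = q y *\<^sub>R m (N y)" for y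
  have NS: "N y \<in> S \<rho>" if "y \<in> P" "y \<noteq> 0" for y
    unfolding N_def using radial_in_S[OF that, of \<rho>] \<rho> by simp
  have mS: "continuous_on (S \<rho>) m"
    unfolding m_def using \<rho> by (intro continuous_intros continuous_on_S) auto
  have q0: "q 0 = 0" by (simp add: q_def)
  \<comment> \<open>Here \<kappa> > 1 enters: the positive exponent \<kappa> - 1 makes
    \<open>q\<close> continuous with value 0 at the origin, so \<open>v\<close> is C^1 across
    it.\<close>
  have qc: "continuous_on X q" for X
    unfolding q_def using \<kappa> \<rho>
    by (intro continuous_on_powr' continuous_intros) auto
  have \<nu>N: "\<nu> (N y) = \<nu> y" if "y \<noteq> 0" for y
    using that \<rho> by (simp add: \<nu>_def N_def r_scale linear_scale[OF lin_B] r_pos_iff)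
  have split: "(r y / \<rho>) powr \<kappa> = q y * (r y / \<rho>)" for y
    using \<rho> by (cases "y = 0") (simp_all add: q_def powr_diff)
  have dv: "(v has_derivative (\<lambda>h. h \<bullet> V y)) (at y within P)" if y: "y \<in> P" for y
  proof (cases "y = 0")
    case False
    have r: "0 < r y" using False by (simp add: r_pos_iff)
    have dr: "(r has_derivative (\<lambda>h. h \<bullet> \<nu> y)) (at y)" unfolding \<nu>_def by (rule r_has_derivative[OF False])
    have "((\<lambda>s. (s / \<rho>) powr \<kappa>) has_real_derivative \<kappa> * (r y / \<rho>) powr (\<kappa> - 1) / \<rho>) (at (r y))"
      using r \<rho> by (auto intro!: derivative_eq_intros)
    from has_derivative_compose[OF dr this[unfolded has_field_derivative_def]]
    have dp: "((\<lambda>y. (r y / \<rho>) powr \<kappa>) has_derivative (\<lambda>h. \<kappa> * q y / \<rho> * (h \<bullet> \<nu> y))) (at y)"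
      by (simp add: q_def)
    have "((\<lambda>s. \<rho> / s) has_real_derivative - \<rho> / (r y)\<^sup>2) (at (r y))"
      using r by (auto intro!: derivative_eq_intros simp: power2_eq_square)
    from has_derivative_compose[OF dr this[unfolded has_field_derivative_def]]
    have dN1: "((\<lambda>y. \<rho> / r y) has_derivative (\<lambda>h. - \<rho> / (r y)\<^sup>2 * (h \<bullet> \<nu> y))) (at y)" .
    have dN: "(N has_derivative (\<lambda>h. (\<rho> / r y) *\<^sub>R h + (- \<rho> / (r y)\<^sup>2 * (h \<bullet> \<nu> y)) *\<^sub>R y)) (at y within P)"
      unfolding N_def[abs_def]
      using has_derivative_at_withinI[OF has_derivative_scaleR[OF dN1 has_derivative_ident]] .
    have "N ` P \<subseteq> P" unfolding N_def using cone_P \<rho> by auto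
    moreover have "N y \<in> D_ball R0" using NS[OF y False] S_subset_D_ball[OF \<rho>(2)] by blast
    ultimately have dw: "(w has_derivative (\<lambda>h. h \<bullet> g (N y))) (at (N y) within N ` P)"
      using has_derivative_subset[OF w_grad] by blast
    have dwN: "((\<lambda>y. w (N y)) has_derivative
        (\<lambda>h. ((\<rho> / r y) *\<^sub>R h + (- \<rho> / (r y)\<^sup>2 * (h \<bullet> \<nu> y)) *\<^sub>R y) \<bullet> g (N y))) (at y within P)"
      by (rule has_derivative_in_compose[OF dN dw])
    have "(v has_derivative (\<lambda>h. (r y / \<rho>) powr \<kappa> * (((\<rho> / r y) *\<^sub>R h + (- \<rho> / (r y)\<^sup>2 * (h \<bullet> \<nu> y)) *\<^sub>R y) \<bullet> g (N y)) +
        \<kappa> * q y / \<rho> * (h \<bullet> \<nu> y) * w (N y))) (at y within P)"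
      unfolding v_def[abs_def] by (rule has_derivative_mult[OF has_derivative_at_withinI[OF dp] dwN])
    then show ?thesis
    proof (rule has_derivative_eq_rhs, intro ext)
      fix h
      have gN: "g (N y) \<bullet> N y = \<rho> / r y * (y \<bullet> g (N y))" by (simp add: N_def inner_commute)
      have "((\<rho> / r y) *\<^sub>R h + (- \<rho> / (r y)\<^sup>2 * (h \<bullet> \<nu> y)) *\<^sub>R y) \<bullet> g (N y) =
          \<rho> / r y * (h \<bullet> g (N y) - (h \<bullet> \<nu> y) * (y \<bullet> g (N y)) / r y)"
        unfolding inner_add_left inner_scaleR_left by (simp add: power2_eq_square right_diff_distrib mult_ac)
      moreover have "(r y / \<rho>) powr \<kappa> * (\<rho> / r y) = q y" unfolding split using r \<rho> False by simp
      ultimately have "(r y / \<rho>) powr \<kappa> * (((\<rho> / r y) *\<^sub>R h + (- \<rho> / (r y)\<^sup>2 * (h \<bullet> \<nu> y)) *\<^sub>R y) \<bullet> g (N y)) =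
          q y * (h \<bullet> g (N y) - (h \<bullet> \<nu> y) * (y \<bullet> g (N y)) / r y)"
        by (metis mult.assoc)
      then have *: "(r y / \<rho>) powr \<kappa> * (((\<rho> / r y) *\<^sub>R h + (- \<rho> / (r y)\<^sup>2 * (h \<bullet> \<nu> y)) *\<^sub>R y) \<bullet> g (N y)) +
        \<kappa> * q y / \<rho> * (h \<bullet> \<nu> y) * w (N y) =
          q y * (h \<bullet> g (N y) - (h \<bullet> \<nu> y) * (y \<bullet> g (N y)) / r y) + \<kappa> * q y / \<rho> * (h \<bullet> \<nu> y) * w (N y)"
        by simp
      show "(r y / \<rho>) powr \<kappa> * (((\<rho> / r y) *\<^sub>R h + (- \<rho> / (r y)\<^sup>2 * (h \<bullet> \<nu> y)) *\<^sub>R y) \<bullet> g (N y)) +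
        \<kappa> * q y / \<rho> * (h \<bullet> \<nu> y) * w (N y) = h \<bullet> V y"
        unfolding * using r \<rho> by (simp add: V_def m_def \<nu>N[OF False] inner_add_right gN field_simps)
    qed
  next
    case True
    obtain M where M: "\<And>y. y \<in> S \<rho> \<Longrightarrow> \<bar>w y\<bar> \<le> M" using bounded_on_S[OF continuous_on_S(1)[OF \<rho>] \<rho>(1)] by blast
    have "(v has_derivative (\<lambda>h. 0)) (at 0 within P)"
      unfolding has_derivative_within_alt
    proof (intro conjI allI impI)
      fix \<epsilon> :: real assume "0 < \<epsilon>"
      define \<epsilon>' where "\<epsilon>' = \<epsilon> * \<rho> / (2 * (\<bar>M\<bar> + 1))"
      have "\<epsilon>' > 0" using \<open>0 < \<epsilon>\<close> \<rho> by (simp add: \<epsilon>'_def)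
      obtain \<delta> where \<delta>: "\<delta> > 0" "\<And>y. dist y 0 < \<delta> \<Longrightarrow> dist (q y) (q 0) < \<epsilon>'"
        using qc[of UNIV] \<open>\<epsilon>' > 0\<close> unfolding continuous_on_iff by (metis UNIV_I)
      show "\<exists>\<delta>>0. \<forall>y\<in>P. norm (y - 0) < \<delta> \<longrightarrow> norm (v y - v 0 - 0) \<le> \<epsilon> * norm (y - 0)"
      proof (intro exI[where x=\<delta>] conjI ballI impI)
        fix y assume y: "y \<in> P" "norm (y - 0) < \<delta>"
        show "norm (v y - v 0 - 0) \<le> \<epsilon> * norm (y - 0)"
        proof (cases "y = 0")
          case False
          have q: "0 \<le> q y" "q y \<le> \<epsilon>'" using \<delta>(2)[of y] y by (auto simp: q0 q_def)
          have "\<bar>w (N y)\<bar> \<le> \<bar>M\<bar> + 1" using M[OF NS[OF y(1) False]] by linarith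
          moreover have "r y / \<rho> \<le> 2 * norm y / \<rho>" using r_le_norm[of y] \<rho> by (intro divide_right_mono) auto
          ultimately have "q y * (r y / \<rho>) * \<bar>w (N y)\<bar> \<le> \<epsilon>' * (2 * norm y / \<rho>) * (\<bar>M\<bar> + 1)"
            using q \<rho> \<open>\<epsilon>' > 0\<close> by (intro mult_mono) auto
          also have "\<dots> = \<epsilon> * norm y" using \<rho> unfolding \<epsilon>'_def by (simp add: divide_simps) 
          finally show ?thesis using \<rho> q by (simp add: v_def split abs_mult)
        qed (use \<open>0 < \<epsilon>\<close> in auto)
      qed (rule \<delta>)
    qed auto
    then show ?thesis using True by (simp add: V_def q0)
  qed
  have Vc: "continuous_on P V"
    unfolding continuous_on_eq_continuous_within
  proof
    fix y assume y: "y \<in> P"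
    show "continuous (at y within P) V"
    proof (cases "y = 0")
      case False
      have "continuous_on (P - {0}) V"
        unfolding V_def N_def by (intro continuous_intros qc continuous_radial_vec[OF mS \<rho>(1)])
      then have "continuous (at y within P - {0}) V"
        using y False by (simp add: continuous_on_eq_continuous_within)
      moreover have "at y within P - {0} = at y within P"
        by (rule at_within_nhd[of y "- {0}"]) (use False in auto)
      ultimately show ?thesis by simp
    next
      case True
      have "compact (m ` S \<rho>)" by (rule compact_continuous_image[OF mS S_compact[OF \<rho>(1)]])
      then obtain M where M: "\<And>y. y \<in> S \<rho> \<Longrightarrow> norm (m y) \<le> M"
        by (meson bounded_iff compact_imp_bounded imageI)
      have "(q \<longlongrightarrow> q 0) (at 0 within P)"
        using qc[of P] y True by (auto simp: continuous_on_def)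
      from tendsto_mult_right[OF this, of "\<bar>M\<bar>"]
      have "((\<lambda>y. q y * \<bar>M\<bar>) \<longlongrightarrow> 0) (at 0 within P)" by (simp add: q0)
      then have "(V \<longlongrightarrow> 0) (at 0 within P)"
      proof (rule Lim_null_comparison[rotated])
        show "\<forall>\<^sub>F y in at 0 within P. norm (V y) \<le> q y * \<bar>M\<bar>"
          unfolding eventually_at_filter
        proof (intro always_eventually allI impI)
          fix y assume "y \<noteq> 0" "y \<in> P"
          then have "norm (m (N y)) \<le> \<bar>M\<bar>" using M[OF NS] by (meson abs_ge_self order_trans)
          then show "norm (V y) \<le> q y * \<bar>M\<bar>" by (simp add: V_def q_def mult_left_mono)
        qed
      qed
      then show ?thesis using True by (simp add: continuous_within V_def q0)
    qed
  qed
  then have VD: "continuous_on (D_ball R0) V" by (rule continuous_on_subset) (auto simp: D_ball_def)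
  have vS: "v y = w y" if "y \<in> S \<rho>" for y using that \<rho> by (simp add: v_def N_def S_def)
  \<comment> \<open>\<open>v\<close> and \<open>w\<close> agree on the sphere, so the boundary term
    vanishes. On the thin set \<open>v\<close> is nonnegative because \<open>T\<close> is a cone,
    which gives the sign that Green's inequality asks for.\<close>
  have "\<sigma> (\<lambda>y. (v y - w y) * (A y (g y) \<bullet> \<nu> y)) \<rho> \<le> I (\<lambda>y. A y (g y) \<bullet> (V y - g y)) \<rho>"
  proof (rule green_inequality[OF _ _ _ \<rho>])
    fix y assume y: "y \<in> D_ball R0"
    show "((\<lambda>y. v y - w y) has_derivative (\<lambda>h. h \<bullet> (V y - g y))) (at y within P)"
      using has_derivative_diff[OF dv w_grad[OF y]] y by (simp add: inner_diff_right D_ball_def)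
    assume yT: "y \<in> T"
    note th = thin[OF yT y]
    have "0 \<le> v y"
    proof (cases "y = 0")
      case False
      have yP: "y \<in> P" using y by (simp add: D_ball_def)
      have "N y \<in> T" unfolding N_def using T_cone[OF yT] \<rho> by simp
      moreover have "N y \<in> D_ball R0" using NS[OF yP False] S_subset_D_ball[OF \<rho>(2)] by blast
      ultimately have "0 \<le> w (N y)" using thin by blast
      then show ?thesis by (simp add: v_def)
    qed (simp add: v_def)
    then have "v y * b y \<le> 0" using th by (simp add: mult_nonneg_nonpos)
    moreover have "w y * b y = 0" using th by blast
    ultimately show "(v y - w y) * b y \<le> 0" unfolding left_diff_distrib by linarith
  qed (intro continuous_intros VD g_cont)
  moreover have "\<sigma> (\<lambda>y. (v y - w y) * (A y (g y) \<bullet> \<nu> y)) \<rho> = 0"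
    using sigma_cong[OF \<rho>(1), of "\<lambda>y. (v y - w y) * (A y (g y) \<bullet> \<nu> y)" "\<lambda>_. 0"] vS sigma_const[OF \<rho>(1), of 0] by simp
  ultimately have i0: "0 \<le> I (\<lambda>y. A y (g y) \<bullet> (V y - g y)) \<rho>" by simp
  define f where "f z = A0 (m z) \<bullet> m z" for z
  have fS: "continuous_on (S \<rho>) f" unfolding f_def by (intro continuous_intros A0_cont mS)
  define G where "G y = (r y / \<rho>) powr (2 * \<kappa> - 2) * f ((\<rho> / r y) *\<^sub>R y)" for y
  have aG: "adm R0 G" unfolding G_def[abs_def] using I_homogeneous_extension(2)[OF fS \<rho>(1)] \<kappa> by simp
  have IG: "I G \<rho> = \<rho> / (2 * \<kappa> - 2 + d) * \<sigma> f \<rho>"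
    unfolding G_def[abs_def] using I_homogeneous_extension(1)[OF fS \<rho>(1), of "2 * \<kappa> - 2"] \<kappa> by simp
  have close: "\<bar>A y p \<bullet> p - A0 p \<bullet> p\<bar> \<le> \<delta> * (A0 p \<bullet> p)" if "y \<in> E \<rho>" for y p
  proof -
    have y: "y \<in> D_ball R0" "0 < r y" "r y < \<rho>" using that \<rho> by (auto simp: E_def D_ball_def)
    have "r y powr \<gamma> \<le> \<rho> powr \<gamma>" using y \<gamma> by (intro powr_mono2) auto
    then have "C0 * r y powr \<gamma> * (A0 p \<bullet> p) \<le> \<delta> * (A0 p \<bullet> p)"
      unfolding \<delta>_def using C0 A0_nonneg by (intro mult_right_mono mult_left_mono) auto
    then show ?thesis using A_close[OF y(1), of p p] A0_nonneg[of p] by simp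
  qed
  have "I (\<lambda>y. A y (g y) \<bullet> (V y - g y)) \<rho> \<le> I (\<lambda>y. (1/2 * (1 + \<delta>)) * G y + (- 1/2 * (1 - \<delta>)) * e y) \<rho>"
  proof (rule I_mono)
    show "adm R0 (\<lambda>y. A y (g y) \<bullet> (V y - g y))"
      by (intro adm_continuous continuous_intros flux_cont VD g_cont)
    show "adm R0 (\<lambda>y. (1/2 * (1 + \<delta>)) * G y + (- 1/2 * (1 - \<delta>)) * e y)"
      by (intro adm_add adm_mult[OF _ aG] adm_mult[OF _ adm_e] adm_continuous continuous_intros)
    show "\<rho> < R0" by fact
    fix y assume y: "y \<in> E \<rho>"
    then have yD: "y \<in> D_ball R0" and ny: "y \<noteq> 0" using \<rho> by (auto simp: E_def D_ball_def)
    \<comment> \<open>Positivity of the form at V - g bounds A g . (V - g) by half of A V . V - A g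
      . g, which is the minimising property of \<open>w\<close>. Freezing the matrix then costs the
      factors 1 + \<delta> and 1 - \<delta>.\<close>
    have "0 \<le> A y (V y - g y) \<bullet> (V y - g y)" by (rule A_nonneg[OF yD])
    also have "\<dots> = A y (V y) \<bullet> V y - 2 * (A y (g y) \<bullet> V y) + A y (g y) \<bullet> g y"
      using A_sym[OF yD, of "V y" "g y"] by (simp add: linear_diff[OF A_lin] inner_diff inner_commute)
    finally have "A y (g y) \<bullet> (V y - g y) \<le> 1/2 * (A y (V y) \<bullet> V y) - 1/2 * (A y (g y) \<bullet> g y)"
      by (simp add: inner_diff_right)
    moreover have "A y (V y) \<bullet> V y \<le> (1 + \<delta>) * (A0 (V y) \<bullet> V y)"
      using close[OF y, of "V y"] unfolding distrib_right by linarith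
    moreover have "(1 - \<delta>) * e y \<le> A y (g y) \<bullet> g y"
      using close[OF y, of "g y"] unfolding left_diff_distrib e_def by linarith
    moreover have "A0 (V y) \<bullet> V y = G y"
    proof -
      have "q y * q y = (r y / \<rho>) powr (2 * \<kappa> - 2)" unfolding q_def powr_add[symmetric] by simp
      then show ?thesis
        by (simp add: V_def G_def f_def N_def linear_scale[OF lin_A0] mult.assoc[symmetric])
    qed
    ultimately show "A y (g y) \<bullet> (V y - g y) \<le> 1/2 * (1 + \<delta>) * G y + - 1/2 * (1 - \<delta>) * e y" by simp
  qed
  also have "\<dots> = 1/2 * (1 + \<delta>) * I G \<rho> + (- 1/2 * (1 - \<delta>)) * energy \<rho>"
    unfolding energy_def
    using I_add[of R0 "\<lambda>y. (1/2 * (1 + \<delta>)) * G y" "\<lambda>y. (- 1/2 * (1 - \<delta>)) * e y" \<rho>]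
      adm_mult[OF adm_continuous[OF continuous_on_const] aG, of "1/2 * (1 + \<delta>)"]
      adm_mult[OF adm_continuous[OF continuous_on_const] adm_e, of "- 1/2 * (1 - \<delta>)"] \<rho>(2)
    by (simp only: I_cmult)
  finally have main: "(1 - \<delta>) * energy \<rho> \<le> (1 + \<delta>) * I G \<rho>" using i0 by simp
  have "\<sigma> f \<rho> = \<sigma> (\<lambda>y. e y + ((\<kappa> / \<rho>)\<^sup>2 * (w y)\<^sup>2 + (- 1) * (wn y)\<^sup>2)) \<rho>"
  proof (rule sigma_cong[OF \<rho>(1)])
    fix z assume z: "z \<in> S \<rho>"
    then have nz: "z \<noteq> 0" "r z = \<rho>" using \<rho> by (auto simp: S_def)
    define t where "t = (\<kappa> * w z - g z \<bullet> z) / \<rho>"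
    have mz: "m z = g z + t *\<^sub>R \<nu> z" by (simp add: m_def t_def)
    \<comment> \<open>Completing the square: 2 * t * wn + t^2 = (t + wn)^2 - wn^2, where t + wn =
      (\<kappa> / \<rho>) * w.\<close>
    have "f z = e z + 2 * t * (A0 (g z) \<bullet> \<nu> z) + t\<^sup>2 * (A0 (\<nu> z) \<bullet> \<nu> z)"
      using sym_A0[of "\<nu> z" "g z"]
      by (simp add: f_def mz e_def linear_add[OF lin_A0] linear_scale[OF lin_A0]
          inner_add power2_eq_square inner_commute algebra_simps)
    also have "\<dots> = e z + 2 * t * wn z + t\<^sup>2"
      unfolding A0_nu_nu[OF nz(1)] unfolding A0_inner_nu wn_def by simp
    also have "t = \<kappa> / \<rho> * w z - wn z" by (simp add: t_def wn_def nz diff_divide_distrib)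
    also have "e z + 2 * (\<kappa> / \<rho> * w z - wn z) * wn z + (\<kappa> / \<rho> * w z - wn z)\<^sup>2 = 
        e z + ((\<kappa> / \<rho>)\<^sup>2 * (w z)\<^sup>2 + (- 1) * (wn z)\<^sup>2)"
      by (simp add: power2_eq_square algebra_simps)
    finally show "f z = e z + ((\<kappa> / \<rho>)\<^sup>2 * (w z)\<^sup>2 + (- 1) * (wn z)\<^sup>2)" .
  qed
  also have "\<dots> = \<sigma> e \<rho> + ((\<kappa> / \<rho>)\<^sup>2 * height \<rho> + (- 1) * \<sigma> (\<lambda>y. (wn y)\<^sup>2) \<rho>)"
    unfolding height_def
    by (subst sigma_add, (auto intro!: continuous_intros continuous_on_S \<rho>)[3],
        subst sigma_add, (auto intro!: continuous_intros continuous_on_S \<rho>)[3],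
        simp only: sigma_cmult)
  finally have "\<sigma> f \<rho> = \<sigma> e \<rho> + (\<kappa> / \<rho>)\<^sup>2 * height \<rho> - \<sigma> (\<lambda>y. (wn y)\<^sup>2) \<rho>" by simp
  with main show ?thesis unfolding IG \<delta>_def by simp
qed

text \<open>The exponent \<open>\<kappa>0 - bb * s powr \<gamma>\<close> decreases in \<open>s\<close>, which absorbs the error that the
  oscillation of the coefficients leaves in \<open>competitor_energy\<close>.\<close>

lemma almost_monotone:
  assumes \<kappa>0': "1 < \<kappa>0" and \<kappa>0: "1 < \<kappa>0 - bb * R powr \<gamma>" and R: "0 < R" "R < R0"
    and bb: "bb = 2 * C0 * (2 * \<kappa>0 + d) * \<kappa>0 / \<gamma>"
    and neg: "energy R - (\<kappa>0 - bb * R powr \<gamma>) * height R / R = - c" "0 < c"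
    and s: "0 < s" "s \<le> R"
  shows "c * (s / R) powr (2 * \<kappa>0 - 2 + d) \<le> \<kappa>0 * height s / s"
proof -
  have d1: "1 \<le> real d" using DIM_positive[where 'a='a] d_eq by linarith
  have bb0: "0 \<le> bb" unfolding bb using C0 \<kappa>0' \<gamma> d1 by (intro divide_nonneg_pos mult_nonneg_nonneg) auto
  define k where "k s = \<kappa>0 - bb * s powr \<gamma>" for s
  have k: "1 < k t" "k t \<le> \<kappa>0" if "0 < t" "t \<le> R" for t
  proof -
    have "bb * t powr \<gamma> \<le> bb * R powr \<gamma>" using that \<gamma> bb0 by (intro mult_left_mono powr_mono2) auto
    then show "1 < k t" using \<kappa>0 by (simp add: k_def)
    show "k t \<le> \<kappa>0" using bb0 by (simp add: k_def)
  qed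
  define W where "W s = \<sigma> (\<lambda>y. w y * wn y) s" for s
  define N2 where "N2 s = \<sigma> (\<lambda>y. (wn y)\<^sup>2) s" for s
  define Q where "Q s = energy s - k s * height s / s" for s
  define Q' where "Q' s = \<sigma> e s - ((- (bb * \<gamma> * s powr (\<gamma> - 1)) * height s + k s * ((real d - 1) / s * height s + 2 * W s)) / s
       - k s * height s / s\<^sup>2)" for s
  \<comment> \<open>The natural rate m = 2 * k(t) - 2 + d varies with t, while
    \<open>ode_stays_negative\<close> wants a constant one. Since m is at most \<open>M\<close>,
    passing to \<open>M\<close> is harmless where \<open>Q\<close> is nonpositive.\<close>
  define M where "M = 2 * \<kappa>0 - 2 + d"
  have dQ: "(Q has_real_derivative Q' t) (at t)" if t: "0 < t" "t \<le> R" for t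
  proof -
    have t': "t < R0" using t R by simp
    have dk: "(k has_real_derivative - (bb * \<gamma> * t powr (\<gamma> - 1))) (at t)"
      unfolding k_def[abs_def] using t by (auto intro!: derivative_eq_intros)
    have dh: "(height has_real_derivative (real d - 1) / t * height t + 2 * W t) (at t)"
      unfolding W_def by (rule height_has_derivative[OF t(1) t'])
    have "(Q has_real_derivative \<sigma> e t - ((- (bb * \<gamma> * t powr (\<gamma> - 1)) * height t + 
        ((real d - 1) / t * height t + 2 * W t) * k t) * t - k t * height t * 1) / (t * t)) (at t)"
      unfolding Q_def[abs_def]
      by (intro DERIV_diff energy_has_derivative DERIV_divide DERIV_mult dk dh DERIV_ident t t') (use t in auto)
    then show ?thesis
      by (rule DERIV_cong) (use t in \<open>simp add: Q'_def power2_eq_square diff_divide_distrib add_divide_distrib mult_ac\<close>)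
  qed
  have ineq: "M / t * Q t \<le> Q' t" if t: "0 < t" "t \<le> R" and Qt: "Q t \<le> 0" for t
  proof -
    have t': "t < R0" using t R by simp
    define \<delta> where "\<delta> = C0 * t powr \<gamma>"
    define m where "m = 2 * k t - 2 + d"
    have \<delta>: "0 \<le> \<delta>" using C0 by (simp add: \<delta>_def)
    have m: "0 < m" "m \<le> M" "m \<le> 2 * \<kappa>0 + d" using k[OF t] d1 by (auto simp: m_def M_def)
    have H: "0 \<le> height t" by (rule height_nonneg[OF t(1) t'])
    define D where "D = energy t"
    have D: "0 \<le> D" unfolding D_def by (rule energy_nonneg)
    define X where "X = \<sigma> e t + (k t / t)\<^sup>2 * height t - N2 t"
    have "(1 - \<delta>) * D \<le> (1 + \<delta>) * (t / m * X)"
      using competitor_energy[OF k(1)[OF t] t(1) t'] by (simp add: \<delta>_def D_def X_def m_def N2_def)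
    \<comment> \<open>Allows division by 1 + \<delta>, leaving an error linear in \<delta> with no
      smallness condition on \<delta>.\<close>
    moreover have "(1 - 2 * \<delta>) * (1 + \<delta>) * D \<le> (1 - \<delta>) * D"
      using D \<delta> by (intro mult_right_mono) (auto simp: algebra_simps)
    ultimately have "(1 + \<delta>) * ((1 - 2 * \<delta>) * D) \<le> (1 + \<delta>) * (t / m * X)" by (simp add: mult_ac)
    then have "(1 - 2 * \<delta>) * D \<le> t / m * X" using \<delta> by (subst (asm) mult_le_cancel_left_pos) auto
    then have "m / t * ((1 - 2 * \<delta>) * D) \<le> m / t * (t / m * X)" using m t by (intro mult_left_mono) auto
    then have i1: "m / t * D - 2 * \<delta> * m / t * D \<le> X" using m t by (simp add: algebra_simps)
    \<comment> \<open>The integral of the square of wn - (k / t) * w, which vanishes exactly when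
      \<open>w\<close> behaves on the sphere like a function of degree k.\<close>
    have i2: "0 \<le> N2 t - 2 * (k t / t) * W t + (k t / t)\<^sup>2 * height t"
    proof -
      note cS = continuous_on_S[OF t(1) t']
      have "0 \<le> \<sigma> (\<lambda>y. (wn y - k t / t * w y)\<^sup>2) t"
        by (intro sigma_nonneg t(1) continuous_intros cS) auto
      also have "\<sigma> (\<lambda>y. (wn y - k t / t * w y)\<^sup>2) t =
          \<sigma> (\<lambda>y. (wn y)\<^sup>2 + ((- (2 * (k t / t))) * (w y * wn y) + (k t / t)\<^sup>2 * (w y)\<^sup>2)) t"
        by (intro sigma_cong t(1)) (simp add: power2_eq_square algebra_simps)
      also have "\<dots> = N2 t + (- (2 * (k t / t)) * W t + (k t / t)\<^sup>2 * height t)"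
      proof -
        define c where "c = k t / t"
        show ?thesis
          unfolding N2_def W_def height_def c_def[symmetric]
          by (subst sigma_add, (auto intro!: continuous_intros cS t)[3],
              subst sigma_add, (auto intro!: continuous_intros cS t)[3], simp only: sigma_cmult)
      qed
      finally show ?thesis by simp
    qed
    \<comment> \<open>Nonpositivity of \<open>Q\<close> bounds the energy by \<kappa>0 * H / t. The
      constant \<open>bb\<close> is chosen so that the term from the derivative of k equals the
      resulting bound for the coefficient error.\<close>
    have i3: "2 * \<delta> * m / t * D \<le> bb * \<gamma> * t powr (\<gamma> - 1) * height t / t"
    proof -
      have "D \<le> k t * height t / t" using Qt by (simp add: Q_def D_def)
      also have "\<dots> \<le> \<kappa>0 * height t / t" using k[OF t] H t by (intro divide_right_mono mult_right_mono) auto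
      finally have "2 * \<delta> * m / t * D \<le> 2 * \<delta> * m / t * (\<kappa>0 * height t / t)"
        using \<delta> m t by (intro mult_left_mono) auto
      also have "\<dots> \<le> 2 * \<delta> * (2 * \<kappa>0 + d) / t * (\<kappa>0 * height t / t)"
        using \<delta> m t H \<kappa>0' by (intro mult_right_mono divide_right_mono mult_left_mono) auto
      also have "\<dots> = bb * \<gamma> * t powr (\<gamma> - 1) * height t / t"
        using \<gamma> t by (simp add: bb \<delta>_def powr_diff)
      finally show ?thesis .
    qed
    have "M / t * Q t \<le> m / t * Q t"
      using m t Qt by (intro mult_right_mono_neg divide_right_mono) auto
    also have "m / t * Q t = m / t * D - m * k t * height t / t\<^sup>2"
      by (simp add: Q_def D_def algebra_simps power2_eq_square)
    also have "\<dots> \<le> Q' t"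
    proof -
      have "Q' t = \<sigma> e t + bb * \<gamma> * t powr (\<gamma> - 1) * height t / t - k t * (real d - 2) * height t / t\<^sup>2 - 2 * (k t / t) * W t"
        using t by (simp add: Q'_def power2_eq_square divide_simps) (simp add: algebra_simps)
      moreover have "m * k t * height t / t\<^sup>2 = 2 * ((k t / t)\<^sup>2 * height t) + k t * (real d - 2) * height t / t\<^sup>2"
        using t by (simp add: m_def power2_eq_square divide_simps) (simp add: algebra_simps)
      ultimately show ?thesis using i1 i2 i3 unfolding X_def by linarith
    qed
    finally show ?thesis .
  qed
  have QR: "Q R = - c" using neg by (simp add: Q_def k_def)
  have "Q s \<le> Q R * (s / R) powr M"
    by (rule ode_stays_negative[OF dQ ineq R(1) _ s]) (use QR neg in auto)
  then have "c * (s / R) powr M \<le> k s * height s / s"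
    using energy_nonneg[of s] QR by (simp add: Q_def)
  also have "\<dots> \<le> \<kappa>0 * height s / s"
    using k[OF s] height_nonneg[of s] s R by (intro divide_right_mono mult_right_mono) auto
  finally show ?thesis by (simp add: M_def)
qed

text \<open>If the bound failed on the whole sphere, \<open>height s\<close> would be at most half
  of what \<open>almost_monotone\<close> forces; the 2 in the denominator produces that half. \<mu>
  stands in for \<open>m1\<close>, the volume of the unit gauge ball, which changes with the center,
  so that the constant can be made uniform.\<close>

lemma growth_below:
  assumes \<kappa>0': "1 < \<kappa>0" and \<kappa>0: "1 < \<kappa>0 - bb * R powr \<gamma>" and R: "0 < R" "R < R0"
    and bb: "bb = 2 * C0 * (2 * \<kappa>0 + d) * \<kappa>0 / \<gamma>"
    and neg: "energy R - (\<kappa>0 - bb * R powr \<gamma>) * height R / R = - c" "0 < c"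
    and \<mu>: "m1 \<le> \<mu>" "0 < \<mu>"
    and s: "0 < s" "s \<le> R"
  shows "\<exists>y\<in>S s. c / (2 * \<kappa>0 * d * \<mu> * R powr (2 * \<kappa>0 - 2 + d)) * s powr (2 * \<kappa>0) \<le> (w y)\<^sup>2"
proof (rule ccontr)
  define M where "M = 2 * \<kappa>0 - 2 + d"
  define q where "q = c / (2 * \<kappa>0 * d * \<mu> * R powr M) * s powr (2 * \<kappa>0)"
  assume "\<not> ?thesis"
  then have le: "(w y)\<^sup>2 \<le> q" if "y \<in> S s" for y using that unfolding q_def M_def by (meson less_imp_le not_le)
  have s': "s < R0" using s R by simp
  have low: "c * (s / R) powr M \<le> \<kappa>0 * height s / s"
    unfolding M_def by (rule almost_monotone[OF \<kappa>0' \<kappa>0 R bb neg s])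
  have d1: "1 \<le> real d" using DIM_positive[where 'a='a] d_eq by linarith
  have \<kappa>p: "0 < \<kappa>0"
  proof (rule ccontr)
    assume "\<not> 0 < \<kappa>0"
    then have "\<kappa>0 * height s / s \<le> 0"
      using height_nonneg[OF s(1) s'] s by (intro divide_nonpos_pos mult_nonpos_nonneg) auto
    moreover have "0 < c * (s / R) powr M" using neg s R by simp
    ultimately show False using low by linarith
  qed
  have q0: "0 \<le> q" unfolding q_def using neg \<kappa>p \<mu> by (intro mult_nonneg_nonneg divide_nonneg_nonneg) auto
  have "height s \<le> \<sigma> (\<lambda>_. q) s"
    unfolding height_def using le by (intro sigma_mono s(1) continuous_intros continuous_on_S s') auto
  also have "\<dots> = q * d * m1 * s ^ (d - 1)" by (rule sigma_const[OF s(1)])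
  also have "\<dots> \<le> q * d * \<mu> * s ^ (d - 1)" using q0 \<mu> s by (intro mult_right_mono mult_left_mono) auto
  finally have "\<kappa>0 * height s / s \<le> \<kappa>0 * (q * d * \<mu> * s ^ (d - 1)) / s"
    using \<kappa>p s by (intro divide_right_mono mult_left_mono) auto
  also have "\<dots> = c / 2 * (s powr (2 * \<kappa>0) * s ^ (d - 1) / s) / R powr M"
    using \<kappa>p \<mu> d1 by (simp add: q_def)
  also have "s powr (2 * \<kappa>0) * s ^ (d - 1) / s = s powr M"
  proof -
    have "s ^ (d - 1) = s powr (real d - 1)" using s d1 by (simp add: powr_realpow[symmetric] of_nat_diff)
    then have "s powr (2 * \<kappa>0) * s ^ (d - 1) / s = s powr (2 * \<kappa>0 + (real d - 1)) / s powr 1"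
      using s by (simp add: powr_add)
    also have "\<dots> = s powr (2 * \<kappa>0 + (real d - 1) - 1)" by (rule powr_diff[symmetric])
    finally show ?thesis by (simp add: M_def algebra_simps)
  qed
  also have "c / 2 * s powr M / R powr M = c * (s / R) powr M / 2" using s R by (simp add: powr_divide)
  finally have "c * (s / R) powr M \<le> c * (s / R) powr M / 2" using low by linarith
  moreover have "0 < c * (s / R) powr M" using neg s R by simp
  ultimately show False by linarith
qed

text \<open>The derivative of the height contains the integral of w * wn, which equals the energy up
  to an error of order \<delta> * |w| * sqrt e on the sphere. Its part \<delta> * t * e is absorbed
  by adding \<delta> * s * energy to the height, whose derivative contains \<delta> * s * \<sigma>
  e. The sum then grows at least like s^a, so towards 0 it decays at least that fast. The ratio 8 is
  the one needed to cover a Euclidean dyadic annulus.\<close>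

lemma growth_above:
  assumes R: "0 < R" "R < R0" and \<kappa>: "0 \<le> \<kappa>1" "\<kappa>1 < \<kappa>2"
    and N: "\<And>s. 0 < s \<Longrightarrow> s \<le> R \<Longrightarrow> \<kappa>2 * height s / s \<le> energy s"
  shows "\<exists>R1 C. 0 < R1 \<and> R1 \<le> R \<and> 0 \<le> C \<and> (\<forall>s. 0 < s \<and> s \<le> R1 \<longrightarrow>
     I (\<lambda>y. (w y)\<^sup>2) s - I (\<lambda>y. (w y)\<^sup>2) (s / 8) \<le> C * s powr (2 * \<kappa>1 + d))"
proof -
  have d1: "1 \<le> real d" using DIM_positive[where 'a='a] d_eq by linarith
  define a where "a = real d - 1 + 2 * \<kappa>1"
  have a: "0 \<le> a" using d1 \<kappa> by (simp add: a_def)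
  \<comment> \<open>The first bound keeps 2 - \<delta> - a * \<delta> positive; the second makes the
    loss from the error terms at most the gap between \<kappa>2 and \<kappa>1.\<close>
  define \<delta> where "\<delta> = min (1 / (2 + a)) (2 * (\<kappa>2 - \<kappa>1) / (\<kappa>2 * (1 + a) + 1))"
  have \<kappa>2: "0 < \<kappa>2" using \<kappa> by simp
  have pos: "0 < \<kappa>2 * (1 + a) + 1" using \<kappa>2 a by (intro add_nonneg_pos mult_nonneg_nonneg) auto
  have \<delta>: "0 < \<delta>" "\<delta> * (2 + a) \<le> 1" "\<delta> * (\<kappa>2 * (1 + a) + 1) \<le> 2 * (\<kappa>2 - \<kappa>1)"
  proof -
    show "0 < \<delta>" using a \<kappa> pos by (simp add: \<delta>_def)
    have "\<delta> \<le> 1 / (2 + a)" unfolding \<delta>_def by (rule min.cobounded1)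
    then show "\<delta> * (2 + a) \<le> 1" using a by (simp add: field_simps)
    have "\<delta> \<le> 2 * (\<kappa>2 - \<kappa>1) / (\<kappa>2 * (1 + a) + 1)" unfolding \<delta>_def by (rule min.cobounded2)
    then show "\<delta> * (\<kappa>2 * (1 + a) + 1) \<le> 2 * (\<kappa>2 - \<kappa>1)" using pos by (subst (asm) pos_le_divide_eq) auto
  qed
  have "\<delta> * 1 \<le> \<delta> * (2 + a)" using \<delta>(1) a by (intro mult_left_mono) auto
  then have \<delta>1: "\<delta> \<le> 1" using \<delta>(2) by linarith
  \<comment> \<open>Below this radius the relative oscillation C0 * t^\<gamma> of the coefficients
    is at most \<delta>.\<close>
  define R1 where "R1 = min R ((\<delta> / (C0 + 1)) powr (1 / \<gamma>))"
  have R1: "0 < R1" "R1 \<le> R" using R \<delta> C0 by (auto simp: R1_def)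
  have C0R: "C0 * t powr \<gamma> \<le> \<delta>" if "0 < t" "t \<le> R1" for t
  proof -
    have "t powr \<gamma> \<le> ((\<delta> / (C0 + 1)) powr (1 / \<gamma>)) powr \<gamma>"
      using that \<gamma> by (intro powr_mono2) (auto simp: R1_def)
    also have "\<dots> = \<delta> / (C0 + 1)" using \<gamma> \<delta> C0 by (simp add: powr_powr)
    finally have "C0 * t powr \<gamma> \<le> C0 * (\<delta> / (C0 + 1))" using C0 by (intro mult_left_mono)
    also have "\<dots> \<le> \<delta>" using C0 \<delta> by (simp add: field_simps)
    finally show ?thesis .
  qed
  define W where "W s = \<sigma> (\<lambda>y. w y * wn y) s" for s
  define Z where "Z s = height s + \<delta> * (s * energy s)" for s
  define Z' where "Z' s = ((real d - 1) / s * height s + 2 * W s) + \<delta> * (energy s + s * \<sigma> e s)" for s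
  have dZ: "(Z has_real_derivative Z' t) (at t)" if t: "0 < t" "t \<le> R1" for t
  proof -
    have t': "t < R0" using t R R1 by simp
    have "(Z has_real_derivative ((real d - 1) / t * height t + 2 * W t) + \<delta> * (1 * energy t + \<sigma> e t * t)) (at t)"
      unfolding Z_def[abs_def] W_def
      by (intro DERIV_add DERIV_cmult DERIV_mult DERIV_ident height_has_derivative energy_has_derivative t t')
    then show ?thesis by (simp add: Z'_def mult.commute)
  qed
  have ineq: "a / t * Z t \<le> Z' t" if t: "0 < t" "t \<le> R1" for t
  proof -
    have t': "t < R0" "t \<le> R" using t R R1 by auto
    note cS = continuous_on_S[OF t(1) t'(1)]
    define H where "H = height t / t"
    define D where "D = energy t"
    have H: "0 \<le> H" using height_nonneg[OF t(1) t'(1)] t by (simp add: H_def)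
    have DH: "\<kappa>2 * H \<le> D" using N[OF t(1) t'(2)] by (simp add: H_def D_def)
    have D: "0 \<le> D" using energy_nonneg by (simp add: D_def)
    define Y where "Y = \<sigma> (\<lambda>y. w y * (A y (g y) \<bullet> \<nu> y)) t"
    have close: "\<bar>A y p \<bullet> q - A0 p \<bullet> q\<bar> \<le> \<delta> * (sqrt (A0 p \<bullet> p) * sqrt (A0 q \<bullet> q))" 
      if "y \<in> D_ball R0" "0 < r y" "r y \<le> t" for y p q
    proof -
      have "C0 * r y powr \<gamma> * (sqrt (A0 p \<bullet> p) * sqrt (A0 q \<bullet> q)) \<le> \<delta> * (sqrt (A0 p \<bullet> p) * sqrt (A0 q \<bullet> q))"
        using C0R[of "r y"] that t A0_nonneg by (intro mult_right_mono mult_nonneg_nonneg) auto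
      then show ?thesis using A_close[OF that(1), of p q] by linarith
    qed
    have "(1 - \<delta>) * D \<le> I (\<lambda>y. A y (g y) \<bullet> g y) t"
    proof -
      have "(1 - \<delta>) * D = I (\<lambda>y. (1 - \<delta>) * e y) t" by (simp add: D_def energy_def I_cmult)
      also have "\<dots> \<le> I (\<lambda>y. A y (g y) \<bullet> g y) t"
      proof (rule I_mono[OF _ _ t'(1)])
        show "adm R0 (\<lambda>y. (1 - \<delta>) * e y)" by (intro adm_mult[OF _ adm_e] adm_continuous continuous_intros)
        show "adm R0 (\<lambda>y. A y (g y) \<bullet> g y)" by (intro adm_continuous continuous_intros flux_cont g_cont)
        fix y assume "y \<in> E t"
        then have "y \<in> D_ball R0" "0 < r y" "r y \<le> t" using t' by (auto simp: E_def D_ball_def)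
        from close[OF this, of "g y" "g y"] show "(1 - \<delta>) * e y \<le> A y (g y) \<bullet> g y"
          using A0_nonneg[of "g y"] unfolding e_def left_diff_distrib by simp
      qed
      finally show ?thesis .
    qed
    also have "\<dots> = Y" unfolding Y_def by (rule energy_identity[OF t(1) t'(1)])
    also have "Y \<le> \<sigma> (\<lambda>y. w y * wn y + (\<delta> / 2 / t * (w y)\<^sup>2 + \<delta> / 2 * t * e y)) t"
      unfolding Y_def
    proof (rule sigma_mono[OF t(1)])
      show "continuous_on (S t) (\<lambda>y. w y * (A y (g y) \<bullet> \<nu> y))" by (intro continuous_intros cS)
      show "continuous_on (S t) (\<lambda>y. w y * wn y + (\<delta> / 2 / t * (w y)\<^sup>2 + \<delta> / 2 * t * e y))"
        by (intro continuous_intros cS)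
      fix y assume y: "y \<in> S t"
      then have yD: "y \<in> D_ball R0" "0 < r y" "r y \<le> t" "y \<noteq> 0" using t t' by (auto simp: S_def D_ball_def)
      have "\<bar>A y (g y) \<bullet> \<nu> y - wn y\<bar> \<le> \<delta> * sqrt (e y)"
        using close[OF yD(1-3), of "g y" "\<nu> y"] unfolding A0_nu_nu[OF yD(4)]
        by (simp add: e_def wn_def A0_inner_nu)
      then have "\<bar>w y\<bar> * \<bar>A y (g y) \<bullet> \<nu> y - wn y\<bar> \<le> \<bar>w y\<bar> * (\<delta> * sqrt (e y))" by (rule mult_left_mono) simp
      then have "w y * (A y (g y) \<bullet> \<nu> y) - w y * wn y \<le> \<delta> * (\<bar>w y\<bar> * sqrt (e y))"
        unfolding abs_mult[symmetric] right_diff_distrib by (simp add: abs_le_iff mult_ac)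
      \<comment> \<open>The weights 1 / t and t give both terms the scaling of the derivative of the
        height.\<close>
      also have "\<bar>w y\<bar> * sqrt (e y) \<le> 1 / 2 / t * (w y)\<^sup>2 + 1 / 2 * t * e y"
      proof -
        have e0: "0 \<le> e y" by (simp add: e_def A0_nonneg)
        have "0 \<le> (\<bar>w y\<bar> - t * sqrt (e y))\<^sup>2" by simp
        also have "\<dots> = (w y)\<^sup>2 - 2 * t * (\<bar>w y\<bar> * sqrt (e y)) + t\<^sup>2 * e y"
          using e0 by (simp add: power2_diff power_mult_distrib)
        finally show ?thesis using t by (simp add: field_simps power2_eq_square)
      qed
      finally show "w y * (A y (g y) \<bullet> \<nu> y) \<le> w y * wn y + (\<delta> / 2 / t * (w y)\<^sup>2 + \<delta> / 2 * t * e y)"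
        using \<delta>(1) by (simp add: algebra_simps)
    qed
    also have "\<dots> = W t + (\<delta> / 2 / t * height t + \<delta> / 2 * t * \<sigma> e t)"
    proof -
      define c1 where "c1 = \<delta> / 2 / t"
      define c2 where "c2 = \<delta> / 2 * t"
      show ?thesis
        unfolding W_def height_def c1_def[symmetric] c2_def[symmetric]
        by (subst sigma_add, (auto intro!: continuous_intros cS t)[3],
            subst sigma_add, (auto intro!: continuous_intros cS t)[3], simp only: sigma_cmult)
    qed
    finally have i1: "(1 - \<delta>) * D \<le> W t + (\<delta> / 2 * H + \<delta> / 2 * t * \<sigma> e t)" by (simp add: H_def)
    have zt: "a / t * Z t = a * H + a * \<delta> * D" using t by (simp add: Z_def H_def D_def field_simps)
    have zt': "Z' t = (real d - 1) * H + 2 * W t + \<delta> * D + \<delta> * t * \<sigma> e t"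
      by (simp add: Z'_def H_def D_def algebra_simps)
    have "(2 - \<delta> - a * \<delta>) * (\<kappa>2 * H) \<le> (2 - \<delta> - a * \<delta>) * D"
      using DH \<delta> by (intro mult_left_mono) (auto simp: algebra_simps)
    moreover have "0 \<le> (2 * (\<kappa>2 - \<kappa>1) - \<delta> * (\<kappa>2 * (1 + a) + 1)) * H" using \<delta> H by (intro mult_nonneg_nonneg) auto
    then have "(2 * \<kappa>1 + \<delta>) * H \<le> (2 - \<delta> - a * \<delta>) * (\<kappa>2 * H)" by (simp add: algebra_simps)
    ultimately have "(2 * \<kappa>1 + \<delta>) * H \<le> (2 - \<delta> - a * \<delta>) * D" by linarith
    moreover have "a * H = (real d - 1) * H + 2 * \<kappa>1 * H" by (simp add: a_def algebra_simps)
    ultimately have "a * H + a * \<delta> * D \<le> (real d - 1) * H + 2 * W t + \<delta> * D + \<delta> * t * \<sigma> e t"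
      using i1 by (simp add: algebra_simps)
    then show ?thesis unfolding zt zt' .
  qed
  define C where "C = Z R1 * R1 powr (- a)"
  have Zb: "height t \<le> C * t powr a" if t: "0 < t" "t \<le> R1" for t
  proof -
    have dY: "((\<lambda>t. Z t * t powr (- a)) has_real_derivative (Z' t - a / t * Z t) * t powr (- a)) (at t)"
      if "0 < t" "t \<le> R1" for t
    proof -
      have "((\<lambda>t. t powr (- a)) has_real_derivative (- a) * t powr (- a - 1)) (at t)"
        using that by (auto intro!: derivative_eq_intros)
      from DERIV_mult[OF dZ[OF that] this]
      have "((\<lambda>t. Z t * t powr (- a)) has_real_derivative Z' t * t powr (- a) + (- a) * t powr (- a - 1) * Z t) (at t)" .
      moreover have "t powr (- a - 1) = t powr (- a) / t" using that by (simp add: powr_diff)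
      ultimately show ?thesis by (simp add: algebra_simps)
    qed
    have "Z t * t powr (- a) \<le> Z R1 * R1 powr (- a)"
    proof (rule DERIV_nonneg_imp_nondecreasing[OF t(2)])
      fix x assume "t \<le> x" "x \<le> R1"
      then have x: "0 < x" "x \<le> R1" using t by auto
      show "\<exists>y. ((\<lambda>t. Z t * t powr - a) has_real_derivative y) (at x) \<and> 0 \<le> y"
        using dY[OF x] ineq[OF x] by (intro exI conjI) (auto intro!: mult_nonneg_nonneg)
    qed
    then have "Z t \<le> C * t powr a" using t by (simp add: C_def powr_minus field_simps)
    moreover have "height t \<le> Z t" using energy_nonneg[of t] \<delta> t by (simp add: Z_def)
    ultimately show ?thesis by linarith
  qed
  have C: "0 \<le> C" unfolding C_def Z_def
    using energy_nonneg[of R1] height_nonneg[of R1] \<delta> R1 R by (intro mult_nonneg_nonneg add_nonneg_nonneg) auto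
  show ?thesis
  proof (rule exI[where x=R1], rule exI[where x=C], intro conjI allI impI R1 C)
    fix s assume s: "0 < s \<and> s \<le> R1"
    have "adm R0 (\<lambda>y. (w y)\<^sup>2)" by (intro adm_continuous continuous_intros w_cont)
    then have "(I (\<lambda>y. (w y)\<^sup>2) has_real_derivative height t) (at t)" if "0 < t" "t \<le> R1" for t
      unfolding height_def using that R R1 by (intro I_has_derivative) auto
    then obtain z where z: "s / 8 < z" "z < s" 
      "I (\<lambda>y. (w y)\<^sup>2) s - I (\<lambda>y. (w y)\<^sup>2) (s / 8) = (s - s / 8) * height z"
      using MVT2[of "s / 8" s "I (\<lambda>y. (w y)\<^sup>2)" height] s by force
    have "height z \<le> C * z powr a" using z s by (intro Zb) auto
    also have "\<dots> \<le> C * s powr a" using C z s a by (intro mult_left_mono powr_mono2) auto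
    finally have "(s - s / 8) * height z \<le> (s - s / 8) * (C * s powr a)" using s by (intro mult_left_mono) auto
    also have "\<dots> \<le> s * (C * s powr a)" using s C by (intro mult_right_mono) auto
    also have "\<dots> = C * s powr (2 * \<kappa>1 + d)"
    proof -
      have "s powr (2 * \<kappa>1 + d) = s powr (a + 1)" by (simp add: a_def add_ac)
      then show ?thesis using s by (simp add: powr_add)
    qed
    finally show "I (\<lambda>y. (w y)\<^sup>2) s - I (\<lambda>y. (w y)\<^sup>2) (s / 8) \<le> C * s powr (2 * \<kappa>1 + d)"
      using z by simp
  qed
qed

end

section \<open>Morrey's estimate, proved by contracting a bump towards a point\<close>

subsection \<open>Hoelder continuity of the coefficients\<close>

lemma exp_flat_continuous: "continuous_on S (exp_flat m)"
  by (intro continuous_at_imp_continuous_on ballI DERIV_isCont[OF exp_flat_has_derivative])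

text \<open>Integrated over a set of finite measure this does the work of Hoelder's inequality, with
  lam left to be balanced. Either |t| is at most lam, or the negative power 1 - q of |t| is at most
  that of lam.\<close>

lemma le_young:
  fixes t q lam :: real
  assumes "0 < lam" "1 \<le> q"
  shows "\<bar>t\<bar> \<le> lam + lam powr (1 - q) * \<bar>t\<bar> powr q"
proof (cases "\<bar>t\<bar> \<le> lam")
  case True
  then show ?thesis by (intro order_trans[OF True]) simp
next
  case False
  then have t: "0 < \<bar>t\<bar>" "lam \<le> \<bar>t\<bar>" using assms by linarith+
  have "\<bar>t\<bar> = \<bar>t\<bar> powr (1 - q) * \<bar>t\<bar> powr q" using t by (simp flip: powr_add)
  also have "\<dots> \<le> lam powr (1 - q) * \<bar>t\<bar> powr q"
    using assms t by (intro mult_right_mono powr_mono2') auto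
  finally show ?thesis using assms by linarith
qed

definition unit_bump_grad :: "'a::euclidean_space \<Rightarrow> 'a" where
  "unit_bump_grad u = (- 2 * exp_flat 2 (1 - u \<bullet> u)) *\<^sub>R u"

lemma unit_bump_has_derivative: "(bump 0 1 has_derivative (\<lambda>h. h \<bullet> unit_bump_grad u)) (at u)"
proof -
  have "((\<lambda>x. 1 - x \<bullet> x) has_derivative (\<lambda>h. - 2 * (h \<bullet> u))) (at u)"
    by (auto intro!: derivative_eq_intros simp: inner_commute)
  from has_derivative_compose[OF this exp_flat_has_derivative[of 0, unfolded has_field_derivative_def]]
  show ?thesis by (simp add: bump_def[abs_def] unit_bump_grad_def mult_ac numeral_2_eq_2)
qed

lemma unit_bump_grad_continuous: "continuous_on S f \<Longrightarrow> continuous_on S (\<lambda>x. unit_bump_grad (f x))"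
  unfolding unit_bump_grad_def
  by (intro continuous_intros continuous_on_compose2[OF exp_flat_continuous[of UNIV]]) auto

lemma unit_bump_grad_0: "1 \<le> norm u \<Longrightarrow> unit_bump_grad u = 0"
proof -
  assume "1 \<le> norm u"
  then have "1\<^sup>2 \<le> (norm u)\<^sup>2" by (intro power_mono) auto
  then show ?thesis by (simp add: unit_bump_grad_def exp_flat_def power2_norm_eq_inner)
qed

lemma bump_conv_unit: "t > 0 \<Longrightarrow> bump c t z = bump 0 1 ((1 / t) *\<^sub>R (z - c))"
  by (simp add: bump_def power2_eq_square)

lemma bump_continuous: "continuous_on S f \<Longrightarrow> continuous_on S (\<lambda>x. bump c t (f x))"
  by (rule continuous_on_compose2[OF smooth_fn_continuous[OF bump_smooth, of UNIV]]) auto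

lemma lebesgue_on_integrable:
  fixes f :: "'a::euclidean_space \<Rightarrow> real"
  assumes "S \<in> sets borel" "set_integrable lborel S f"
  shows "integrable (lebesgue_on S) f"
  using assms by (subst integrable_restrict_space) (auto simp: set_integrable_def integrable_completion)

text \<open>The bump on \<open>cball c \<rho>\<close> is contracted towards \<open>x\<close> by
  homotheties of ratio s, giving kernels \<open>K s\<close> of constant mass. The s-derivative of
  \<open>K s\<close> is -1/s times the divergence of (z - x) * K s, so the weak derivatives bound
  the derivative of the integral of f * K s by a multiple of s^(\<gamma> - 1), which is integrable
  at 0. As s tends to 0 the integral tends to \<open>f x\<close> times the mass of the bump. Only
  the cone between \<open>x\<close> and the ball is used, so \<open>x\<close> may lie on the flat
  boundary.\<close>

lemma morrey_bump_estimate: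
  fixes f :: "'a::euclidean_space \<Rightarrow> real" and g :: "'a \<Rightarrow> 'a \<Rightarrow> real" and x c :: 'a
  defines "d \<equiv> real DIM('a)"
  assumes \<Omega>: "open \<Omega>" "emeasure lborel \<Omega> < \<infinity>" and X: "\<Omega> \<subseteq> X" "x \<in> X" and f: "continuous_on X f"
    and star: "\<And>s y. 0 < s \<Longrightarrow> s \<le> 1 \<Longrightarrow> y \<in> cball c \<rho> \<Longrightarrow> x + s *\<^sub>R (y - x) \<in> \<Omega>"
    and far: "\<And>y. y \<in> cball c \<rho> \<Longrightarrow> norm (y - x) \<le> 4 * \<rho>"
    and \<rho>: "0 < \<rho>" and q: "d < q"
    and g: "\<And>i. i \<in> Basis \<Longrightarrow> integrable (lebesgue_on \<Omega>) (\<lambda>z. \<bar>g i z\<bar> powr q)"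
    and weak: "\<And>i. i \<in> Basis \<Longrightarrow> weak_partial \<Omega> i f (g i)"
  shows "\<bar>(LINT z|lebesgue_on \<Omega>. f z * (bump c \<rho> z / \<rho> ^ DIM('a))) - f x * (\<integral>u. bump (0::'a) 1 u \<partial>lborel)\<bar>
    \<le> 4 * (\<Sum>i\<in>Basis. measure lborel (ball (0::'a) 1) + (LINT z|lebesgue_on \<Omega>. \<bar>g i z\<bar> powr q)) / (1 - d / q) * \<rho> powr (1 - d / q)"
proof -
  define m0 where "m0 = (\<integral>u. bump (0::'a) 1 u \<partial>lborel)"
  define V where "V = measure lborel (ball (0::'a) 1)"
  define G where "G i = (LINT z|lebesgue_on \<Omega>. \<bar>g i z\<bar> powr q)" for i
  define Ctot where "Ctot = 4 * (\<Sum>i\<in>Basis. V + G i)"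
  define \<gamma> where "\<gamma> = 1 - d / q"
  have d1: "1 \<le> d" using DIM_positive[where 'a='a] unfolding d_def by linarith
  have q1: "1 \<le> q" using d1 q by linarith
  have \<gamma>: "0 < \<gamma>" "\<gamma> \<le> 1" using q d1 by (auto simp: \<gamma>_def)
  define N where "N s = (s * \<rho>) ^ DIM('a)" for s
  \<comment> \<open>The coordinate in which the contracted ball, with center x + s (c - x) and
    radius s * \<rho>, becomes the unit ball.\<close>
  define u where "u s z = (1 / (s * \<rho>)) *\<^sub>R (z - x) - (1 / \<rho>) *\<^sub>R (c - x)" for s z
  define K where "K s z = bump 0 1 (u s z) / N s" for s z
  define K' where "K' s z = - (d / s) * K s z - (unit_bump_grad (u s z) \<bullet> (z - x)) / (s\<^sup>2 * \<rho>) / N s" for s z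
  have Npos: "0 < N s" if "0 < s" for s using that \<rho> by (simp add: N_def)
  have N_powr: "N s = (s * \<rho>) powr d" if "0 < s" for s
    using that \<rho> by (simp add: N_def d_def powr_realpow)
  have u_eq: "u s z = (1 / (s * \<rho>)) *\<^sub>R (z - (x + s *\<^sub>R (c - x)))" if "0 < s" for s z
  proof -
    have "(1 / (s * \<rho>)) *\<^sub>R (z - (x + s *\<^sub>R (c - x))) = (1 / (s * \<rho>)) *\<^sub>R ((z - x) - s *\<^sub>R (c - x))"
      by (simp add: diff_diff_add)
    also have "\<dots> = u s z" unfolding u_def scaleR_diff_right[of "1 / (s * \<rho>)" "z - x"] using that by simp
    finally show ?thesis by simp
  qed
  have K_bump: "K s z = bump (x + s *\<^sub>R (c - x)) (s * \<rho>) z / N s" if "0 < s" for s z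
  proof -
    have "bump (x + s *\<^sub>R (c - x)) (s * \<rho>) z = bump 0 1 ((1 / (s * \<rho>)) *\<^sub>R (z - (x + s *\<^sub>R (c - x))))"
      using that \<rho> by (intro bump_conv_unit) simp
    then show ?thesis using u_eq[OF that, of z] by (simp only: K_def)
  qed
  define Kset where "Kset s = (\<lambda>y. x + s *\<^sub>R (y - x)) ` cball c \<rho>" for s
  have Kset\<Omega>: "Kset s \<subseteq> \<Omega>" if "0 < s" "s \<le> 1" for s using star that by (auto simp: Kset_def)
  have Kset_eq: "Kset s = cball (x + s *\<^sub>R (c - x)) (s * \<rho>)" if s: "0 < s" for s
  proof (intro equalityI subsetI)
    fix z assume "z \<in> Kset s"
    then obtain y where y: "y \<in> cball c \<rho>" "z = x + s *\<^sub>R (y - x)" by (auto simp: Kset_def)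
    have "x + s *\<^sub>R (c - x) - z = s *\<^sub>R (c - y)" unfolding y(2) by (simp add: algebra_simps)
    then show "z \<in> cball (x + s *\<^sub>R (c - x)) (s * \<rho>)" using y(1) s by (simp add: dist_norm)
  next
    fix z assume z: "z \<in> cball (x + s *\<^sub>R (c - x)) (s * \<rho>)"
    define y where "y = x + (1 / s) *\<^sub>R (z - x)"
    have zy: "z = x + s *\<^sub>R (y - x)" using s by (simp add: y_def)
    then have "x + s *\<^sub>R (c - x) - z = s *\<^sub>R (c - y)" by (simp add: algebra_simps)
    then have "s * norm (c - y) \<le> s * \<rho>" using z s by (simp add: dist_norm)
    then have "y \<in> cball c \<rho>" using s by (simp add: dist_norm)
    then show "z \<in> Kset s" unfolding Kset_def using zy by blast
  qed
  have u1: "1 \<le> norm (u s z)" if "z \<notin> Kset s" "0 < s" for s z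
  proof -
    have "norm (u s z) = norm (z - (x + s *\<^sub>R (c - x))) / (s * \<rho>)" using that \<rho> by (simp add: u_eq)
    moreover have "s * \<rho> \<le> norm (z - (x + s *\<^sub>R (c - x)))"
      using that by (simp add: Kset_eq dist_norm norm_minus_commute)
    ultimately show ?thesis using that \<rho> by (simp add: le_divide_eq)
  qed
  have K0: "K s z = 0" and K'0: "K' s z = 0" and Kg0: "unit_bump_grad (u s z) = 0" if "z \<notin> Kset s" "0 < s" for s z
    using u1[OF that] by (auto simp: K_def K'_def unit_bump_grad_0 bump_eq_0_iff)
  have Kbound: "0 \<le> K s z" "K s z \<le> 1 / N s" if "0 < s" for s z
    using Npos[OF that] bump_nonneg[of 0 1 "u s z"] bump_le_1[of 0 1 "u s z"] by (auto simp: K_def intro!: divide_right_mono)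
  have uc: "continuous_on (T \<times> UNIV) (\<lambda>p. u (fst p) (snd p))" "continuous_on (T \<times> UNIV) (\<lambda>p. N (fst p))" if "T \<subseteq> {0<..}" for T
    unfolding u_def N_def using that \<rho> by (auto intro!: continuous_intros)
  have cK: "continuous_on (T \<times> UNIV) (\<lambda>p. K (fst p) (snd p))" 
    and cK': "continuous_on (T \<times> UNIV) (\<lambda>p. K' (fst p) (snd p))" if T: "T \<subseteq> {0<..}" for T
  proof -
    have nz: "\<forall>p\<in>T \<times> (UNIV :: 'a set). N (fst p) \<noteq> 0" "\<forall>p\<in>T \<times> (UNIV :: 'a set). fst p \<noteq> 0"
      "\<forall>p\<in>T \<times> (UNIV :: 'a set). (fst p)\<^sup>2 * \<rho> \<noteq> 0"
      using T Npos \<rho> by force+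
    show *: "continuous_on (T \<times> UNIV) (\<lambda>p. K (fst p) (snd p))"
      unfolding K_def by (intro continuous_on_divide bump_continuous uc T nz)
    show "continuous_on (T \<times> UNIV) (\<lambda>p. K' (fst p) (snd p))"
      unfolding K'_def
      by (intro continuous_on_diff continuous_on_mult continuous_on_minus continuous_on_divide * continuous_on_inner
          unit_bump_grad_continuous uc T nz continuous_intros)
  qed
  have slice: "continuous_on UNIV (K s)" "continuous_on UNIV (K' s)" if "0 < s" for s
  proof -
    note p = continuous_on_Pair[OF continuous_on_const[of UNIV s] continuous_on_id[of "UNIV :: 'a set"]]
    show "continuous_on UNIV (K s)" "continuous_on UNIV (K' s)"
      using continuous_on_compose2[OF cK[of "{s}"] p] continuous_on_compose2[OF cK'[of "{s}"] p] that
      by (simp_all add: image_subset_iff)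
  qed
  have dK: "((\<lambda>s. K s z) has_real_derivative K' s z) (at s)" if s: "0 < s" for s z
  proof -
    have "((\<lambda>s. u s z) has_derivative (\<lambda>h. (- h / (s\<^sup>2 * \<rho>)) *\<^sub>R (z - x))) (at s)"
      unfolding u_def using s \<rho>
      by (auto intro!: derivative_eq_intros simp: power2_eq_square)
    from has_derivative_compose[OF this unit_bump_has_derivative]
    have "((\<lambda>s. bump 0 1 (u s z)) has_real_derivative - (unit_bump_grad (u s z) \<bullet> (z - x)) / (s\<^sup>2 * \<rho>)) (at s)"
      unfolding has_field_derivative_def
      by (rule has_derivative_eq_rhs) (auto simp: inner_commute)
    moreover have "(N has_real_derivative d / s * N s) (at s)"
    proof -
      have "((\<lambda>s. (s * \<rho>) ^ DIM('a)) has_real_derivative real DIM('a) * (s * \<rho>) ^ (DIM('a) - 1) * \<rho>) (at s)"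
        by (auto intro!: derivative_eq_intros)
      moreover have "(s * \<rho>) ^ DIM('a) = (s * \<rho>) * (s * \<rho>) ^ (DIM('a) - 1)"
        using DIM_positive[where 'a='a] by (simp flip: power_Suc)
      ultimately show ?thesis using s \<rho> by (simp add: N_def[abs_def] d_def mult_ac)
    qed
    ultimately have "((\<lambda>s. bump 0 1 (u s z) / N s) has_real_derivative
       ((- (unit_bump_grad (u s z) \<bullet> (z - x)) / (s\<^sup>2 * \<rho>)) * N s - bump 0 1 (u s z) * (d / s * N s)) / (N s * N s)) (at s)"
      using Npos[OF s] by (intro DERIV_divide) auto
    then show ?thesis unfolding K_def[abs_def]
      by (rule DERIV_cong) (use Npos[OF s] in \<open>simp add: K'_def K_def diff_divide_distrib mult_ac\<close>)
  qed
  have derivative_bound: "\<bar>LINT z|lebesgue_on \<Omega>. f' z * K' s z\<bar> \<le> Ctot * \<rho> powr \<gamma> * s powr (\<gamma> - 1)"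
    if s: "0 < s" "s \<le> 1" and f': "continuous_on UNIV f'" "\<And>z. z \<in> Kset s \<Longrightarrow> f' z = f z" for s f'
  proof -
    define \<phi> where "\<phi> i z = ((z - x) \<bullet> i) * K s z" for i z
    define \<phi>' where "\<phi>' i z = K s z + ((z - x) \<bullet> i) * (unit_bump_grad (u s z) \<bullet> i) / (s * \<rho>) / N s" for i z
    have part: "partial_within UNIV i (\<phi> i) z = \<phi>' i z" if i: "i \<in> Basis" for i z
    proof -
      have "((\<lambda>z. u s z) has_derivative (\<lambda>h. (1 / (s * \<rho>)) *\<^sub>R h)) (at z)"
        unfolding u_def by (auto intro!: derivative_eq_intros)
      from has_derivative_compose[OF this unit_bump_has_derivative]
      have "((\<lambda>z. bump 0 1 (u s z)) has_derivative (\<lambda>h. ((1 / (s * \<rho>)) *\<^sub>R h) \<bullet> unit_bump_grad (u s z))) (at z)" .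
      from has_derivative_mult_right[OF this, of "1 / N s"]
      have dKz: "(K s has_derivative (\<lambda>h. 1 / N s * (((1 / (s * \<rho>)) *\<^sub>R h) \<bullet> unit_bump_grad (u s z)))) (at z)"
        by (simp add: K_def[abs_def])
      have "((\<lambda>z. (z - x) \<bullet> i) has_derivative (\<lambda>h. h \<bullet> i)) (at z)"
        by (auto intro!: derivative_eq_intros)
      from has_derivative_mult[OF this dKz]
      have "(\<phi> i has_derivative (\<lambda>h. ((z - x) \<bullet> i) * (1 / N s * (((1 / (s * \<rho>)) *\<^sub>R h) \<bullet> unit_bump_grad (u s z))) + (h \<bullet> i) * K s z)) (at z)"
        unfolding \<phi>_def[abs_def] .
      from frechet_derivative_at[OF this, symmetric]
      show ?thesis using i by (simp add: partial_within_def \<phi>'_def inner_commute)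
    qed
    have \<phi>0: "\<phi> i z = 0" "\<phi>' i z = 0" if "z \<notin> Kset s" for i z
      using K0[OF that s(1)] Kg0[OF that s(1)] by (auto simp: \<phi>_def \<phi>'_def)
    have KsC: "compact (Kset s)" by (simp add: Kset_eq[OF s(1)])
    have test: "test_fun \<Omega> (\<phi> i)" for i
      unfolding test_fun_def
    proof (intro conjI allI)
      have "smooth_fn (\<lambda>z. (z \<bullet> i + (- (x \<bullet> i))) * (bump (x + s *\<^sub>R (c - x)) (s * \<rho>) z * (1 / N s)))"
        by (intro smooth_fn.mult smooth_fn.add smooth_fn.lin smooth_fn.const bump_smooth)
      then have "smooth_fn (\<phi> i)" by (simp add: \<phi>_def[abs_def] K_bump[OF s(1)] inner_diff_left)
      then show "C_k k (\<phi> i)" for k by (rule smooth_fn_C_k)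
      have cl: "closure {z. \<phi> i z \<noteq> 0} \<subseteq> Kset s"
        using \<phi>0 KsC by (intro closure_minimal compact_imp_closed) auto
      then show "closure {z. \<phi> i z \<noteq> 0} \<subseteq> \<Omega>" using Kset\<Omega>[OF s] by blast
      show "compact (closure {z. \<phi> i z \<noteq> 0})"
        using compact_Int_closed[OF KsC closed_closure[of "{z. \<phi> i z \<noteq> 0}"]] cl by (simp add: Int_absorb1)
    qed
    have c\<phi>': "continuous_on UNIV (\<phi>' i)" for i
    proof -
      have "continuous_on UNIV (\<lambda>z. u s z)" unfolding u_def by (intro continuous_intros)
      then show ?thesis unfolding \<phi>'_def[abs_def] using s \<rho> Npos[OF s(1)]
        by (intro continuous_intros slice unit_bump_grad_continuous) auto
    qed
    have "(\<Sum>i\<in>Basis. \<phi>' i z) = - s * K' s z" for z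
    proof -
      have "(\<Sum>i\<in>Basis. ((z - x) \<bullet> i) * (unit_bump_grad (u s z) \<bullet> i)) = unit_bump_grad (u s z) \<bullet> (z - x)"
        unfolding euclidean_inner[of "unit_bump_grad (u s z)" "z - x"] by (intro sum.cong) (auto simp: mult.commute)
      then have "(\<Sum>i\<in>Basis. \<phi>' i z) = d * K s z + (unit_bump_grad (u s z) \<bullet> (z - x)) / (s * \<rho>) / N s"
        by (simp add: \<phi>'_def sum.distrib d_def flip: sum_divide_distrib)
      also have "\<dots> = - s * K' s z" using s \<rho> Npos[OF s(1)]
        by (simp add: K'_def power2_eq_square right_diff_distrib)
      finally show ?thesis .
    qed
    \<comment> \<open>This is the divergence formula: \<open>\<phi>' i\<close> is the i-th
      derivative of the i-th component of (z - x) * K s.\<close>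
    then have K'sum: "K' s z = (\<Sum>i\<in>Basis. - (1 / s) * \<phi>' i z)" for z
      using s by (simp add: sum_negf flip: sum_distrib_left sum_divide_distrib)
    have ii: "integrable (lebesgue_on \<Omega>) (\<lambda>z. f' z * \<phi>' i z)" for i
    proof (rule lebesgue_on_integrable)
      have "set_integrable lborel (Kset s) (\<lambda>z. f' z * \<phi>' i z)"
        unfolding set_integrable_def
        by (intro borel_integrable_compact KsC continuous_intros continuous_on_subset[OF f'(1)] continuous_on_subset[OF c\<phi>']) auto
      moreover have "(\<lambda>z. indicat_real \<Omega> z *\<^sub>R (f' z * \<phi>' i z)) = (\<lambda>z. indicat_real (Kset s) z *\<^sub>R (f' z * \<phi>' i z))"
        using \<phi>0 Kset\<Omega>[OF s] by (force simp: fun_eq_iff indicator_def)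
      ultimately show "set_integrable lborel \<Omega> (\<lambda>z. f' z * \<phi>' i z)" by (simp only: set_integrable_def)
    qed (use \<Omega> in simp)
    have "(LINT z|lebesgue_on \<Omega>. f' z * K' s z) = (LINT z|lebesgue_on \<Omega>. (\<Sum>i\<in>Basis. - (1 / s) * (f' z * \<phi>' i z)))"
      by (simp add: K'sum sum_distrib_left mult_ac)
    also have "\<dots> = (\<Sum>i\<in>Basis. - (1 / s) * (LINT z|lebesgue_on \<Omega>. f' z * \<phi>' i z))"
      using ii by (subst Bochner_Integration.integral_sum) (auto intro!: Bochner_Integration.integrable_mult_right)
    finally have sumeq: "(LINT z|lebesgue_on \<Omega>. f' z * K' s z) = (\<Sum>i\<in>Basis. - (1 / s) * (LINT z|lebesgue_on \<Omega>. f' z * \<phi>' i z))" .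
    have each: "\<bar>- (1 / s) * (LINT z|lebesgue_on \<Omega>. f' z * \<phi>' i z)\<bar> \<le> 4 * (V + G i) * \<rho> powr \<gamma> * s powr (\<gamma> - 1)"
      if i: "i \<in> Basis" for i
    proof -
      have "(\<lambda>z. f' z * \<phi>' i z) = (\<lambda>z. f z * partial_within UNIV i (\<phi> i) z)"
        using f'(2) \<phi>0 part[OF i] by (force simp: fun_eq_iff)
      then have eq: "(LINT z|lebesgue_on \<Omega>. f' z * \<phi>' i z) = - (LINT z|lebesgue_on \<Omega>. g i z * \<phi> i z)"
        using weak[OF i] test[of i] unfolding weak_partial_def by simp
      \<comment> \<open>Balances the two terms of \<open>le_young\<close>: lam times the volume (s *
        \<rho>)^d, and lam powr (1 - q), are both of order (s * \<rho>)^(d - d / q).\<close>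
      define lam where "lam = (s * \<rho>) powr (- d / q)"
      define \<beta> where "\<beta> = 4 * \<rho> * s / N s"
      have lam: "0 < lam" using s \<rho> by (simp add: lam_def)
      have \<beta>: "0 \<le> \<beta>" using s \<rho> Npos[OF s(1)] by (simp add: \<beta>_def)
      define Hb where "Hb z = \<beta> * (lam * indicat_real (Kset s) z + lam powr (1 - q) * \<bar>g i z\<bar> powr q)" for z
      have KsM: "Kset s \<in> sets borel" using KsC by (simp add: borel_compact)
      have iK: "integrable (lebesgue_on \<Omega>) (indicat_real (Kset s))"
        and vK: "(LINT z|lebesgue_on \<Omega>. indicat_real (Kset s) z) = (s * \<rho>) powr d * V"
      proof -
        have eqI: "(\<lambda>z. indicat_real \<Omega> z *\<^sub>R indicat_real (Kset s) z) = indicat_real (Kset s)"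
          using Kset\<Omega>[OF s] by (auto simp: fun_eq_iff indicator_def)
        have si: "set_integrable lborel \<Omega> (indicat_real (Kset s))"
          unfolding set_integrable_def eqI
          using borel_integrable_compact[OF KsC continuous_on_const[of "Kset s" "1 :: real"]] by simp
        show "integrable (lebesgue_on \<Omega>) (indicat_real (Kset s))"
          using \<Omega>(1) si by (intro lebesgue_on_integrable) auto
        have "(LINT z|lebesgue_on \<Omega>. indicat_real (Kset s) z) = (LINT z:\<Omega>|lborel. indicat_real (Kset s) z)"
          using \<Omega>(1) KsM by (intro lebesgue_on_eq_lborel) (auto simp: set_borel_measurable_def)
        also have "\<dots> = measure lborel (Kset s)" unfolding set_lebesgue_integral_def eqI using KsM by simp
        also have "\<dots> = (s * \<rho>) ^ DIM('a) * V"
          using content_ball_conv_unit_ball[of "s * \<rho>" "x + s *\<^sub>R (c - x)"] s \<rho>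
          unfolding Kset_eq[OF s(1)] V_def by (simp add: content_cball_conv_ball) 
        finally show "(LINT z|lebesgue_on \<Omega>. indicat_real (Kset s) z) = (s * \<rho>) powr d * V"
          using N_powr[OF s(1)] by (simp add: N_def)
      qed
      have iH: "integrable (lebesgue_on \<Omega>) Hb"
        unfolding Hb_def by (intro Bochner_Integration.integrable_mult_right Bochner_Integration.integrable_add iK g i)
      have "(LINT z|lebesgue_on \<Omega>. Hb z) = \<beta> * (lam * ((s * \<rho>) powr d * V) + lam powr (1 - q) * G i)"
        unfolding Hb_def G_def using iK g[OF i] vK by simp
      have le: "norm (g i z * \<phi> i z) \<le> Hb z" for z
      proof (cases "z \<in> Kset s")
        case True
        then obtain y where y: "y \<in> cball c \<rho>" "z = x + s *\<^sub>R (y - x)" by (auto simp: Kset_def)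
        have "\<bar>(z - x) \<bullet> i\<bar> \<le> norm (z - x)" by (rule Basis_le_norm[OF i])
        also have "\<dots> = s * norm (y - x)" using y s by simp
        also have "\<dots> \<le> s * (4 * \<rho>)" using far[OF y(1)] s by (intro mult_left_mono) auto
        finally have "\<bar>\<phi> i z\<bar> \<le> s * (4 * \<rho>) * (1 / N s)"
          unfolding \<phi>_def abs_mult using Kbound[OF s(1), of z] s \<rho> by (intro mult_mono) auto
        then have "\<bar>\<phi> i z\<bar> \<le> \<beta>" by (simp add: \<beta>_def mult_ac)
        then have "\<bar>g i z\<bar> * \<bar>\<phi> i z\<bar> \<le> (lam + lam powr (1 - q) * \<bar>g i z\<bar> powr q) * \<beta>"
          using le_young[OF lam q1, of "g i z"] by (intro mult_mono) auto
        then show ?thesis using True by (simp add: Hb_def abs_mult mult_ac)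
      next
        case False
        then show ?thesis using \<phi>0 \<beta> lam by (simp add: Hb_def)
      qed
      \<comment> \<open>Integrability of |g|^q does not settle measurability of g itself; if the
        product is not integrable, its integral is 0 by default and the bound still holds.\<close>
      have "\<bar>LINT z|lebesgue_on \<Omega>. g i z * \<phi> i z\<bar> \<le> (LINT z|lebesgue_on \<Omega>. Hb z)"
      proof (cases "integrable (lebesgue_on \<Omega>) (\<lambda>z. g i z * \<phi> i z)")
        case True
        have "norm (LINT z|lebesgue_on \<Omega>. g i z * \<phi> i z) \<le> (LINT z|lebesgue_on \<Omega>. norm (g i z * \<phi> i z))"
          by (rule integral_norm_bound)
        also have "\<dots> \<le> (LINT z|lebesgue_on \<Omega>. Hb z)"
          using True iH le by (intro integral_mono) auto
        finally show ?thesis by simp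
      next
        case False
        have "0 \<le> Hb z" for z using order_trans[OF norm_ge_zero le[of z]] .
        then show ?thesis using False by (simp add: not_integrable_integral_eq)
      qed
      also have "\<dots> = \<beta> * (lam * ((s * \<rho>) powr d * V) + lam powr (1 - q) * G i)" by fact
      also have "lam * ((s * \<rho>) powr d * V) = (s * \<rho>) powr (d - d / q) * V"
        unfolding lam_def by (simp flip: powr_add mult.assoc)
      also have "lam powr (1 - q) = (s * \<rho>) powr (d - d / q)"
      proof -
        have "- d / q * (1 - q) = d - d / q" using q1 by (simp add: field_simps)
        then show ?thesis unfolding lam_def powr_powr by simp
      qed
      also have "\<beta> * ((s * \<rho>) powr (d - d / q) * V + (s * \<rho>) powr (d - d / q) * G i)
          = 4 * (V + G i) * (\<rho> * s * ((s * \<rho>) powr (d - d / q) / (s * \<rho>) powr d))"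
        unfolding \<beta>_def N_powr[OF s(1)] by (simp add: algebra_simps add_divide_distrib)
      also have "(s * \<rho>) powr (d - d / q) / (s * \<rho>) powr d = (s * \<rho>) powr (\<gamma> - 1)"
        unfolding powr_diff[symmetric] by (simp add: \<gamma>_def)
      also have "\<rho> * s * (s * \<rho>) powr (\<gamma> - 1) = s * (\<rho> powr \<gamma> * s powr (\<gamma> - 1))"
        using s \<rho> by (simp add: powr_mult powr_diff)
      finally have "\<bar>LINT z|lebesgue_on \<Omega>. g i z * \<phi> i z\<bar> \<le> s * (4 * (V + G i) * \<rho> powr \<gamma> * s powr (\<gamma> - 1))"
        by (simp add: mult_ac)
      then have "1 / s * \<bar>LINT z|lebesgue_on \<Omega>. g i z * \<phi> i z\<bar> \<le> 1 / s * (s * (4 * (V + G i) * \<rho> powr \<gamma> * s powr (\<gamma> - 1)))"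
        using s by (intro mult_left_mono) auto
      then show ?thesis unfolding eq using s by (simp add: abs_mult)
    qed
    have "\<bar>LINT z|lebesgue_on \<Omega>. f' z * K' s z\<bar> \<le> (\<Sum>i\<in>Basis. \<bar>- (1 / s) * (LINT z|lebesgue_on \<Omega>. f' z * \<phi>' i z)\<bar>)"
      unfolding sumeq by (rule sum_abs)
    also have "\<dots> \<le> (\<Sum>i\<in>Basis. 4 * (V + G i) * \<rho> powr \<gamma> * s powr (\<gamma> - 1))" by (intro sum_mono each)
    also have "\<dots> = Ctot * \<rho> powr \<gamma> * s powr (\<gamma> - 1)"
      by (simp add: Ctot_def sum_distrib_left sum_distrib_right)
    finally show ?thesis .
  qed
  define F where "F s = (LINT z|lebesgue_on \<Omega>. f z * K s z)" for s
  have Ctot: "0 \<le> Ctot"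
    unfolding Ctot_def V_def G_def by (intro mult_nonneg_nonneg sum_nonneg add_nonneg_nonneg integral_nonneg_AE) auto
  have F_diff: "\<bar>F 1 - F s0\<bar> \<le> Ctot * \<rho> powr \<gamma> / \<gamma>" if s0: "0 < s0" "s0 < 1" for s0
  proof -
    define Cc where "Cc = (\<lambda>(s, y). x + s *\<^sub>R (y - x)) ` ({s0..1} \<times> cball c \<rho>)"
    have Cc: "compact Cc" unfolding Cc_def split_beta
      by (intro compact_continuous_image compact_Times continuous_intros) auto
    have Cc\<Omega>: "Cc \<subseteq> \<Omega>" unfolding Cc_def using star s0 by auto
    have KC: "Kset s \<subseteq> Cc" if "s0 \<le> s" "s \<le> 1" for s unfolding Kset_def Cc_def using that by force
    \<comment> \<open>The supports for s in [s0, 1] sweep out a compact subset of \<Omega>. A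
      continuous extension of \<open>f\<close> from it to the whole space allows differentiation
      under the integral over a fixed box.\<close>
    obtain f' where f': "continuous_on UNIV f'" "\<And>z. z \<in> Cc \<Longrightarrow> f' z = f z"
      using Tietze_unbounded[of Cc f UNIV] continuous_on_subset[OF f, of Cc] Cc Cc\<Omega> X(1) compact_imp_closed
      by (metis closed_closedin order_trans subtopology_UNIV)
    obtain b where b: "Cc \<subseteq> cbox (- b) b" using bounded_subset_cbox_symmetric[OF compact_imp_bounded[OF Cc]] by blast
    define J where "J s = integral (cbox (- b) b) (\<lambda>z. f' z * K s z)" for s
    define J' where "J' s = integral (cbox (- b) b) (\<lambda>z. f' z * K' s z)" for s
    have conv: "integral (cbox (- b) b) (\<lambda>z. f' z * k z) = (LINT z|lebesgue_on \<Omega>. f' z * k z)"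
      if "continuous_on UNIV k" "\<And>z. z \<notin> Kset s \<Longrightarrow> k z = 0" "s0 \<le> s" "s \<le> 1" for k s
    proof -
      have sub: "Kset s \<subseteq> Cc" using KC that by simp
      have "integral (cbox (- b) b) (\<lambda>z. f' z * k z) = (\<integral>z. f' z * k z \<partial>lborel)"
        using that sub b by (intro integral_cbox_eq_lborel continuous_intros f') auto
      also have "\<dots> = (LINT z:\<Omega>|lborel. f' z * k z)"
        unfolding set_lebesgue_integral_def using that sub Cc\<Omega>
        by (intro Bochner_Integration.integral_cong) (auto simp: indicator_def)
      also have "\<dots> = (LINT z|lebesgue_on \<Omega>. f' z * k z)"
        using \<Omega>(1) that by (intro lebesgue_on_eq_lborel[symmetric] set_borel_measurable_continuous_borel
            continuous_intros continuous_on_subset[OF f'(1)] continuous_on_subset[OF that(1)]) auto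
      finally show ?thesis .
    qed
    have JF: "J s = F s" if "s0 \<le> s" "s \<le> 1" for s
    proof -
      have "J s = (LINT z|lebesgue_on \<Omega>. f' z * K s z)"
        unfolding J_def by (rule conv[OF slice(1) _ that]) (use K0 s0 that in auto)
      moreover have "(\<lambda>z. f' z * K s z) = (\<lambda>z. f z * K s z)"
      proof
        fix z show "f' z * K s z = f z * K s z"
          using f'(2)[of z] KC[OF that] K0[of z s] s0 that by (cases "z \<in> Kset s") auto
      qed
      ultimately show ?thesis by (simp add: F_def)
    qed
    have J'b: "\<bar>J' s\<bar> \<le> Ctot * \<rho> powr \<gamma> * s powr (\<gamma> - 1)" if "s0 \<le> s" "s \<le> 1" for s
    proof -
      have "J' s = (LINT z|lebesgue_on \<Omega>. f' z * K' s z)"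
        unfolding J'_def by (rule conv[OF slice(2) _ that]) (use K'0 s0 that in auto)
      then show ?thesis using derivative_bound[of s f'] that s0 f' KC[OF that] by auto
    qed
    have dJ: "(J has_real_derivative J' s) (at s within {s0..1})" if "s \<in> {s0..1}" for s
      unfolding J_def[abs_def] J'_def
    proof (rule leibniz_rule_field_derivative)
      fix s z assume "s \<in> {s0..1}"
      then have "0 < s" using s0 by simp
      from has_field_derivative_at_within[OF DERIV_cmult[OF dK[OF this]]]
      show "((\<lambda>s. f' z * K s z) has_real_derivative f' z * K' s z) (at s within {s0..1})" .
      show "(\<lambda>z. f' z * K s z) integrable_on cbox (- b) b"
        using \<open>s \<in> {s0..1}\<close> s0
        by (intro integrable_continuous continuous_intros continuous_on_subset[OF f'(1)] continuous_on_subset[OF slice(1)]) auto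
    next
      have "continuous_on ({s0..1} \<times> cbox (- b) b) (\<lambda>p. K' (fst p) (snd p))"
        by (rule continuous_on_subset[OF cK'[of "{s0..1}"]]) (use s0 in auto)
      moreover have "continuous_on ({s0..1} \<times> cbox (- b) b) (\<lambda>p. f' (snd p))"
        by (rule continuous_on_compose2[OF f'(1)]) (auto intro!: continuous_intros)
      ultimately show "continuous_on ({s0..1} \<times> cbox (- b) b) (\<lambda>(s, z). f' z * K' s z)"
        unfolding split_beta by (intro continuous_intros)
    qed (use that in auto)
    have cJ: "continuous_on {s0..1} J" using dJ by (rule DERIV_continuous_on)
    \<comment> \<open>An antiderivative of the bound on |J'|. Monotonicity of A - J and A + J
      integrates that bound by the mean value theorem, and A 1 - A s0 stays bounded as s0 tends to
      0.\<close>
    define A where "A s = Ctot * \<rho> powr \<gamma> / \<gamma> * s powr \<gamma>" for s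
    have dA: "(A has_real_derivative Ctot * \<rho> powr \<gamma> * s powr (\<gamma> - 1)) (at s)" if "0 < s" for s
      unfolding A_def[abs_def] using that \<gamma> by (auto intro!: derivative_eq_intros)
    have cA: "continuous_on {s0..1} A"
      using s0 by (intro continuous_at_imp_continuous_on ballI DERIV_isCont[OF dA]) auto
    have dJ': "(J has_real_derivative J' s) (at s)" if "s0 < s" "s < 1" for s
      using dJ[of s] that at_within_interior[of s "{s0..1}"] by (simp add: interior_atLeastAtMost_real)
    have half: "\<epsilon> * (F 1 - F s0) \<le> A 1 - A s0" if \<epsilon>: "\<epsilon> = 1 \<or> \<epsilon> = -1" for \<epsilon>
    proof -
      obtain z where z: "s0 < z" "z < 1"
        "(A 1 - \<epsilon> * J 1) - (A s0 - \<epsilon> * J s0) = (Ctot * \<rho> powr \<gamma> * z powr (\<gamma> - 1) - \<epsilon> * J' z) * (1 - s0)"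
      proof (rule mvt[of s0 1 "\<lambda>s. A s - \<epsilon> * J s" "\<lambda>s h. (Ctot * \<rho> powr \<gamma> * s powr (\<gamma> - 1) - \<epsilon> * J' s) * h"])
        show "continuous_on {s0..1} (\<lambda>s. A s - \<epsilon> * J s)" by (intro continuous_intros cA cJ)
        fix s assume s: "s0 < s" "s < 1"
        have "((\<lambda>s. A s - \<epsilon> * J s) has_real_derivative Ctot * \<rho> powr \<gamma> * s powr (\<gamma> - 1) - \<epsilon> * J' s) (at s)"
          using s s0 by (intro DERIV_diff DERIV_cmult dA dJ') auto
        then show "((\<lambda>s. A s - \<epsilon> * J s) has_derivative (\<lambda>h. (Ctot * \<rho> powr \<gamma> * s powr (\<gamma> - 1) - \<epsilon> * J' s) * h)) (at s)"
          by (simp add: has_field_derivative_def)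
      qed (use s0 that in auto)
      have "\<epsilon> * J' z \<le> Ctot * \<rho> powr \<gamma> * z powr (\<gamma> - 1)"
        using J'b[of z] z \<epsilon> by (auto simp: abs_le_iff)
      then have "0 \<le> (Ctot * \<rho> powr \<gamma> * z powr (\<gamma> - 1) - \<epsilon> * J' z) * (1 - s0)" using s0 by (intro mult_nonneg_nonneg) auto
      then show ?thesis using z(3) JF[of 1] JF[of s0] s0 by (simp add: algebra_simps)
    qed
    have "A 1 - A s0 \<le> Ctot * \<rho> powr \<gamma> / \<gamma>"
      using Ctot \<gamma> unfolding A_def by simp
    then show ?thesis using half[of 1] half[of "-1"] by (auto simp: abs_le_iff)
  qed
  have F1: "F 1 = (LINT z|lebesgue_on \<Omega>. f z * (bump c \<rho> z / \<rho> ^ DIM('a)))"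
    by (simp add: F_def K_bump N_def)
  \<comment> \<open>As s tends to 0 the kernels concentrate at \<open>x\<close> with mass
    \<open>m0\<close>, so continuity of \<open>f\<close> at this one point identifies the
    limit.\<close>
  have lim: "\<exists>s. 0 < s \<and> s < 1 \<and> \<bar>F s - f x * m0\<bar> \<le> \<epsilon> * m0" if \<epsilon>: "0 < \<epsilon>" for \<epsilon>
  proof -
    obtain \<delta> where \<delta>: "0 < \<delta>" "\<And>z. z \<in> X \<Longrightarrow> dist z x < \<delta> \<Longrightarrow> dist (f z) (f x) < \<epsilon>"
      using f X(2) \<epsilon> unfolding continuous_on_iff by metis
    define s where "s = min (1/2) (\<delta> / (8 * \<rho>))"
    have s: "0 < s" "s < 1" "s * (4 * \<rho>) < \<delta>"
    proof -
      show "0 < s" "s < 1" using \<delta> \<rho> by (auto simp: s_def)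
      have "s \<le> \<delta> / (8 * \<rho>)" unfolding s_def by (rule min.cobounded2)
      then have "s * (8 * \<rho>) \<le> \<delta>" using \<rho> by (simp add: le_divide_eq)
      moreover have "s * (4 * \<rho>) < s * (8 * \<rho>)" using \<open>0 < s\<close> \<rho> by simp
      ultimately show "s * (4 * \<rho>) < \<delta>" by linarith
    qed
    have KsC: "compact (Kset s)" by (simp add: Kset_eq[OF s(1)])
    have KsM: "Kset s \<in> sets borel" using KsC by (simp add: borel_compact)
    have iK: "set_integrable lborel (Kset s) (K s)" "set_integrable lborel (Kset s) (\<lambda>z. f z * K s z)"
      unfolding set_integrable_def using Kset\<Omega>[of s] s X(1)
      by (intro borel_integrable_compact KsC continuous_intros continuous_on_subset[OF slice(1)] continuous_on_subset[OF f]; auto)+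
    have intK: "(LINT z:Kset s|lborel. K s z) = m0"
    proof -
      have "(LINT z:Kset s|lborel. K s z) = (\<integral>z. K s z \<partial>lborel)"
        unfolding set_lebesgue_integral_def using K0 s by (intro Bochner_Integration.integral_cong) (auto simp: indicator_def)
      also have "\<dots> = \<bar>s * \<rho>\<bar> ^ DIM('a) *\<^sub>R (\<integral>z. K s ((x + s *\<^sub>R (c - x)) + (s * \<rho>) *\<^sub>R z) \<partial>lborel)"
        using s \<rho> by (intro lborel_integral_affine) auto
      also have "(\<lambda>z. K s ((x + s *\<^sub>R (c - x)) + (s * \<rho>) *\<^sub>R z)) = (\<lambda>z. bump 0 1 z / N s)"
        using s \<rho> by (auto simp: K_bump bump_conv_unit[of "s * \<rho>"])
      finally show ?thesis using s \<rho> Npos[OF s(1)] by (simp add: m0_def N_def)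
    qed
    have "F s = (LINT z:\<Omega>|lborel. f z * K s z)"
      unfolding F_def using \<Omega>(1) X(1) s
      by (intro lebesgue_on_eq_lborel set_borel_measurable_continuous_borel continuous_intros
          continuous_on_subset[OF f] continuous_on_subset[OF slice(1)]) auto
    also have "\<dots> = (LINT z:Kset s|lborel. f z * K s z)"
      using Kset\<Omega>[of s] s K0 by (intro set_integral_eq_subset) auto
    finally have "F s - f x * m0 = (LINT z:Kset s|lborel. f z * K s z) - (LINT z:Kset s|lborel. f x * K s z)"
      using intK by simp
    also have "\<dots> = (LINT z:Kset s|lborel. f z * K s z - f x * K s z)"
      using iK by (intro set_integral_diff(2)[symmetric]) auto
    also have "norm \<dots> \<le> (LINT z:Kset s|lborel. norm (f z * K s z - f x * K s z))"
      using iK by (intro set_integral_norm_bound set_integral_diff(1)) auto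
    also have "\<dots> \<le> (LINT z:Kset s|lborel. \<epsilon> * K s z)"
    proof (rule set_integral_mono)
      show "set_integrable lborel (Kset s) (\<lambda>z. norm (f z * K s z - f x * K s z))"
        using iK by (intro set_integrable_norm set_integral_diff(1)) auto
      show "set_integrable lborel (Kset s) (\<lambda>z. \<epsilon> * K s z)" using iK by simp
      fix z assume z: "z \<in> Kset s"
      then obtain y where y: "y \<in> cball c \<rho>" "z = x + s *\<^sub>R (y - x)" by (auto simp: Kset_def)
      have "dist z x = s * norm (y - x)" using y s by (simp add: dist_norm)
      also have "\<dots> \<le> s * (4 * \<rho>)" using far[OF y(1)] s by (intro mult_left_mono) auto
      finally have "dist z x < \<delta>" using s by linarith
      moreover have "z \<in> X" using z Kset\<Omega>[of s] s X(1) by auto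
      ultimately have "\<bar>f z - f x\<bar> \<le> \<epsilon>" using \<delta>(2)[of z] by (simp add: dist_real_def)
      then show "norm (f z * K s z - f x * K s z) \<le> \<epsilon> * K s z"
        using Kbound(1)[OF s(1), of z] by (simp add: abs_mult mult_right_mono flip: left_diff_distrib)
    qed
    also have "\<dots> = \<epsilon> * m0" using intK by simp
    finally show ?thesis using s by auto
  qed
  have m0: "0 \<le> m0" unfolding m0_def by (intro integral_nonneg_AE) (simp add: bump_nonneg)
  have "\<bar>F 1 - f x * m0\<bar> \<le> Ctot * \<rho> powr \<gamma> / \<gamma> + \<epsilon>" if \<epsilon>: "0 < \<epsilon>" for \<epsilon>
  proof -
    have "0 < \<epsilon> / (m0 + 1)" using \<epsilon> m0 by simp
    then obtain s where s: "0 < s" "s < 1" "\<bar>F s - f x * m0\<bar> \<le> \<epsilon> / (m0 + 1) * m0" using lim by blast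
    have "\<epsilon> / (m0 + 1) * m0 \<le> \<epsilon>" using \<epsilon> m0 by (simp add: divide_simps)
    then show ?thesis using s F_diff[of s] by linarith
  qed
  then have "\<bar>F 1 - f x * m0\<bar> \<le> Ctot * \<rho> powr \<gamma> / \<gamma>" by (rule field_le_epsilon)
  then show ?thesis unfolding F1 m0_def Ctot_def V_def G_def \<gamma>_def by simp
qed

section \<open>Quadratic form bounds for a symmetric matrix and its inverse\<close>

subsection \<open>Ellipticity from eigenvalues\<close>

text \<open>Take the minimum l of the form on the unit sphere. Then T - l is nonnegative and its
  form vanishes at the minimiser, which forces the minimiser into the kernel of T - l. This converts
  the eigenvalue condition of (A2) into bounds on the form.\<close>

lemma symmetric_min_eigenvalue:
  fixes T :: "'a::euclidean_space \<Rightarrow> 'a"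
  assumes lin: "linear T" and sym: "\<And>u v. T u \<bullet> v = u \<bullet> T v"
  shows "\<exists>l. is_eigenvalue T l \<and> (\<forall>v. l * (v \<bullet> v) \<le> T v \<bullet> v)"
proof -
  have cT: "continuous_on (sphere 0 1) (\<lambda>v. T v \<bullet> v)"
    by (intro continuous_intros linear_continuous_on linear_conv_bounded_linear[THEN iffD1, OF lin])
  obtain b :: 'a where "b \<in> Basis" using nonempty_Basis by blast
  then have "b \<in> sphere 0 1" by simp
  then obtain v0 where v0: "v0 \<in> sphere 0 1" "\<And>v. v \<in> sphere 0 1 \<Longrightarrow> T v0 \<bullet> v0 \<le> T v \<bullet> v"
    using continuous_attains_inf[OF compact_sphere _ cT] by blast
  define l where "l = T v0 \<bullet> v0"
  have low: "l * (v \<bullet> v) \<le> T v \<bullet> v" for v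
  proof (cases "v = 0")
    case False
    define e where "e = (1 / norm v) *\<^sub>R v"
    have "e \<in> sphere 0 1" using False by (simp add: e_def)
    then have "l \<le> T e \<bullet> e" using v0(2) by (simp add: l_def)
    also have "T e \<bullet> e = (T v \<bullet> v) / (v \<bullet> v)"
      by (simp add: e_def linear_scale[OF lin] power2_norm_eq_inner[symmetric] power2_eq_square)
    finally show ?thesis using False by (simp add: pos_le_divide_eq)
  qed (simp add: linear_0[OF lin])
  define N where "N v = T v - l *\<^sub>R v" for v
  have linN: "linear N" unfolding N_def
    by (intro linear_compose_sub lin linear_scale_self)
  have Npos: "0 \<le> N v \<bullet> v" for v using low[of v] by (simp add: N_def inner_diff_left)
  have N0: "N v0 \<bullet> v0 = 0" using v0(1) by (simp add: N_def l_def inner_diff_left dot_square_norm)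
  have symN: "N u \<bullet> v = u \<bullet> N v" for u v by (simp add: N_def inner_diff sym)
  define h where "h = N v0"
  have "h \<bullet> h \<le> 0 + e" if e: "0 < e" for e
  proof -
    \<comment> \<open>Moving from \<open>v0\<close> by -t * h turns nonnegativity into 2 * (h . h)
      \<le> t * (N h . h); this t makes the right side at most 2 * e, and the + 1 avoids a zero
      denominator.\<close>
    define t where "t = 2 * e / (N h \<bullet> h + 1)"
    have t: "0 < t" using e Npos[of h] by (simp add: t_def)
    have "0 \<le> N (v0 - t *\<^sub>R h) \<bullet> (v0 - t *\<^sub>R h)" by (rule Npos)
    also have "\<dots> = - 2 * t * (h \<bullet> h) + t * t * (N h \<bullet> h)"
      using symN[of h v0] N0
      by (simp add: linear_diff[OF linN] linear_scale[OF linN] inner_diff h_def[symmetric] inner_commute algebra_simps)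
    finally have "t * (2 * (h \<bullet> h)) \<le> t * (t * (N h \<bullet> h))" by (simp add: algebra_simps)
    then have "2 * (h \<bullet> h) \<le> t * (N h \<bullet> h)" using t by (subst (asm) mult_le_cancel_left_pos)
    also have "\<dots> \<le> 2 * e" using e Npos[of h] by (simp add: t_def divide_simps)
    finally show ?thesis by simp
  qed
  then have "h \<bullet> h \<le> 0" by (rule field_le_epsilon)
  then have "h = 0" by (metis inner_eq_zero_iff inner_ge_zero order_antisym)
  then have "T v0 = l *\<^sub>R v0" by (simp add: h_def N_def)
  moreover have "v0 \<noteq> 0" using v0(1) by auto
  ultimately have "is_eigenvalue T l" unfolding is_eigenvalue_def by blast
  with low show ?thesis by blast
qed

lemma symmetric_eigenvalue_bounds:
  fixes T :: "'a::euclidean_space \<Rightarrow> 'a"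
  assumes lin: "linear T" and sym: "\<And>u v. T u \<bullet> v = u \<bullet> T v"
    and ev: "\<And>l. is_eigenvalue T l \<Longrightarrow> l \<in> {c..C}"
  shows "c * (v \<bullet> v) \<le> T v \<bullet> v" "T v \<bullet> v \<le> C * (v \<bullet> v)"
proof -
  obtain l where "is_eigenvalue T l" "l * (v \<bullet> v) \<le> T v \<bullet> v"
    using symmetric_min_eigenvalue[OF lin sym] by blast
  moreover have "c * (v \<bullet> v) \<le> l * (v \<bullet> v)" using ev[OF calculation(1)] by (intro mult_right_mono) auto
  ultimately show "c * (v \<bullet> v) \<le> T v \<bullet> v" by linarith
  have "linear (\<lambda>v. - T v)" by (rule linear_compose_neg[OF lin])
  from symmetric_min_eigenvalue[OF this] sym
  obtain l where l: "is_eigenvalue (\<lambda>v. - T v) l" "l * (v \<bullet> v) \<le> (- T v) \<bullet> v" by auto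
  from l(1) obtain u where "u \<noteq> 0" "- T u = l *\<^sub>R u" unfolding is_eigenvalue_def by blast
  then have "u \<noteq> 0 \<and> T u = (- l) *\<^sub>R u" by (metis minus_minus scaleR_minus_left)
  then have "is_eigenvalue T (- l)" unfolding is_eigenvalue_def by blast
  from ev[OF this] have "(- l) * (v \<bullet> v) \<le> C * (v \<bullet> v)" by (intro mult_right_mono) auto
  then show "T v \<bullet> v \<le> C * (v \<bullet> v)" using l(2) by simp
qed

text \<open>The eigenvalues of the inverse are reciprocals and [1/2, 2] is invariant under
  reciprocals, so the inverse obeys the same bounds.\<close>

lemma symmetric_inverse:
  fixes T :: "'a::euclidean_space \<Rightarrow> 'a"
  assumes lin: "linear T" and sym: "\<And>u v. T u \<bullet> v = u \<bullet> T v"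
    and ev: "\<And>l. is_eigenvalue T l \<Longrightarrow> l \<in> {1/2..2}"
  shows "\<exists>B. linear B \<and> (\<forall>x. T (B x) = x) \<and> (\<forall>x. B (T x) = x) \<and>
    (\<forall>x. x \<bullet> x \<le> 2 * (B x \<bullet> x)) \<and> (\<forall>x. B x \<bullet> x \<le> 2 * (x \<bullet> x))"
proof -
  have "v = 0" if "T v = 0" for v
    using symmetric_eigenvalue_bounds(1)[OF lin sym ev, of v] that by (simp add: inner_ge_zero order_antisym_conv)
  then have "inj T" using linear_injective_0[OF lin] by blast
  then obtain B where B: "linear B" "\<And>x. B (T x) = x" "\<And>x. T (B x) = x"
    using linear_injective_isomorphism[OF lin] by blast
  have symB: "B u \<bullet> v = u \<bullet> B v" for u v
    using sym[of "B u" "B v"] by (simp add: B(3))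
  have evB: "l \<in> {1/2..2}" if "is_eigenvalue B l" for l
  proof -
    from that obtain v where v: "v \<noteq> 0" "B v = l *\<^sub>R v" unfolding is_eigenvalue_def by blast
    then have lv: "v = l *\<^sub>R T v" using B(3)[of v] by (simp add: linear_scale[OF lin])
    then have l0: "l \<noteq> 0" using v(1) by auto
    have "(1 / l) *\<^sub>R v = (1 / l) *\<^sub>R (l *\<^sub>R T v)" using lv by (rule arg_cong)
    also have "\<dots> = T v" using l0 by simp
    finally have l: "l \<noteq> 0" "T v = (1 / l) *\<^sub>R v" using l0 by auto
    then have "is_eigenvalue T (1 / l)" unfolding is_eigenvalue_def using v(1) by blast
    from ev[OF this] have "1 / 2 \<le> 1 / l" "1 / l \<le> 2" by auto
    moreover have "0 < l"
    proof (rule ccontr)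
      assume "\<not> 0 < l"
      then have "1 / l \<le> 0" by simp
      with \<open>1 / 2 \<le> 1 / l\<close> show False by linarith
    qed
    ultimately show ?thesis by (simp add: field_simps)
  qed
  note b = symmetric_eigenvalue_bounds[OF B(1) symB evB]
  have "x \<bullet> x \<le> 2 * (B x \<bullet> x)" for x using b(1)[of x] by simp
  moreover have "B x \<bullet> x \<le> 2 * (x \<bullet> x)" for x using b(2)[of x] .
  ultimately show ?thesis using B by blast
qed

lemma linear_coeff_map: "linear (coeff_map a x)"
  unfolding coeff_map_def
  by (intro linearI) (simp_all add: inner_add_left distrib_left sum.distrib scaleR_add_left
      scaleR_sum_right sum_distrib_left mult_ac)

lemma coeff_map_inner: "coeff_map a x v \<bullet> u = (\<Sum>i\<in>Basis. \<Sum>j\<in>Basis. a i j x * (v \<bullet> j) * (u \<bullet> i))"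
  unfolding coeff_map_def inner_sum_left
  by (intro sum.cong refl) (simp add: sum_distrib_right inner_commute)

section \<open>Regularity of the solution and of the coefficients up to the thin set\<close>

subsection \<open>The problem at a thin point\<close>

locale thin_obstacle =
  fixes a :: "'n::finite pt \<Rightarrow> 'n pt \<Rightarrow> 'n pt \<Rightarrow> real" and w :: "'n pt \<Rightarrow> real" and p :: ereal and \<alpha> :: real
  assumes coeffs: "admissible_coeffs p a"
    and alpha: "0 < \<alpha>"
    and reg: "C1_holder_loc \<alpha> (half_ball 0 1) w"
    and sol: "thin_obstacle_solution a w"
begin

definition Hb :: "'n pt set" where "Hb = half_ball 0 1"
definition P :: "'n pt set" where "P = {x. 0 \<le> snd x}"
definition T :: "'n pt set" where "T = {x. snd x = 0}"
definition A :: "'n pt \<Rightarrow> 'n pt \<Rightarrow> 'n pt" where "A = coeff_map a"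
definition g :: "'n pt \<Rightarrow> 'n pt" where "g x = (\<Sum>v\<in>Basis. partial_within Hb v w x *\<^sub>R v)"

lemma Hb_eq: "Hb = P \<inter> ball 0 1"
  by (auto simp: Hb_def P_def half_ball_def)

lemma thin_ball_eq: "thin_ball 1 = T \<inter> ball (0 :: 'n pt) 1"
  by (auto simp: thin_ball_def T_def half_ball_def)

lemma thin_sub_Hb: "thin_ball 1 \<subseteq> Hb"
  by (auto simp: thin_ball_def Hb_def)

lemma closed_P: "closed P"
  unfolding P_def by (intro closed_Collect_le continuous_intros)

lemma w_has_derivative: "x \<in> Hb \<Longrightarrow> (w has_derivative (\<lambda>h. h \<bullet> g x)) (at x within Hb)"
proof -
  assume x: "x \<in> Hb"
  have "w differentiable (at x within Hb)"
    using reg x unfolding C1_holder_loc_def differentiable_on_def Hb_def by blast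
  then have fd: "(w has_derivative frechet_derivative w (at x within Hb)) (at x within Hb)"
    by (simp add: frechet_derivative_works)
  then have lin: "linear (frechet_derivative w (at x within Hb))" by (rule has_derivative_linear)
  have "frechet_derivative w (at x within Hb) h = h \<bullet> g x" for h
  proof -
    have "frechet_derivative w (at x within Hb) h = frechet_derivative w (at x within Hb) (\<Sum>v\<in>Basis. (h \<bullet> v) *\<^sub>R v)"
      by (simp add: euclidean_representation)
    also have "\<dots> = (\<Sum>v\<in>Basis. (h \<bullet> v) * partial_within Hb v w x)"
      by (simp add: linear_sum[OF lin] linear_scale[OF lin] partial_within_def)
    also have "\<dots> = h \<bullet> g x" by (simp add: g_def inner_sum_right mult.commute)
    finally show ?thesis .
  qed
  then have "frechet_derivative w (at x within Hb) = (\<lambda>h. h \<bullet> g x)" by blast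
  with fd show ?thesis by simp
qed

lemma g_component: "v \<in> Basis \<Longrightarrow> g x \<bullet> v = partial_within Hb v w x"
  unfolding g_def by (rule inner_sum_left_Basis)

lemma g_cont: "continuous_on Hb g"
proof (subst continuous_on_componentwise, intro ballI)
  fix v :: "'n pt" assume v: "v \<in> Basis"
  show "continuous_on Hb (\<lambda>x. g x \<bullet> v)"
    unfolding g_component[OF v] continuous_on_eq_continuous_within
  proof
    fix x assume x: "x \<in> Hb"
    define \<epsilon> where "\<epsilon> = (1 - norm x) / 2"
    have \<epsilon>: "0 < \<epsilon>" "norm x + \<epsilon> < 1" using x by (auto simp: \<epsilon>_def Hb_eq field_simps)
    define C where "C = P \<inter> cball x \<epsilon>"
    have C: "compact C" unfolding C_def using closed_Int_compact[OF closed_P compact_cball] .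
    have CH: "C \<subseteq> Hb"
    proof
      fix y assume "y \<in> C"
      then have "y \<in> P" "norm (y - x) \<le> \<epsilon>" by (auto simp: C_def dist_norm norm_minus_commute)
      then show "y \<in> Hb" using \<epsilon> norm_triangle_sub[of y x] by (auto simp: Hb_eq)
    qed
    have "\<exists>L. \<forall>y\<in>C. \<forall>z\<in>C. \<bar>partial_within Hb v w y - partial_within Hb v w z\<bar> \<le> L * dist y z powr \<alpha>"
      using reg[unfolded C1_holder_loc_def, folded Hb_def, THEN conjunct2, rule_format, OF v, of C] C CH by simp
    then obtain L where L: "\<And>y z. y \<in> C \<Longrightarrow> z \<in> C \<Longrightarrow> \<bar>partial_within Hb v w y - partial_within Hb v w z\<bar> \<le> L * dist y z powr \<alpha>"
      by blast
    have xC: "x \<in> C" using x \<epsilon> by (auto simp: C_def Hb_eq)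
    have "((\<lambda>y. L * dist y x powr \<alpha>) \<longlongrightarrow> L * dist x x powr \<alpha>) (at x within Hb)"
      using alpha by (intro tendsto_intros tendsto_powr') auto
    then have "((\<lambda>y. L * dist y x powr \<alpha>) \<longlongrightarrow> 0) (at x within Hb)" by simp
    then have "((\<lambda>y. partial_within Hb v w y - partial_within Hb v w x) \<longlongrightarrow> 0) (at x within Hb)"
    proof (rule Lim_null_comparison[rotated])
      have "\<forall>\<^sub>F y in at x within Hb. y \<in> ball x \<epsilon> \<and> y \<in> Hb"
        by (rule eventually_at_ball[OF \<epsilon>(1)])
      then show "\<forall>\<^sub>F y in at x within Hb. norm (partial_within Hb v w y - partial_within Hb v w x) \<le> L * dist y x powr \<alpha>"
      proof eventually_elim
        case (elim y)
        then have "y \<in> C" by (auto simp: C_def Hb_eq)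
        from L[OF this xC] show ?case by simp
      qed
    qed
    then show "continuous (at x within Hb) (partial_within Hb v w)"
      by (simp add: continuous_within LIM_zero_iff)
  qed
qed

lemma a_cont: "i \<in> Basis \<Longrightarrow> j \<in> Basis \<Longrightarrow> continuous_on Hb (a i j)"
  using coeffs by (simp add: admissible_coeffs_def Hb_def)

lemma A_lin: "linear (A x)" by (simp add: A_def linear_coeff_map)

lemma A_sym: "x \<in> Hb \<Longrightarrow> A x u \<bullet> v = u \<bullet> A x v"
proof -
  assume x: "x \<in> Hb"
  have "A x u \<bullet> v = (\<Sum>i\<in>Basis. \<Sum>j\<in>Basis. a i j x * (u \<bullet> j) * (v \<bullet> i))"
    by (simp add: A_def coeff_map_inner)
  also have "\<dots> = (\<Sum>j\<in>Basis. \<Sum>i\<in>Basis. a i j x * (u \<bullet> j) * (v \<bullet> i))" by (rule sum.swap)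
  also have "\<dots> = (\<Sum>j\<in>Basis. \<Sum>i\<in>Basis. a j i x * (v \<bullet> i) * (u \<bullet> j))"
    using coeffs x by (intro sum.cong refl) (simp add: admissible_coeffs_def Hb_def mult_ac)
  also have "\<dots> = A x v \<bullet> u" by (simp add: A_def coeff_map_inner)
  finally show ?thesis by (simp add: inner_commute)
qed

lemma A_eigen: "x \<in> Hb \<Longrightarrow> is_eigenvalue (A x) l \<Longrightarrow> l \<in> {1/2..2}"
  using coeffs by (auto simp: admissible_coeffs_def Hb_def A_def)

lemma A_bounds:
  assumes "x \<in> Hb"
  shows "1/2 * (v \<bullet> v) \<le> A x v \<bullet> v" "A x v \<bullet> v \<le> 2 * (v \<bullet> v)"
  using symmetric_eigenvalue_bounds[OF A_lin A_sym[OF assms] A_eigen[OF assms]] by auto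

lemma A_cont:
  assumes "continuous_on X f" "continuous_on X V" "f ` X \<subseteq> Hb"
  shows "continuous_on X (\<lambda>y. A (f y) (V y))"
  unfolding A_def coeff_map_def
  by (intro continuous_intros assms continuous_on_compose2[OF a_cont assms(1) assms(3)]) auto

definition B :: "'n pt \<Rightarrow> 'n pt \<Rightarrow> 'n pt" where
  "B x = (SOME B. linear B \<and> (\<forall>v. A x (B v) = v) \<and> (\<forall>v. B (A x v) = v) \<and>
    (\<forall>v. v \<bullet> v \<le> 2 * (B v \<bullet> v)) \<and> (\<forall>v. B v \<bullet> v \<le> 2 * (v \<bullet> v)))"

lemma B_props:
  assumes "x \<in> Hb"
  shows "linear (B x)" "A x (B x v) = v" "B x (A x v) = v" "v \<bullet> v \<le> 2 * (B x v \<bullet> v)" "B x v \<bullet> v \<le> 2 * (v \<bullet> v)"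
  using someI_ex[OF symmetric_inverse[OF A_lin A_sym[OF assms] A_eigen[OF assms]], folded B_def] by blast+

text \<open>Reduces p = \<infinity> to a finite exponent: bounded derivatives on a set of finite
  measure lie in every L^q, and dimension plus one is a convenient q.\<close>

lemma coeffs_weak_partials_Lq:
  "\<exists>q>real DIM('n pt). \<forall>i\<in>Basis. \<forall>j\<in>Basis. \<forall>k\<in>Basis. \<exists>h.
     integrable (lebesgue_on (interior Hb)) (\<lambda>z. \<bar>h z\<bar> powr q) \<and> weak_partial (interior Hb) k (a i j) h"
proof -
  have pc: "ereal (real CARD('n) + 1) < p" "\<forall>i\<in>Basis. \<forall>j\<in>Basis. sobolev_W1 p (interior Hb) (a i j)"
    using coeffs by (auto simp: admissible_coeffs_def Hb_def)
  have dim: "real DIM('n pt) = real CARD('n) + 1" by simp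
  show ?thesis
  proof (cases p)
    case (real q)
    show ?thesis
    proof (intro exI[where x=q] conjI ballI)
      show "real DIM('n pt) < q" using pc(1) real dim by simp
      fix i j k :: "'n pt" assume "i \<in> Basis" "j \<in> Basis" "k \<in> Basis"
      then obtain h where "in_Lp p (interior Hb) h" "weak_partial (interior Hb) k (a i j) h"
        using pc(2) unfolding sobolev_W1_def by blast
      then show "\<exists>h. integrable (lebesgue_on (interior Hb)) (\<lambda>z. \<bar>h z\<bar> powr q) \<and> weak_partial (interior Hb) k (a i j) h"
        using real by (intro exI[where x=h]) (simp add: in_Lp_def)
    qed
  next
    case PInf
    define q where "q = real DIM('n pt) + 1"
    show ?thesis
    proof (intro exI[where x=q] conjI ballI)
      show "real DIM('n pt) < q" by (simp add: q_def)
      fix i j k :: "'n pt" assume "i \<in> Basis" "j \<in> Basis" "k \<in> Basis"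
      then obtain h where h: "in_Lp p (interior Hb) h" "weak_partial (interior Hb) k (a i j) h"
        using pc(2) unfolding sobolev_W1_def by blast
      then obtain C where hm: "h \<in> borel_measurable (lebesgue_on (interior Hb))" and C: "AE x in lebesgue_on (interior Hb). \<bar>h x\<bar> \<le> C"
        using PInf by (auto simp: in_Lp_def)
      have "integrable (lebesgue_on (interior Hb)) (\<lambda>z. \<bar>h z\<bar> powr q)"
      proof (rule integrableI_bounded_set[where A="interior Hb" and B="\<bar>C\<bar> powr q"])
        have "bounded (interior Hb)" by (rule bounded_subset[of "ball 0 1"]) (use interior_subset Hb_eq in auto)
        then have "emeasure lborel (interior Hb) < \<infinity>" using emeasure_bounded_finite by auto
        then show "emeasure (lebesgue_on (interior Hb)) (interior Hb) < \<infinity>"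
          by (simp add: emeasure_restrict_space)
        show "AE x in lebesgue_on (interior Hb). x \<in> interior Hb \<longrightarrow> norm (\<bar>h x\<bar> powr q) \<le> \<bar>C\<bar> powr q"
          using C by eventually_elim (auto intro!: powr_mono2 simp: q_def)
        show "(\<lambda>z. \<bar>h z\<bar> powr q) \<in> borel_measurable (lebesgue_on (interior Hb))" using hm by measurable
      qed (auto simp: space_restrict_space)
      with h(2) show "\<exists>h. integrable (lebesgue_on (interior Hb)) (\<lambda>z. \<bar>h z\<bar> powr q) \<and> weak_partial (interior Hb) k (a i j) h"
        by blast
    qed
  qed (use pc in auto)
qed

lemma interior_Hb: "interior Hb = {x. 0 < snd x \<and> norm x < 1}"
  unfolding Hb_def by (rule interior_half_ball)

lemma unit_bump_integral_pos: "0 < (\<integral>u. bump (0 :: 'a::euclidean_space) 1 u \<partial>lborel)"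
proof -
  obtain b :: 'a where b: "cball 0 1 \<subseteq> cbox (- b) b" using bounded_subset_cbox_symmetric[OF bounded_cball] by blast
  have "integral (cbox (- b) b) (bump 0 1) = (\<integral>u. bump (0 :: 'a) 1 u \<partial>lborel)"
  proof (rule integral_cbox_eq_lborel)
    fix x assume "x \<notin> cbox (- b) b"
    then have "x \<notin> cball 0 1" using b by blast
    then show "bump 0 1 x = 0" by (simp add: bump_eq_0_iff)
  qed (rule smooth_fn_continuous[OF bump_smooth])
  then show ?thesis using bump_integral_pos[of 1 0 "- b" b] b by simp
qed

text \<open>The values at \<open>x\<close> and \<open>z\<close> are both compared with the same
  weighted mean over an interior ball of radius |x - z|. The margin \<open>3 * norm (x - z)\<close>
  keeps this ball inside the unit ball, and convexity provides the segments that the Morrey estimate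
  contracts along.\<close>

lemma coefficient_holder:
  "\<exists>\<gamma> C. 0 < \<gamma> \<and> 0 \<le> C \<and> (\<forall>i\<in>Basis. \<forall>j\<in>Basis. \<forall>z\<in>thin_ball 1. \<forall>x\<in>P. norm z + 3 * norm (x - z) < 1 \<longrightarrow>
     \<bar>a i j x - a i j z\<bar> \<le> C * norm (x - z) powr \<gamma>)"
proof -
  obtain q where q: "real DIM('n pt) < q" and ex: "\<forall>i\<in>Basis. \<forall>j\<in>Basis. \<forall>k\<in>Basis. \<exists>h.
     integrable (lebesgue_on (interior Hb)) (\<lambda>z. \<bar>h z\<bar> powr q) \<and> weak_partial (interior Hb) k (a i j) h"
    using coeffs_weak_partials_Lq by blast
  then obtain h where h: "\<And>i j k. i \<in> Basis \<Longrightarrow> j \<in> Basis \<Longrightarrow> k \<in> Basis \<Longrightarrow>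
      integrable (lebesgue_on (interior Hb)) (\<lambda>z. \<bar>h i j k z\<bar> powr q) \<and> weak_partial (interior Hb) k (a i j) (h i j k)"
    by metis
  define \<gamma> where "\<gamma> = 1 - real DIM('n pt) / q"
  have d1: "1 \<le> real DIM('n pt)" using DIM_positive[where 'a="'n pt"] by linarith
  have \<gamma>: "0 < \<gamma>" using q d1 by (simp add: \<gamma>_def)
  define m0 where "m0 = (\<integral>u. bump (0 :: 'n pt) 1 u \<partial>lborel)"
  have m0: "0 < m0" unfolding m0_def by (rule unit_bump_integral_pos)
  define K where "K i j = 4 * (\<Sum>k\<in>Basis. measure lborel (ball (0::'n pt) 1) + (LINT z|lebesgue_on (interior Hb). \<bar>h i j k z\<bar> powr q)) / \<gamma>" for i j
  have K: "0 \<le> K i j" for i j unfolding K_def using \<gamma>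
    by (intro divide_nonneg_pos mult_nonneg_nonneg sum_nonneg add_nonneg_nonneg integral_nonneg_AE) auto
  define C where "C = (\<Sum>i\<in>Basis. \<Sum>j\<in>Basis. 2 * K i j / m0)"
  have "\<bar>a i j x - a i j z\<bar> \<le> C * norm (x - z) powr \<gamma>"
    if ij: "i \<in> Basis" "j \<in> Basis" and z: "z \<in> thin_ball 1" and x: "x \<in> P" "norm z + 3 * norm (x - z) < 1" for i j x z
  proof (cases "x = z")
    case False
    define \<rho> where "\<rho> = norm (x - z)"
    have \<rho>: "0 < \<rho>" using False by (simp add: \<rho>_def)
    \<comment> \<open>At height 2 * \<rho> the ball of radius \<rho> stays \<rho> above the flat
      boundary; its points are within 3 * \<rho> of \<open>z\<close> and hence within 4 * \<rho> of
      \<open>x\<close>.\<close>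
    define c where "c = z + (2 * \<rho>) *\<^sub>R (0, 1)"
    have sz: "snd z = 0" "norm z < 1" using z by (auto simp: thin_ball_eq T_def)
    have cy: "\<rho> \<le> snd y" "norm y < 1" "norm (y - z) \<le> 3 * \<rho>" if "y \<in> cball c \<rho>" for y
    proof -
      have yc: "norm (y - c) \<le> \<rho>" using that by (simp add: dist_norm norm_minus_commute)
      have "\<bar>snd (y - c)\<bar> \<le> norm (y - c)" using norm_snd_le[of "snd (y - c)" "fst (y - c)"]
        by (simp only: prod.collapse real_norm_def)
      then show "\<rho> \<le> snd y" using yc sz by (simp add: c_def)
      have cz: "norm (c - z) = 2 * \<rho>" using \<rho> by (simp add: c_def)
      then show "norm (y - z) \<le> 3 * \<rho>" using yc norm_triangle_ineq[of "y - c" "c - z"] by simp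
      then show "norm y < 1" using x(2) norm_triangle_sub[of y z] by (simp add: \<rho>_def)
    qed
    have est: "\<bar>(LINT z|lebesgue_on (interior Hb). a i j z * (bump c \<rho> z / \<rho> ^ DIM('n pt))) - a i j v * m0\<bar> \<le> K i j * \<rho> powr \<gamma>"
      if v: "v \<in> Hb" "norm (v - z) \<le> \<rho>" for v
      unfolding m0_def K_def \<gamma>_def
    proof (rule morrey_bump_estimate[where X=Hb])
      show "open (interior Hb)" "interior Hb \<subseteq> Hb" using interior_subset by auto
      have "bounded (interior Hb)" by (rule bounded_subset[of "ball 0 1"]) (use interior_subset Hb_eq in auto)
      then show "emeasure lborel (interior Hb) < \<infinity>" using emeasure_bounded_finite by auto
      show "continuous_on Hb (a i j)" by (rule a_cont[OF ij])
      show "norm (y - v) \<le> 4 * \<rho>" if "y \<in> cball c \<rho>" for y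
        using cy[OF that] v norm_triangle_ineq[of "y - z" "z - v"] by (simp add: norm_minus_commute)
      show "v + s *\<^sub>R (y - v) \<in> interior Hb" if s: "0 < s" "s \<le> 1" "y \<in> cball c \<rho>" for s y
      proof -
        have vy: "v + s *\<^sub>R (y - v) = (1 - s) *\<^sub>R v + s *\<^sub>R y" by (simp add: algebra_simps)
        have "0 < s * snd y" using s cy[OF s(3)] \<rho> by simp
        moreover have "0 \<le> (1 - s) * snd v" using s v by (simp add: Hb_eq P_def)
        ultimately have "0 < snd (v + s *\<^sub>R (y - v))" unfolding vy by simp
        moreover have "v + s *\<^sub>R (y - v) \<in> ball 0 1"
          unfolding vy using s cy[OF s(3)] v by (intro convexD[OF convex_ball]) (auto simp: Hb_eq)
        ultimately show ?thesis by (simp add: interior_Hb)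
      qed
    qed (use h ij q \<rho> v in auto)
    have "norm x < 1" using x(2) norm_triangle_sub[of x z] norm_ge_zero[of "x - z"] by linarith
    then have "\<bar>a i j x * m0 - a i j z * m0\<bar> \<le> 2 * K i j * \<rho> powr \<gamma>"
      using est[of x] est[of z] x(1) sz \<rho> by (auto simp: Hb_eq P_def \<rho>_def)
    then have "\<bar>a i j x - a i j z\<bar> * m0 \<le> 2 * K i j * \<rho> powr \<gamma>"
      using m0 by (simp add: abs_mult flip: left_diff_distrib)
    then have "\<bar>a i j x - a i j z\<bar> \<le> 2 * K i j / m0 * \<rho> powr \<gamma>"
      using m0 by (simp add: field_simps)
    also have "2 * K i j / m0 \<le> C"
    proof -
      have "2 * K i j / m0 \<le> (\<Sum>j\<in>Basis. 2 * K i j / m0)"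
        using ij K m0 by (intro member_le_sum) auto
      also have "\<dots> \<le> C" unfolding C_def
        using ij K m0 by (intro member_le_sum[of i _ "\<lambda>i. \<Sum>j\<in>Basis. 2 * K i j / m0"] sum_nonneg) auto
      finally show ?thesis .
    qed
    finally show ?thesis by (simp add: \<rho>_def mult_right_mono)
  qed simp
  moreover have "0 \<le> C" unfolding C_def using K m0 by (intro sum_nonneg) auto
  ultimately show ?thesis using \<gamma> by blast
qed

end

section \<open>Translating to a thin point, and continuity of energy and height in that
  point\<close>

subsection \<open>Dependence on the center\<close>

context gauge_cone
begin

text \<open>The sphere fits between the balls of radius \<rho> and t > \<rho>, whose volumes
  \<open>m1 * \<rho> ^ d\<close> and \<open>m1 * t ^ d\<close> merge as t decreases to \<rho>. It is
  the set on which indicators of varying gauge balls may fail to converge.\<close>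

lemma null_S:
  assumes "0 < \<rho>"
  shows "S \<rho> \<in> null_sets lborel"
proof -
  have SM: "S \<rho> \<in> sets borel" using S_compact[OF assms] by (simp add: borel_compact)
  have mE: "measure lborel (E t) = m1 * t ^ d" if "0 < t" for t
    using I_const[OF that, of 1] emeasure_E_finite[of t] by (simp add: I_def set_lebesgue_integral_def)
  have fin: "emeasure lborel (S \<rho>) < \<infinity>" using S_compact[OF assms] by (rule emeasure_compact_finite)
  have "measure lborel (S \<rho>) \<le> m1 * t ^ d - m1 * \<rho> ^ d" if t: "\<rho> < t" for t
  proof -
    have "measure lborel (S \<rho>) + measure lborel (E \<rho>) = measure lborel (S \<rho> \<union> E \<rho>)"
      using fin emeasure_E_finite[of \<rho>] SM E_borel[of \<rho>]
      by (intro measure_Union[symmetric]) (auto simp: S_def E_def)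
    also have "\<dots> \<le> measure lborel (E t)"
      using t assms SM emeasure_E_finite[of t] E_borel[of t] E_borel[of \<rho>]
      by (intro measure_mono_fmeasurable) (auto simp: fmeasurable_def S_def E_def)
    finally show ?thesis using mE[of \<rho>] mE[of t] assms t by simp
  qed
  then have "\<forall>\<^sub>F t in at_right \<rho>. measure lborel (S \<rho>) \<le> m1 * t ^ d - m1 * \<rho> ^ d"
    by (simp add: eventually_at_filter)
  moreover have "((\<lambda>t. m1 * t ^ d - m1 * \<rho> ^ d) \<longlongrightarrow> m1 * \<rho> ^ d - m1 * \<rho> ^ d) (at_right \<rho>)"
    by (intro tendsto_intros)
  ultimately have "measure lborel (S \<rho>) \<le> m1 * \<rho> ^ d - m1 * \<rho> ^ d"
    by (intro tendsto_lowerbound) auto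
  then have "measure lborel (S \<rho>) = 0" using measure_nonneg[of lborel "S \<rho>"] by linarith
  then have "emeasure lborel (S \<rho>) = 0" using fin by (simp add: emeasure_eq_ennreal_measure)
  then show ?thesis using SM by (simp add: null_sets_def)
qed

end

context thin_obstacle
begin

lemma gauge: "z \<in> Hb \<Longrightarrow> gauge_cone P (A z) (B z) (CARD('n) + 1)"
proof -
  assume z: "z \<in> Hb"
  show ?thesis
  proof (rule gauge_cone.intro)
  show "CARD('n) + 1 = DIM('n pt)" by simp
  show "closed P" by (rule closed_P)
  show "t *\<^sub>R x \<in> P" if "x \<in> P" "0 \<le> t" for x t using that by (simp add: P_def)
  show "linear (A z)" by (rule A_lin)
  show "linear (B z)" by (rule B_props(1)[OF z])
  show "A z x \<bullet> y = x \<bullet> A z y" for x y by (rule A_sym[OF z])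
  show "A z (B z x) = x" for x by (rule B_props(2)[OF z])
  show "x \<bullet> x \<le> 2 * (B z x \<bullet> x)" for x by (rule B_props(4)[OF z])
  show "B z x \<bullet> x \<le> 2 * (x \<bullet> x)" for x by (rule B_props(5)[OF z])
  qed
qed

text \<open>By (A1) and symmetry only the diagonal entry of the last row survives on the thin set,
  which transfers the sign and complementarity conditions from the normal derivative to the
  flux.\<close>

lemma flux_normal:
  assumes "x \<in> thin_ball 1"
  shows "snd (A x (g x)) = a (0, 1) (0, 1) x * partial_within Hb (0, 1) w x"
proof -
  have b: "(0 :: real^'n, 1 :: real) \<in> Basis" by (simp add: Basis_prod_def)
  have off: "a (0, 1) j x = 0" if j: "j \<in> Basis" "j \<noteq> (0, 1)" for j :: "'n pt"
  proof -
    obtain k where k: "j = (axis k 1, 0)" using j by (auto simp: Basis_prod_def Basis_vec_def)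
    have "a j (0, 1) x = 0" using coeffs assms unfolding k admissible_coeffs_def by blast
    moreover have "a (0, 1) j x = a j (0, 1) x"
      using coeffs assms thin_sub_Hb b j unfolding admissible_coeffs_def Hb_def by blast
    ultimately show ?thesis by simp
  qed
  have "snd (A x (g x)) = A x (g x) \<bullet> (0, 1)" by (simp add: inner_prod_def)
  also have "\<dots> = (\<Sum>j\<in>Basis. a (0, 1) j x * (g x \<bullet> j))"
    unfolding A_def coeff_map_def using inner_sum_left_Basis[OF b, of "\<lambda>i. \<Sum>j\<in>Basis. a i j x * (g x \<bullet> j)"] by simp
  also have "\<dots> = (\<Sum>j\<in>{(0, 1)}. a (0, 1) j x * (g x \<bullet> j))"
    using b off by (intro sum.mono_neutral_right) auto
  also have "\<dots> = a (0, 1) (0, 1) x * partial_within Hb (0, 1) w x"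
    by (simp add: g_component[OF b])
  finally show ?thesis .
qed

lemma thin_conditions:
  assumes x: "x \<in> thin_ball 1"
  shows "0 \<le> w x \<and> snd (A x (g x)) \<le> 0 \<and> w x * snd (A x (g x)) = 0"
proof -
  have b: "(0 :: real^'n, 1 :: real) \<in> Basis" by (simp add: Basis_prod_def)
  have s: "w x \<ge> 0" "- partial_within Hb (0, 1) w x \<ge> 0" "w x * partial_within Hb (0, 1) w x = 0"
    using sol x unfolding thin_obstacle_solution_def Hb_def by blast+
  have "0 \<le> A x (0, 1) \<bullet> (0, 1)"
    using A_bounds(1)[of x "(0, 1)"] x thin_sub_Hb by (auto simp: inner_prod_def)
  also have "A x (0, 1) \<bullet> (0, 1) = (\<Sum>j\<in>Basis. a (0, 1) j x * ((0, 1) \<bullet> j))"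
    unfolding A_def coeff_map_def using inner_sum_left_Basis[OF b, of "\<lambda>i. \<Sum>j\<in>Basis. a i j x * ((0, 1) \<bullet> j)"] by simp
  also have "\<dots> = a (0, 1) (0, 1) x"
  proof -
    have "(\<Sum>j\<in>Basis. a (0, 1) j x * ((0, 1) \<bullet> j)) = (\<Sum>j\<in>{(0, 1)}. a (0, 1) j x * ((0, 1) \<bullet> j))"
      using b inner_not_same_Basis[OF b] by (intro sum.mono_neutral_right) auto
    then show ?thesis by (simp add: inner_prod_def)
  qed
  finally have "0 \<le> a (0, 1) (0, 1) x" .
  then show ?thesis using s unfolding flux_normal[OF x] by (auto simp: mult_nonneg_nonpos)
qed

lemma weak_ineq:
  assumes \<phi>: "\<And>x. x \<in> P \<Longrightarrow> (\<phi> has_derivative (\<lambda>h. h \<bullet> \<psi> x)) (at x within P)"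
    and \<psi>: "continuous_on P \<psi>"
    and C: "compact C" "C \<subseteq> Hb" "\<And>x. x \<in> P - C \<Longrightarrow> \<phi> x = 0" "\<And>x. x \<in> P - C \<Longrightarrow> \<psi> x = 0"
    and sign: "\<And>x. x \<in> C \<Longrightarrow> snd x = 0 \<Longrightarrow> \<phi> x * snd (A x (g x)) \<le> 0"
  shows "0 \<le> (LINT x:Hb|lborel. A x (g x) \<bullet> \<psi> x)"
  unfolding Hb_def
proof (rule weak_ineq_up_to_boundary[OF _ _ \<phi>[unfolded P_def] \<psi>[unfolded P_def] C(1) C(2)[unfolded Hb_def]
      C(3)[unfolded P_def] C(4)[unfolded P_def] sign])
  show "continuous_on (half_ball 0 1) (\<lambda>x. A x (g x))"
    unfolding Hb_def[symmetric] by (intro A_cont g_cont continuous_on_id) auto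
  fix \<phi> :: "'n pt \<Rightarrow> real" assume "test_fun (interior (half_ball 0 1)) \<phi>"
  then have "(LINT x|lebesgue_on (interior Hb). (\<Sum>i\<in>Basis. \<Sum>j\<in>Basis.
              a i j x * partial_within Hb j w x * partial_within UNIV i \<phi> x)) = 0"
    using sol unfolding thin_obstacle_solution_def weak_solution_def Hb_def by blast
  moreover have "(A x (g x) \<bullet> i) * partial_within UNIV i \<phi> x =
      (\<Sum>j\<in>Basis. a i j x * partial_within Hb j w x * partial_within UNIV i \<phi> x)" if "i \<in> Basis" for i x
    unfolding A_def coeff_map_def inner_sum_left_Basis[OF that] by (simp add: g_component sum_distrib_right)
  ultimately show "(LINT x|lebesgue_on (interior (half_ball 0 1)). (\<Sum>i\<in>Basis. (A x (g x) \<bullet> i) * partial_within UNIV i \<phi> x)) = 0"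
    by (simp add: Hb_def)
qed

lemma A_close:
  assumes C: "0 \<le> C" and h: "\<And>i j. i \<in> Basis \<Longrightarrow> j \<in> Basis \<Longrightarrow> \<bar>a i j x - a i j z\<bar> \<le> C" and z: "z \<in> Hb"
  shows "\<bar>A x u \<bullet> v - A z u \<bullet> v\<bar> \<le> 4 * (real CARD('n) + 1) ^ 2 * C * (sqrt (A z u \<bullet> u) * sqrt (A z v \<bullet> v))"
proof -
  have n: "norm u \<le> 2 * sqrt (A z u \<bullet> u)" for u
  proof (rule power2_le_imp_le)
    have "u \<bullet> u \<le> 2 * (A z u \<bullet> u)" using A_bounds(1)[OF z, of u] by simp
    moreover have "0 \<le> A z u \<bullet> u" using A_bounds(1)[OF z, of u] inner_ge_zero[of u] by linarith
    ultimately show "(norm u)\<^sup>2 \<le> (2 * sqrt (A z u \<bullet> u))\<^sup>2"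
      by (simp add: power_mult_distrib power2_norm_eq_inner)
    show "0 \<le> 2 * sqrt (A z u \<bullet> u)" using \<open>0 \<le> A z u \<bullet> u\<close> by simp
  qed
  have "A x u \<bullet> v - A z u \<bullet> v = (\<Sum>i\<in>Basis. \<Sum>j\<in>Basis. (a i j x - a i j z) * (u \<bullet> j) * (v \<bullet> i))"
    by (simp add: A_def coeff_map_inner sum_subtractf left_diff_distrib)
  also have "\<bar>\<dots>\<bar> \<le> (\<Sum>i\<in>(Basis :: 'n pt set). \<Sum>j\<in>(Basis :: 'n pt set). C * norm u * norm v)"
  proof (intro order_trans[OF sum_abs] sum_mono)
    fix i j :: "'n pt" assume ij: "i \<in> Basis" "j \<in> Basis"
    show "\<bar>(a i j x - a i j z) * (u \<bullet> j) * (v \<bullet> i)\<bar> \<le> C * norm u * norm v"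
      unfolding abs_mult using ij h C by (intro mult_mono Basis_le_norm mult_nonneg_nonneg) auto
  qed
  also have "\<dots> = (real CARD('n) + 1) ^ 2 * C * (norm u * norm v)" by (simp add: power2_eq_square add.commute)
  also have "\<dots> \<le> (real CARD('n) + 1) ^ 2 * C * ((2 * sqrt (A z u \<bullet> u)) * (2 * sqrt (A z v \<bullet> v)))"
    using C n[of u] n[of v] order_trans[OF norm_ge_zero n[of u]] by (intro mult_left_mono mult_mono mult_nonneg_nonneg) auto
  finally show ?thesis by (simp add: mult_ac)
qed

text \<open>\<gamma> and \<open>C0\<close> do not depend on the center. The radius (1 - norm z) / 8
  ensures norm z + 3 * norm y < 1 on the gauge ball, as required by
  \<open>coefficient_holder\<close>, because the Euclidean norm is at most twice the gauge.\<close>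

lemma center_exists:
  "\<exists>\<gamma> C0. 0 < \<gamma> \<and> 0 \<le> C0 \<and> (\<forall>z\<in>thin_ball 1. thin_center P (A z) (B z) (CARD('n) + 1) (\<lambda>y. A (z + y)) (\<lambda>y. w (z + y)) (\<lambda>y. g (z + y))
     T (\<lambda>y. snd (A (z + y) (g (z + y)))) ((1 - norm z) / 8) \<gamma> C0)"
proof -
  obtain \<gamma> C where \<gamma>: "0 < \<gamma>" and C: "0 \<le> C" and H: "\<And>i j z x. i \<in> Basis \<Longrightarrow> j \<in> Basis \<Longrightarrow> z \<in> thin_ball 1 \<Longrightarrow> x \<in> P \<Longrightarrow>
     norm z + 3 * norm (x - z) < 1 \<Longrightarrow> \<bar>a i j x - a i j z\<bar> \<le> C * norm (x - z) powr \<gamma>"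
    using coefficient_holder by blast
  define C0 where "C0 = 4 * (real CARD('n) + 1) ^ 2 * (C * 2 powr \<gamma>)"
  have C0: "0 \<le> C0" using C by (simp add: C0_def)
  show ?thesis
  proof (rule exI[where x=\<gamma>], rule exI[where x=C0], intro conjI ballI \<gamma> C0)
    fix z :: "'n pt" assume z: "z \<in> thin_ball 1"
    have zH: "z \<in> Hb" using z thin_sub_Hb by blast
    have sz: "snd z = 0" "norm z < 1" using z by (auto simp: thin_ball_eq T_def)
    interpret G: gauge_cone P "A z" "B z" "CARD('n) + 1" by (rule gauge[OF zH])
    define R0 where "R0 = (1 - norm z) / 8"
    have R0: "0 < R0" using sz by (simp add: R0_def)
    have DB: "y \<in> P" "norm y \<le> 2 * G.r y" "norm z + 3 * norm y < 1" "z + y \<in> Hb" if "y \<in> G.D_ball R0" for y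
    proof -
      show y: "y \<in> P" "norm y \<le> 2 * G.r y" using that G.norm_le_r by (auto simp: G.D_ball_def)
      then have "norm y < 2 * R0" using that by (auto simp: G.D_ball_def)
      then show n: "norm z + 3 * norm y < 1" unfolding R0_def using sz(2) by argo
      have "norm (z + y) < 1" using norm_triangle_ineq[of z y] n norm_ge_zero[of y] by linarith
      then show "z + y \<in> Hb" using y sz by (simp add: Hb_eq P_def)
    qed
    have shiftP: "(\<lambda>y. z + y) ` P \<subseteq> P" "(\<lambda>x. x - z) ` P \<subseteq> P" using sz by (auto simp: P_def)
    have cshift: "continuous_on X (\<lambda>y. z + y)" for X by (intro continuous_intros)
    show "thin_center P (A z) (B z) (CARD('n) + 1) (\<lambda>y. A (z + y)) (\<lambda>y. w (z + y)) (\<lambda>y. g (z + y))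
     T (\<lambda>y. snd (A (z + y) (g (z + y)))) ((1 - norm z) / 8) \<gamma> C0"
      unfolding R0_def[symmetric]
    proof (intro thin_center.intro thin_center_axioms.intro G.gauge_cone_axioms)
      fix y assume y: "y \<in> G.D_ball R0"
      have "(w has_derivative (\<lambda>h. h \<bullet> g (z + y))) (at (z + y) within P)"
      proof -
        have "at (z + y) within P = at (z + y) within Hb"
          by (rule at_within_nhd[of _ "ball 0 1"]) (use DB[OF y] in \<open>auto simp: Hb_eq\<close>)
        then show ?thesis using w_has_derivative[OF DB(4)[OF y]] by simp
      qed
      then have "(w has_derivative (\<lambda>h. h \<bullet> g (z + y))) (at (z + y) within (\<lambda>y. z + y) ` P)"
        using shiftP(1) by (rule has_derivative_subset)
      moreover have "((\<lambda>y. z + y) has_derivative (\<lambda>h. h)) (at y within P)" by (auto intro!: derivative_eq_intros)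
      ultimately show "((\<lambda>y. w (z + y)) has_derivative (\<lambda>h. h \<bullet> g (z + y))) (at y within P)"
        using has_derivative_in_compose[of "\<lambda>y. z + y" "\<lambda>h. h" y P w] by simp
    next
      show "continuous_on (G.D_ball R0) (\<lambda>y. g (z + y))"
        by (rule continuous_on_compose2[OF g_cont cshift]) (use DB(4) in auto)
      show "continuous_on X (\<lambda>y. A (z + y) (V y))" if "X \<subseteq> G.D_ball R0" "continuous_on X V" for X V
        by (rule A_cont[OF cshift that(2)]) (use DB(4) that(1) in auto)
      show "linear (A (z + y))" for y by (rule A_lin)
      show "A (z + y) u \<bullet> v = u \<bullet> A (z + y) v" if "y \<in> G.D_ball R0" for y u v
        by (rule A_sym[OF DB(4)[OF that]])
      show "0 \<le> A (z + y) u \<bullet> u" if "y \<in> G.D_ball R0" for y u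
        using A_bounds(1)[OF DB(4)[OF that], of u] inner_ge_zero[of u] by linarith
      show "0 \<le> A z u \<bullet> u" for u
        using A_bounds(1)[OF zH, of u] inner_ge_zero[of u] by linarith
      show "\<bar>A (z + y) u \<bullet> v - A z u \<bullet> v\<bar> \<le> C0 * G.r y powr \<gamma> * (sqrt (A z u \<bullet> u) * sqrt (A z v \<bullet> v))"
        if y: "y \<in> G.D_ball R0" for y u v
      proof -
        have "\<bar>a i j (z + y) - a i j z\<bar> \<le> C * 2 powr \<gamma> * G.r y powr \<gamma>" if "i \<in> Basis" "j \<in> Basis" for i j
        proof -
          have "\<bar>a i j (z + y) - a i j z\<bar> \<le> C * norm y powr \<gamma>"
            using H[OF that z, of "z + y"] DB[OF y] sz by (simp add: P_def)
          also have "\<dots> \<le> C * (2 * G.r y) powr \<gamma>"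
            using C DB(2)[OF y] \<gamma> by (intro mult_left_mono powr_mono2) auto
          finally show ?thesis by (simp add: powr_mult mult.assoc)
        qed
        from A_close[OF _ this zH, of u v] C show ?thesis by (simp add: C0_def mult_ac)
      qed
      show "t *\<^sub>R y \<in> T" if "y \<in> T" for y t using that by (simp add: T_def)
      show "0 \<le> w (z + y) \<and> snd (A (z + y) (g (z + y))) \<le> 0 \<and> w (z + y) * snd (A (z + y) (g (z + y))) = 0"
        if "y \<in> T" "y \<in> G.D_ball R0" for y
        using thin_conditions[of "z + y"] that DB(4)[OF that(2)] sz by (auto simp: thin_ball_eq T_def Hb_eq)
      fix \<phi> \<psi> \<rho>
      assume \<rho>: "0 < \<rho>" "\<rho> < R0"
        and d\<phi>: "\<And>y. y \<in> P \<Longrightarrow> (\<phi> has_derivative (\<lambda>h. h \<bullet> \<psi> y)) (at y within P)"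
        and \<psi>: "continuous_on P \<psi>"
        and zero: "\<And>y. y \<in> P \<Longrightarrow> \<rho> \<le> G.r y \<Longrightarrow> \<phi> y = 0 \<and> \<psi> y = 0"
        and sgn: "\<And>y. y \<in> T \<Longrightarrow> y \<in> G.D_ball R0 \<Longrightarrow> \<phi> y * snd (A (z + y) (g (z + y))) \<le> 0"
      define K where "K = {y \<in> P. G.r y \<le> \<rho>}"
      have KD: "K \<subseteq> G.D_ball R0" using \<rho> by (auto simp: K_def G.D_ball_def)
      have "0 \<le> (LINT x:Hb|lborel. A x (g x) \<bullet> \<psi> (x - z))"
      proof (rule weak_ineq)
        fix x assume x: "x \<in> P"
        have "(\<phi> has_derivative (\<lambda>h. h \<bullet> \<psi> (x - z))) (at (x - z) within (\<lambda>x. x - z) ` P)"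
          by (rule has_derivative_subset[OF d\<phi> shiftP(2)]) (use x shiftP(2) in auto)
        moreover have "((\<lambda>x. x - z) has_derivative (\<lambda>h. h)) (at x within P)" by (auto intro!: derivative_eq_intros)
        ultimately show "((\<lambda>x. \<phi> (x - z)) has_derivative (\<lambda>h. h \<bullet> \<psi> (x - z))) (at x within P)"
          using has_derivative_in_compose[of "\<lambda>x. x - z" "\<lambda>h. h" x P \<phi>] by simp
      next
        show "continuous_on P (\<lambda>x. \<psi> (x - z))"
          by (rule continuous_on_compose2[OF \<psi>]) (use shiftP(2) in \<open>auto intro!: continuous_intros\<close>)
        show "compact ((\<lambda>y. z + y) ` K)" unfolding K_def by (intro compact_continuous_image G.compact_gauge_ball cshift)
        show "(\<lambda>y. z + y) ` K \<subseteq> Hb" using KD DB(4) by auto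
        have out: "\<rho> \<le> G.r (x - z)" "x - z \<in> P" if "x \<in> P - (\<lambda>y. z + y) ` K" for x
        proof -
          show xz: "x - z \<in> P" using that shiftP(2) by auto
          show "\<rho> \<le> G.r (x - z)"
          proof (rule ccontr)
            assume "\<not> \<rho> \<le> G.r (x - z)"
            then have "x - z \<in> K" using xz by (simp add: K_def)
            then have "z + (x - z) \<in> (\<lambda>y. z + y) ` K" by (rule imageI)
            then show False using that by simp
          qed
        qed
        show "\<phi> (x - z) = 0" "\<psi> (x - z) = 0" if "x \<in> P - (\<lambda>y. z + y) ` K" for x
          using zero out[OF that] by auto
        show "\<phi> (x - z) * snd (A x (g x)) \<le> 0" if xK: "x \<in> (\<lambda>y. z + y) ` K" and x0: "snd x = 0" for x
        proof -
          obtain y where y: "x = z + y" "y \<in> K" using xK by (rule imageE)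
          then have "y \<in> T" using x0 sz by (simp add: T_def)
          then show ?thesis using sgn[of y] y KD by auto
        qed
      qed
      also have "(LINT x:Hb|lborel. A x (g x) \<bullet> \<psi> (x - z)) =
          (\<integral>y. indicat_real Hb (z + y) *\<^sub>R (A (z + y) (g (z + y)) \<bullet> \<psi> y) \<partial>lborel)"
        unfolding set_lebesgue_integral_def
        using lborel_integral_affine[of 1 "\<lambda>x. indicat_real Hb x *\<^sub>R (A x (g x) \<bullet> \<psi> (x - z))" z] by simp
      \<comment> \<open>The domains agree up to the zero set of \<psi> and the origin, which is left
        out of \<open>G.E\<close> and is a null set.\<close>
      also have "\<dots> = G.I (\<lambda>y. A (z + y) (g (z + y)) \<bullet> \<psi> y) R0"
        unfolding G.I_def set_lebesgue_integral_def
      proof (rule integral_discrete_difference[where X="{0}"])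
        fix y :: "'n pt" assume "y \<in> space lborel" "y \<notin> {0}"
        then have y0: "y \<noteq> 0" by simp
        show "indicat_real Hb (z + y) *\<^sub>R (A (z + y) (g (z + y)) \<bullet> \<psi> y) = indicat_real (G.E R0) y *\<^sub>R (A (z + y) (g (z + y)) \<bullet> \<psi> y)"
        proof (cases "y \<in> P \<and> G.r y < R0")
          case True
          then have "y \<in> G.E R0" "z + y \<in> Hb" using y0 DB(4)[of y] by (auto simp: G.E_def G.r_pos_iff G.D_ball_def)
          then show ?thesis by simp
        next
          case False
          then have "y \<notin> G.E R0" by (auto simp: G.E_def)
          moreover have "z + y \<notin> Hb \<or> \<psi> y = 0"
            using False zero[of y] \<rho> sz by (auto simp: Hb_eq P_def)
          ultimately show ?thesis by auto
        qed
      qed auto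
      finally show "0 \<le> G.I (\<lambda>y. A (z + y) (g (z + y)) \<bullet> \<psi> y) R0" .
    qed (use R0 \<gamma> C0 in auto)
  qed
qed

text \<open>This and the next two definitions write the gauge, energy and height with the center as
  a variable; in an interpretation of \<open>thin_center\<close> the center is fixed, while
  continuity in it is what is wanted.\<close>

definition gauge_norm :: "'n pt \<Rightarrow> 'n pt \<Rightarrow> real" where
  "gauge_norm z y = sqrt (B z y \<bullet> y)"

definition En :: "real \<Rightarrow> 'n pt \<Rightarrow> real" where
  "En R z = (LINT y:{y \<in> P. 0 < gauge_norm z y \<and> gauge_norm z y < R}|lborel. A z (g (z + y)) \<bullet> g (z + y))"

definition Ht :: "real \<Rightarrow> 'n pt \<Rightarrow> real" where
  "Ht R z = real (CARD('n) + 1) * R ^ (CARD('n)) * (LINT y:{y \<in> P. 0 < gauge_norm z y \<and> gauge_norm z y < 1}|lborel.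
      (w (z + (R / gauge_norm z y) *\<^sub>R y))\<^sup>2)"

definition centers :: "real \<Rightarrow> 'n pt set" where
  "centers R = {z \<in> thin_ball 1. R < (1 - norm z) / 8}"

text \<open>The resolvent identity writes B(u) - B(z) as B(u) (A(z) - A(u)) B(z), and ellipticity
  bounds B(u) by 2, so continuity of \<open>A\<close> is inherited by its inverse.\<close>

lemma B_tendsto:
  assumes u: "u \<longlonglongrightarrow> z" "\<And>k. u k \<in> Hb" "z \<in> Hb"
  shows "(\<lambda>k. B (u k) y) \<longlonglongrightarrow> B z y"
proof -
  have nB: "norm (B x v) \<le> 2 * norm v" if x: "x \<in> Hb" for x v
  proof -
    have "1/2 * (norm (B x v))\<^sup>2 \<le> norm v * norm (B x v)"
      using A_bounds(1)[OF x, of "B x v"] B_props(2)[OF x, of v] norm_cauchy_schwarz[of v "B x v"]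
      by (simp add: power2_norm_eq_inner)
    then show ?thesis by (cases "B x v = 0") (auto simp: power2_eq_square)
  qed
  have diff: "B (u k) y - B z y = B (u k) (A z (B z y) - A (u k) (B z y))" for k
    using B_props(1-3)[OF u(2)[of k]] B_props(2)[OF u(3)]
    by (simp add: linear_diff[OF B_props(1)[OF u(2)]])
  have "continuous_on Hb (\<lambda>x. A x (B z y))" by (intro A_cont continuous_on_id continuous_on_const) auto
  then have "(\<lambda>k. A (u k) (B z y)) \<longlonglongrightarrow> A z (B z y)"
    using u by (intro continuous_on_tendsto_compose[of Hb "\<lambda>x. A x (B z y)" u z sequentially]) auto
  then have "(\<lambda>k. 2 * norm (A z (B z y) - A (u k) (B z y))) \<longlonglongrightarrow> 2 * norm (A z (B z y) - A z (B z y))"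
    by (intro tendsto_intros)
  then have "(\<lambda>k. 2 * norm (A z (B z y) - A (u k) (B z y))) \<longlonglongrightarrow> 0" by simp
  then have "(\<lambda>k. B (u k) y - B z y) \<longlonglongrightarrow> 0"
    by (rule Lim_null_comparison[rotated]) (use nB[OF u(2)] in \<open>simp add: diff\<close>)
  then show ?thesis by (simp add: LIM_zero_iff)
qed

text \<open>Dominated convergence with a moving domain: off the limiting gauge sphere the indicators
  eventually agree with the limiting one, and that sphere is null by \<open>null_S\<close>.\<close>

lemma integral_tendsto_gauge:
  fixes f :: "'n pt \<Rightarrow> 'n pt \<Rightarrow> real"
  assumes R: "0 < R" and u: "u \<longlonglongrightarrow> z" "\<And>k. u k \<in> thin_ball 1" "z \<in> thin_ball 1"
    and meas: "\<And>x. x \<in> insert z (range u) \<Longrightarrow> set_integrable lborel {y \<in> P. 0 < gauge_norm x y \<and> gauge_norm x y < R} (f x)"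
    and bound: "\<And>k y. y \<in> P \<Longrightarrow> 0 < gauge_norm (u k) y \<Longrightarrow> gauge_norm (u k) y < R \<Longrightarrow> \<bar>f (u k) y\<bar> \<le> M"
    and lim: "\<And>y. y \<in> P \<Longrightarrow> 0 < gauge_norm z y \<Longrightarrow> gauge_norm z y < R \<Longrightarrow>
       (\<lambda>k. gauge_norm (u k) y) \<longlonglongrightarrow> gauge_norm z y \<Longrightarrow> (\<lambda>k. f (u k) y) \<longlonglongrightarrow> f z y"
  shows "(\<lambda>k. LINT y:{y \<in> P. 0 < gauge_norm (u k) y \<and> gauge_norm (u k) y < R}|lborel. f (u k) y) \<longlonglongrightarrow>
     (LINT y:{y \<in> P. 0 < gauge_norm z y \<and> gauge_norm z y < R}|lborel. f z y)"
proof -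
  have H: "u k \<in> Hb" "z \<in> Hb" for k using u thin_sub_Hb by auto
  define X where "X x = {y \<in> P. 0 < gauge_norm x y \<and> gauge_norm x y < R}" for x
  have gpos: "0 < gauge_norm x y \<longleftrightarrow> y \<noteq> 0" and gle: "norm y \<le> 2 * gauge_norm x y" if "x \<in> Hb" for x y
  proof -
    interpret G: gauge_cone P "A x" "B x" "CARD('n) + 1" by (rule gauge[OF that])
    show "0 < gauge_norm x y \<longleftrightarrow> y \<noteq> 0" "norm y \<le> 2 * gauge_norm x y"
      using G.r_pos_iff[of y] G.norm_le_r[of y] by (auto simp: G.r_def gauge_norm_def)
  qed
  have null: "{y \<in> P. gauge_norm z y = R} \<in> null_sets lborel"
  proof -
    interpret G: gauge_cone P "A z" "B z" "CARD('n) + 1" by (rule gauge[OF H(2)])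
    show ?thesis using G.null_S[OF R] by (simp add: G.S_def G.r_def gauge_norm_def)
  qed
  have gl: "(\<lambda>k. gauge_norm (u k) y) \<longlonglongrightarrow> gauge_norm z y" for y
    unfolding gauge_norm_def by (intro tendsto_intros B_tendsto u(1) H)
  show ?thesis
    unfolding set_lebesgue_integral_def X_def[symmetric]
  proof (rule integral_dominated_convergence[where w="\<lambda>y. indicat_real (cball 0 (2 * R)) y *\<^sub>R \<bar>M\<bar>"])
    show "(\<lambda>y. indicat_real (X z) y *\<^sub>R f z y) \<in> borel_measurable lborel"
      using meas[of z] unfolding set_integrable_def X_def[symmetric] by (intro borel_measurable_integrable) auto
    show "(\<lambda>y. indicat_real (X (u k)) y *\<^sub>R f (u k) y) \<in> borel_measurable lborel" for k
      using meas[of "u k"] unfolding set_integrable_def X_def[symmetric] by (intro borel_measurable_integrable) auto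
    show "integrable lborel (\<lambda>y :: 'n pt. indicat_real (cball 0 (2 * R)) y *\<^sub>R \<bar>M\<bar>)"
      by (intro borel_integrable_compact) auto
    show "AE y in lborel. norm (indicat_real (X (u k)) y *\<^sub>R f (u k) y) \<le> indicat_real (cball 0 (2 * R)) y *\<^sub>R \<bar>M\<bar>" for k
    proof (intro AE_I2)
      fix y
      show "norm (indicat_real (X (u k)) y *\<^sub>R f (u k) y) \<le> indicat_real (cball 0 (2 * R)) y *\<^sub>R \<bar>M\<bar>"
      proof (cases "y \<in> X (u k)")
        case True
        then have "norm y \<le> 2 * R" "\<bar>f (u k) y\<bar> \<le> M" using gle[OF H(1), of y k] bound[of y k] by (auto simp: X_def)
        then show ?thesis using True by simp
      qed simp
    qed
    have "AE y in lborel. y \<notin> {y \<in> P. gauge_norm z y = R}" by (rule AE_not_in[OF null])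
    then show "AE y in lborel. (\<lambda>k. indicat_real (X (u k)) y *\<^sub>R f (u k) y) \<longlonglongrightarrow> indicat_real (X z) y *\<^sub>R f z y"
    proof eventually_elim
      case (elim y)
      consider "y \<notin> P" | "y = 0" | "y \<in> P" "y \<noteq> 0" "gauge_norm z y < R" | "R < gauge_norm z y"
        using elim by fastforce
      then show ?case
      proof cases
        case 1
        then show ?thesis by (simp add: X_def)
      next
        case 2
        then have "y \<notin> X (u k)" "y \<notin> X z" for k using gpos[OF H(1)[of k], of y] gpos[OF H(2), of y] by (auto simp: X_def)
        then show ?thesis by simp
      next
        case 3
        have yz: "y \<in> X z" using 3 gpos[OF H(2), of y] by (simp add: X_def)
        have "eventually (\<lambda>k. gauge_norm (u k) y < R) sequentially" using gl 3(3) by (rule order_tendstoD)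
        then have "eventually (\<lambda>k. indicat_real (X (u k)) y *\<^sub>R f (u k) y = f (u k) y) sequentially"
          by eventually_elim (use 3 gpos[OF H(1)] in \<open>simp add: X_def\<close>)
        moreover have "(\<lambda>k. f (u k) y) \<longlonglongrightarrow> f z y" using lim[of y] 3 yz gl by (simp add: X_def)
        ultimately have "(\<lambda>k. indicat_real (X (u k)) y *\<^sub>R f (u k) y) \<longlonglongrightarrow> f z y"
          by (subst tendsto_cong)
        then show ?thesis using yz by simp
      next
        case 4
        have "eventually (\<lambda>k. R < gauge_norm (u k) y) sequentially" using gl 4 by (rule order_tendstoD)
        then have "eventually (\<lambda>k. indicat_real (X (u k)) y *\<^sub>R f (u k) y = 0) sequentially"
          by eventually_elim (simp add: X_def)
        then show ?thesis using 4 by (simp add: X_def tendsto_eventually)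
      qed
    qed
  qed
qed

lemma bounded_on_half_ball:
  fixes f :: "'n pt \<Rightarrow> 'b::real_normed_vector"
  assumes "continuous_on Hb f" "s < 1"
  shows "\<exists>M. \<forall>x\<in>P. norm x \<le> s \<longrightarrow> norm (f x) \<le> M"
proof -
  have "compact (f ` (P \<inter> cball 0 s))"
    using assms by (intro compact_continuous_image closed_Int_compact closed_P compact_cball continuous_on_subset[OF assms(1)])
      (auto simp: Hb_eq)
  then have "bounded (f ` (P \<inter> cball 0 s))" by (rule compact_imp_bounded)
  then obtain M where M: "\<forall>v\<in>f ` (P \<inter> cball 0 s). norm v \<le> M" unfolding bounded_iff by blast
  show ?thesis
  proof (intro exI[where x=M] ballI impI)
    fix x assume "x \<in> P" "norm x \<le> s"
    then have "x \<in> P \<inter> cball 0 s" by (simp del: split_paired_All)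
    then show "norm (f x) \<le> M" using M by blast
  qed
qed

lemma w_cont: "continuous_on Hb w"
  by (rule grad_imp_continuous_on[OF w_has_derivative])

lemma En_Ht_continuous:
  assumes R: "0 < R"
  shows "continuous_on (centers R) (En R)" "continuous_on (centers R) (Ht R)"
proof -
  have cen: "x \<in> thin_ball 1" "x \<in> Hb" "norm x < 1 - 8 * R" "snd x = 0" if "x \<in> centers R" for x
    using that thin_sub_Hb by (auto simp: centers_def thin_ball_eq T_def field_simps)
  \<comment> \<open>A gauge radius \<open>R\<close> allows Euclidean displacements up to 2 * R;
    since |x| < 1 - 8 * R this leaves a distance 6 * R to the spherical boundary, where
    \<open>w\<close> and its gradient need not be bounded.\<close>
  have inside: "x + v \<in> P" "norm (x + v) \<le> 1 - 6 * R" "x + v \<in> Hb" if "x \<in> centers R" "v \<in> P" "norm v \<le> 2 * R" for x v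
  proof -
    show 1: "x + v \<in> P" using that cen[OF that(1)] by (simp add: P_def)
    show 2: "norm (x + v) \<le> 1 - 6 * R" using norm_triangle_ineq[of x v] cen[OF that(1)] that(3) by linarith
    show "x + v \<in> Hb" using 1 2 R by (simp add: Hb_eq)
  qed
  obtain Mg where Mg: "\<And>x. x \<in> P \<Longrightarrow> norm x \<le> 1 - 6 * R \<Longrightarrow> norm (g x) \<le> Mg"
    using bounded_on_half_ball[OF g_cont, of "1 - 6 * R"] R by auto
  obtain Mw where Mw: "\<And>x. x \<in> P \<Longrightarrow> norm x \<le> 1 - 6 * R \<Longrightarrow> norm (w x) \<le> Mw"
    using bounded_on_half_ball[OF w_cont, of "1 - 6 * R"] R by auto
  obtain \<gamma> C0 where cx: "\<And>z. z \<in> thin_ball 1 \<Longrightarrow> thin_center P (A z) (B z) (CARD('n) + 1) (\<lambda>y. A (z + y)) (\<lambda>y. w (z + y)) (\<lambda>y. g (z + y))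
     T (\<lambda>y. snd (A (z + y) (g (z + y)))) ((1 - norm z) / 8) \<gamma> C0"
    using center_exists by blast
  have gle: "norm y \<le> 2 * gauge_norm x y" if "x \<in> Hb" for x y
  proof -
    interpret G: gauge_cone P "A x" "B x" "CARD('n) + 1" by (rule gauge[OF that])
    show ?thesis using G.norm_le_r[of y] by (simp add: G.r_def gauge_norm_def)
  qed
  have coneP: "t *\<^sub>R y \<in> P" if "y \<in> P" "0 \<le> t" for y t using that by (simp add: P_def)
  show "continuous_on (centers R) (En R)"
    unfolding continuous_on_sequentially o_def
  proof (intro ballI allI impI)
    fix z u assume z: "z \<in> centers R" and u: "(\<forall>n. u n \<in> centers R) \<and> u \<longlonglongrightarrow> z"
    show "(\<lambda>n. En R (u n)) \<longlonglongrightarrow> En R z"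
      unfolding En_def
    proof (rule integral_tendsto_gauge[OF R, where M="2 * Mg\<^sup>2"])
      fix x assume "x \<in> insert z (range u)"
      then have x: "x \<in> centers R" using z u by auto
      interpret C: thin_center P "A x" "B x" "CARD('n) + 1" "\<lambda>y. A (x + y)" "\<lambda>y. w (x + y)" "\<lambda>y. g (x + y)" T
        "\<lambda>y. snd (A (x + y) (g (x + y)))" "(1 - norm x) / 8" \<gamma> C0 by (rule cx[OF cen(1)[OF x]])
      show "set_integrable lborel {y \<in> P. 0 < gauge_norm x y \<and> gauge_norm x y < R} (\<lambda>y. A x (g (x + y)) \<bullet> g (x + y))"
        using C.adm_set_integrable[OF C.adm_e, of R] x by (simp add: centers_def C.E_def C.r_def C.e_def[abs_def] gauge_norm_def)
    next
      fix k y assume y: "y \<in> P" "0 < gauge_norm (u k) y" "gauge_norm (u k) y < R"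
      have uk: "u k \<in> centers R" using u by simp
      have "norm y \<le> 2 * R" using gle[OF cen(2)[OF uk], of y] y by simp
      then have "norm (g (u k + y)) \<le> Mg" using inside[OF uk y(1)] by (intro Mg) auto
      then have "(norm (g (u k + y)))\<^sup>2 \<le> Mg\<^sup>2" by (intro power_mono) auto
      then show "\<bar>A (u k) (g (u k + y)) \<bullet> g (u k + y)\<bar> \<le> 2 * Mg\<^sup>2"
        using A_bounds[OF cen(2)[OF uk], of "g (u k + y)"] inner_ge_zero[of "g (u k + y)"]
        by (simp add: power2_norm_eq_inner)
    next
      fix y assume y: "y \<in> P" "0 < gauge_norm z y" "gauge_norm z y < R"
      have ny: "norm y \<le> 2 * R" using gle[OF cen(2)[OF z], of y] y by simp
      have gy: "continuous_on (centers R) (\<lambda>x. g (x + y))"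
        by (rule continuous_on_compose2[OF g_cont]) (use inside(3)[OF _ y(1) ny] in \<open>auto intro!: continuous_intros\<close>)
      have "continuous_on (centers R) (\<lambda>x. A x (g (x + y)))"
        by (rule A_cont[OF continuous_on_id gy]) (use cen(2) in auto)
      then have cc: "continuous_on (centers R) (\<lambda>x. A x (g (x + y)) \<bullet> g (x + y))"
        using gy by (intro continuous_intros)
      have "u \<longlonglongrightarrow> z" "\<forall>\<^sub>F k in sequentially. u k \<in> centers R" using u by simp_all
      from continuous_on_tendsto_compose[OF cc this(1) z this(2)]
      show "(\<lambda>k. A (u k) (g (u k + y)) \<bullet> g (u k + y)) \<longlonglongrightarrow> A z (g (z + y)) \<bullet> g (z + y)" .
    qed (use u z cen in auto)
  qed
  show "continuous_on (centers R) (Ht R)"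
    unfolding continuous_on_sequentially o_def
  proof (intro ballI allI impI)
    fix z u assume z: "z \<in> centers R" and u: "(\<forall>n. u n \<in> centers R) \<and> u \<longlonglongrightarrow> z"
    have rad: "norm ((R / gauge_norm x y) *\<^sub>R y) \<le> 2 * R" "(R / gauge_norm x y) *\<^sub>R y \<in> P"
      if "x \<in> centers R" "y \<in> P" "0 < gauge_norm x y" for x y
    proof -
      have "norm ((R / gauge_norm x y) *\<^sub>R y) = R / gauge_norm x y * norm y" using R that by simp
      also have "\<dots> \<le> R / gauge_norm x y * (2 * gauge_norm x y)"
        using gle[OF cen(2)[OF that(1)], of y] R that by (intro mult_left_mono) auto
      also have "\<dots> = 2 * R" using that by simp
      finally show "norm ((R / gauge_norm x y) *\<^sub>R y) \<le> 2 * R" .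
      show "(R / gauge_norm x y) *\<^sub>R y \<in> P" using coneP[OF that(2)] R that by simp
    qed
    have "(\<lambda>n. LINT y:{y \<in> P. 0 < gauge_norm (u n) y \<and> gauge_norm (u n) y < 1}|lborel. (w (u n + (R / gauge_norm (u n) y) *\<^sub>R y))\<^sup>2)
      \<longlonglongrightarrow> (LINT y:{y \<in> P. 0 < gauge_norm z y \<and> gauge_norm z y < 1}|lborel. (w (z + (R / gauge_norm z y) *\<^sub>R y))\<^sup>2)"
    proof (rule integral_tendsto_gauge[OF zero_less_one, where M="Mw\<^sup>2"])
      fix x assume "x \<in> insert z (range u)"
      then have x: "x \<in> centers R" using z u by auto
      interpret C: thin_center P "A x" "B x" "CARD('n) + 1" "\<lambda>y. A (x + y)" "\<lambda>y. w (x + y)" "\<lambda>y. g (x + y)" T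
        "\<lambda>y. snd (A (x + y) (g (x + y)))" "(1 - norm x) / 8" \<gamma> C0 by (rule cx[OF cen(1)[OF x]])
      have "continuous_on (C.S R) (\<lambda>y. (w (x + y))\<^sup>2)"
        using x R by (intro continuous_intros C.continuous_on_S) (auto simp: centers_def)
      from C.set_integrable_radial[OF this R, of 1]
      show "set_integrable lborel {y \<in> P. 0 < gauge_norm x y \<and> gauge_norm x y < 1} (\<lambda>y. (w (x + (R / gauge_norm x y) *\<^sub>R y))\<^sup>2)"
        by (simp add: C.E_def C.r_def gauge_norm_def)
    next
      fix k y assume y: "y \<in> P" "0 < gauge_norm (u k) y" "gauge_norm (u k) y < 1"
      have uk: "u k \<in> centers R" using u by simp
      have "norm (w (u k + (R / gauge_norm (u k) y) *\<^sub>R y)) \<le> Mw"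
        using inside[OF uk] rad[OF uk y(1,2)] by (intro Mw) auto
      then have "\<bar>w (u k + (R / gauge_norm (u k) y) *\<^sub>R y)\<bar>\<^sup>2 \<le> Mw\<^sup>2" by (intro power_mono) auto
      then show "\<bar>(w (u k + (R / gauge_norm (u k) y) *\<^sub>R y))\<^sup>2\<bar> \<le> Mw\<^sup>2" by simp
    next
      fix y assume y: "y \<in> P" "0 < gauge_norm z y" and gl: "(\<lambda>k. gauge_norm (u k) y) \<longlonglongrightarrow> gauge_norm z y"
      have ev: "eventually (\<lambda>k. 0 < gauge_norm (u k) y) sequentially" using gl y(2) by (rule order_tendstoD)
      have "(\<lambda>k. u k + (R / gauge_norm (u k) y) *\<^sub>R y) \<longlonglongrightarrow> z + (R / gauge_norm z y) *\<^sub>R y"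
        using u gl y by (intro tendsto_intros) auto
      moreover have "eventually (\<lambda>k. u k + (R / gauge_norm (u k) y) *\<^sub>R y \<in> Hb) sequentially"
        using ev by eventually_elim (use inside(3) rad y u in auto)
      moreover have "z + (R / gauge_norm z y) *\<^sub>R y \<in> Hb" using inside(3)[OF z] rad[OF z y] by auto
      ultimately have "(\<lambda>k. w (u k + (R / gauge_norm (u k) y) *\<^sub>R y)) \<longlonglongrightarrow> w (z + (R / gauge_norm z y) *\<^sub>R y)"
        by (intro continuous_on_tendsto_compose[OF w_cont])
      then show "(\<lambda>k. (w (u k + (R / gauge_norm (u k) y) *\<^sub>R y))\<^sup>2) \<longlonglongrightarrow> (w (z + (R / gauge_norm z y) *\<^sub>R y))\<^sup>2"
        by (intro tendsto_intros)
    qed (use u z cen in auto)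
    then show "(\<lambda>n. Ht R (u n)) \<longlonglongrightarrow> Ht R z" unfolding Ht_def by (intro tendsto_intros)
  qed
qed

end

section \<open>From the vanishing order to a locally uniform lower bound, and compactness\<close>

subsection \<open>The lower bound\<close>

text \<open>If q > p, then r^(q - p) tends to 0 and the inequality breaks at small r. It is used to
  contradict decay that is too fast for the vanishing order.\<close>

lemma powr_exponent_compare:
  fixes c C p q \<rho> :: real
  assumes "0 < c" "0 < \<rho>" and le: "\<And>r. 0 < r \<Longrightarrow> r < \<rho> \<Longrightarrow> c * r powr p \<le> C * r powr q"
  shows "q \<le> p"
proof (rule ccontr)
  assume "\<not> q \<le> p"
  then have qp: "0 < q - p" by simp
  define C' where "C' = \<bar>C\<bar> + 1"
  define r where "r = min (\<rho> / 2) ((c / (2 * C')) powr (1 / (q - p)))"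
  have C': "0 < C'" "C \<le> C'" by (auto simp: C'_def)
  have r: "0 < r" "r < \<rho>" using assms C' by (auto simp: r_def)
  have "c * r powr p \<le> C' * r powr q"
    using le[OF r] C' by (meson mult_right_mono order_trans powr_ge_zero)
  also have "r powr q = r powr p * r powr (q - p)" by (simp flip: powr_add)
  finally have "c * r powr p \<le> (C' * r powr (q - p)) * r powr p" by (simp add: mult_ac)
  then have 1: "c \<le> C' * r powr (q - p)" using r by simp
  have "r powr (q - p) \<le> ((c / (2 * C')) powr (1 / (q - p))) powr (q - p)"
    using r qp by (intro powr_mono2) (auto simp: r_def)
  also have "\<dots> = c / (2 * C')" using qp assms C' by (simp add: powr_powr)
  finally have "C' * r powr (q - p) \<le> C' * (c / (2 * C'))" using C' by (intro mult_left_mono) auto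
  also have "\<dots> = c / 2" using C' by simp
  finally show False using 1 assms by simp
qed

context thin_obstacle
begin

lemma half_ball_sub:
  assumes "snd z = 0" "norm z + r \<le> 1"
  shows "half_ball z r \<subseteq> Hb"
proof
  fix x assume "x \<in> half_ball z r"
  then have "0 \<le> snd x" "norm (x - z) < r" by (auto simp: half_ball_def)
  then show "x \<in> Hb" using assms norm_triangle_sub[of x z] by (auto simp: Hb_eq P_def)
qed

lemma half_annulus_borel: "half_annulus (z :: 'n pt) s r \<in> sets borel"
proof -
  have "half_ball z r = P \<inter> ball z r" for r by (auto simp: half_ball_def P_def dist_norm norm_minus_commute)
  then show ?thesis unfolding half_annulus_def using closed_P by auto
qed

text \<open>A ball of radius r / 8 centered 3/4 * r above \<open>z\<close> fits into the half
  annulus.\<close>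

lemma half_annulus_measure:
  fixes z :: "'n pt"
  assumes z: "snd z = 0" and r: "0 < r"
  shows "measure lborel (ball (0 :: 'n pt) 1) / 8 ^ (CARD('n) + 1) * r powr (real CARD('n) + 1) \<le> measure lebesgue (half_annulus z (r / 2) r)"
proof -
  define c where "c = z + (3 / 4 * r) *\<^sub>R (0, 1)"
  have sub: "ball c (r / 8) \<subseteq> half_annulus z (r / 2) r"
  proof
    fix y assume "y \<in> ball c (r / 8)"
    then have yc: "norm (y - c) < r / 8" by (simp add: dist_norm norm_minus_commute)
    have cz: "norm (c - z) = 3 / 4 * r" using r by (simp add: c_def)
    have "\<bar>snd (y - c)\<bar> \<le> norm (y - c)" using norm_snd_le[of "snd (y - c)" "fst (y - c)"]
      by (simp only: prod.collapse real_norm_def)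
    then have "0 \<le> snd y" using yc z r by (simp add: c_def)
    moreover have "norm (y - z) < r" "r / 2 \<le> norm (y - z)"
      using norm_triangle_ineq[of "y - c" "c - z"] norm_triangle_ineq[of "y - z" "c - y"] cz yc
      by (simp_all add: norm_minus_commute) 
    ultimately show "y \<in> half_annulus z (r / 2) r" by (simp add: half_annulus_def half_ball_def)
  qed
  have "bounded (half_annulus z (r / 2) r)"
    by (rule bounded_subset[of "ball z r"]) (auto simp: half_annulus_def half_ball_def dist_norm norm_minus_commute)
  moreover have "half_annulus z (r / 2) r \<in> sets lebesgue" using half_annulus_borel[of z "r / 2" r] by simp
  ultimately have "measure lebesgue (ball c (r / 8)) \<le> measure lebesgue (half_annulus z (r / 2) r)"
    using sub by (intro measure_mono_fmeasurable bounded_set_imp_lmeasurable) auto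
  moreover define X where "X = (r / 8) ^ (CARD('n) + 1)"
  have "measure lebesgue (ball c (r / 8)) = X * measure lborel (ball (0 :: 'n pt) 1)"
    using content_ball_conv_unit_ball[of "r / 8" c] r by (simp add: X_def)
  moreover have "X = r powr (real CARD('n) + 1) / 8 ^ (CARD('n) + 1)"
    using r powr_realpow[of r "CARD('n) + 1"] by (simp add: X_def power_divide add.commute)
  ultimately show ?thesis by (simp add: mult_ac)
qed

text \<open>An exponent \<kappa>1 strictly between the order and \<kappa> bounds the quotient of
  logarithms for all small r. The extra n + 1 in the power comes from multiplying the mean by the
  volume of the annulus.\<close>

lemma order_lower_bound:
  assumes z: "z \<in> thin_ball 1" and ord: "vanishing_order w z < ereal \<kappa>"
  shows "\<exists>\<kappa>1<\<kappa>. \<exists>c>0. \<exists>\<rho>>0. norm z + \<rho> \<le> 1 \<and> (\<forall>r. 0 < r \<and> r < \<rho> \<longrightarrow>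
    c * r powr (2 * \<kappa>1 + (real CARD('n) + 1)) \<le> (LINT x:half_annulus z (r / 2) r|lborel. (w x)\<^sup>2))"
proof -
  have sz: "snd z = 0" "norm z < 1" using z by (auto simp: thin_ball_eq T_def)
  obtain \<kappa>1 where \<kappa>1: "vanishing_order w z < ereal \<kappa>1" "\<kappa>1 < \<kappa>"
    using ereal_dense2[OF ord] by auto
  define m where "m r = measure lebesgue (half_annulus z (r / 2) r)" for r
  define L where "L r = (LINT x:half_annulus z (r / 2) r|lborel. (w x)\<^sup>2)" for r
  define V where "V = measure lborel (ball (0 :: 'n pt) 1) / 8 ^ (CARD('n) + 1)"
  have V: "0 < V" unfolding V_def using content_ball_pos[of 1 "0 :: 'n pt"] by simp
  have L_eq: "(LINT x|lebesgue_on (half_annulus z (r / 2) r). (w x)\<^sup>2) = L r" if "norm z + r \<le> 1" for r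
    unfolding L_def
  proof (intro lebesgue_on_eq_lborel set_borel_measurable_continuous_borel half_annulus_borel continuous_intros)
    show "continuous_on (half_annulus z (r / 2) r) w"
      by (rule continuous_on_subset[OF w_cont]) (use half_ball_sub[OF sz(1) that] in \<open>auto simp: half_annulus_def\<close>)
  qed
  have "\<forall>\<^sub>F r in at_right 0. ext_ln (sqrt (1 / m r * (LINT x|lebesgue_on (half_annulus z (r / 2) r). (w x)\<^sup>2))) / ereal (ln r) < ereal \<kappa>1"
    using Limsup_lessD[OF \<kappa>1(1)[unfolded vanishing_order_def]] by (simp add: m_def)
  then obtain \<rho>1 where \<rho>1: "0 < \<rho>1" "\<And>r. 0 < r \<Longrightarrow> r < \<rho>1 \<Longrightarrow>
      ext_ln (sqrt (1 / m r * (LINT x|lebesgue_on (half_annulus z (r / 2) r). (w x)\<^sup>2))) / ereal (ln r) < ereal \<kappa>1"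
    unfolding eventually_at_right_field by meson
  define \<rho> where "\<rho> = min \<rho>1 (1 - norm z)"
  have \<rho>: "0 < \<rho>" "\<rho> \<le> \<rho>1" "norm z + \<rho> \<le> 1" "\<rho> \<le> 1" using \<rho>1 sz by (auto simp: \<rho>_def min_le_iff_disj)
  have "V * r powr (2 * \<kappa>1 + (real CARD('n) + 1)) \<le> L r" if r: "0 < r" "r < \<rho>" for r
  proof -
    define X where "X = 1 / m r * L r"
    have "ext_ln (sqrt X) / ereal (ln r) < ereal \<kappa>1"
      using \<rho>1(2)[of r] r \<rho> L_eq[of r] by (simp add: X_def)
    moreover have lnr: "ln r < 0" using r \<rho> by simp
    \<comment> \<open>A vanishing integral would give -\<infinity> divided by the negative number ln
      r, hence +\<infinity>, which is excluded. The sign of ln r also reverses the inequality in the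
      next step.\<close>
    ultimately have X: "0 < X" and "ln (sqrt X) / ln r < \<kappa>1"
      by (auto simp: ext_ln_def not_le split: if_splits)
    then have "\<kappa>1 * ln r < ln (sqrt X)" using lnr by (simp add: neg_divide_less_eq)
    then have "exp (\<kappa>1 * ln r) < exp (ln (sqrt X))" by simp
    then have "r powr \<kappa>1 < sqrt X" using r X by (simp add: powr_def)
    then have "(r powr \<kappa>1)\<^sup>2 < (sqrt X)\<^sup>2" by (intro power_strict_mono) auto
    moreover have "(r powr \<kappa>1)\<^sup>2 = r powr (2 * \<kappa>1)" using r by (simp add: power2_eq_square flip: powr_add)
    ultimately have 1: "r powr (2 * \<kappa>1) < X" using X by simp
    have mr: "V * r powr (real CARD('n) + 1) \<le> m r"
      unfolding V_def m_def by (rule half_annulus_measure[OF sz(1) r(1)])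
    have "0 < V * r powr (real CARD('n) + 1)" using V r by simp
    then have m0: "0 < m r" using mr by linarith
    have "V * r powr (2 * \<kappa>1 + (real CARD('n) + 1)) = V * r powr (real CARD('n) + 1) * r powr (2 * \<kappa>1)"
      by (simp add: powr_add mult_ac)
    also have "\<dots> \<le> m r * r powr (2 * \<kappa>1)" using mr by (intro mult_right_mono) auto
    also have "\<dots> \<le> m r * X" using m0 1 by (intro mult_left_mono) auto
    also have "\<dots> = L r" using m0 by (simp add: X_def)
    finally show ?thesis .
  qed
  then show ?thesis using \<kappa>1(2) V \<rho> unfolding L_def by blast
qed

text \<open>At a zero, differentiability gives |w| \<le> C * r nearby, so the annular integral is at
  most of order r^(2 + n + 1). This secures degrees above 1 for the homogeneous competitor.\<close>

lemma order_ge_1_at_zero: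
  assumes z: "z \<in> thin_ball 1" "w z = 0" and c: "0 < c" and \<rho>: "0 < \<rho>" "norm z + \<rho> \<le> 1"
    and low: "\<And>r. 0 < r \<Longrightarrow> r < \<rho> \<Longrightarrow> c * r powr (2 * \<kappa>1 + (real CARD('n) + 1)) \<le> (LINT x:half_annulus z (r / 2) r|lborel. (w x)\<^sup>2)"
  shows "1 \<le> \<kappa>1"
proof -
  have sz: "snd z = 0" "norm z < 1" using z by (auto simp: thin_ball_eq T_def)
  have zH: "z \<in> Hb" using z thin_sub_Hb by blast
  obtain \<delta> where \<delta>: "0 < \<delta>" "\<And>x. x \<in> Hb \<Longrightarrow> norm (x - z) < \<delta> \<Longrightarrow> norm (w x - w z - (x - z) \<bullet> g z) \<le> 1 * norm (x - z)"
    using w_has_derivative[OF zH, unfolded has_derivative_within_alt, THEN conjunct2, rule_format, OF zero_less_one]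
    by auto
  define C where "C = 1 + norm (g z)"
  have C: "\<bar>w x\<bar> \<le> C * norm (x - z)" if "x \<in> Hb" "norm (x - z) < \<delta>" for x
  proof -
    have "\<bar>(x - z) \<bullet> g z\<bar> \<le> norm (x - z) * norm (g z)" by (rule Cauchy_Schwarz_ineq2)
    moreover have "\<bar>w x - (x - z) \<bullet> g z\<bar> \<le> norm (x - z)" using \<delta>(2)[OF that] z(2) by simp
    moreover have "\<bar>w x\<bar> \<le> \<bar>w x - (x - z) \<bullet> g z\<bar> + \<bar>(x - z) \<bullet> g z\<bar>" by linarith
    ultimately show ?thesis by (simp add: C_def algebra_simps)
  qed
  define V where "V = measure lborel (ball (0 :: 'n pt) 1)"
  define \<rho>' where "\<rho>' = min \<delta> \<rho>"
  have cmp: "c * r powr (2 * \<kappa>1 + (real CARD('n) + 1)) \<le> C\<^sup>2 * V * r powr (2 + (real CARD('n) + 1))" if r: "0 < r" "r < \<rho>'" for r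
  proof -
    have sub: "half_annulus z (r / 2) r \<subseteq> Hb"
      using half_ball_sub[OF sz(1), of r] r \<rho> by (auto simp: half_annulus_def \<rho>'_def)
    have "(LINT x:half_annulus z (r / 2) r|lborel. (w x)\<^sup>2) \<le> (LINT x:ball z r|lborel. (C * r)\<^sup>2)"
      unfolding set_lebesgue_integral_def
    proof (rule integral_mono')
      show "integrable lborel (\<lambda>x. indicat_real (ball z r) x *\<^sub>R (C * r)\<^sup>2)"
        using emeasure_lborel_ball_finite[of z r] by (intro integrable_scaleR_left integrable_real_indicator) auto
      fix x
      show "indicat_real (half_annulus z (r / 2) r) x *\<^sub>R (w x)\<^sup>2 \<le> indicat_real (ball z r) x *\<^sub>R (C * r)\<^sup>2"
      proof (cases "x \<in> half_annulus z (r / 2) r")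
        case True
        then have x: "norm (x - z) < r" by (auto simp: half_annulus_def half_ball_def)
        then have "\<bar>w x\<bar> \<le> C * norm (x - z)" using C[of x] True sub r by (auto simp: \<rho>'_def)
        also have "\<dots> \<le> C * r" using x by (intro mult_left_mono) (auto simp: C_def)
        finally have "\<bar>w x\<bar>\<^sup>2 \<le> (C * r)\<^sup>2" by (intro power_mono) auto
        then show ?thesis using True x by (simp add: dist_norm norm_minus_commute)
      qed simp
    qed auto
    also have "\<dots> = measure lborel (ball z r) * (C * r)\<^sup>2"
      unfolding set_lebesgue_integral_def by simp
    also have "measure lborel (ball z r) = r powr (real CARD('n) + 1) * V"
      using content_ball_conv_unit_ball[of r z] r powr_realpow[of r "CARD('n) + 1"] by (simp add: V_def add.commute)
    also have "r powr (real CARD('n) + 1) * V * (C * r)\<^sup>2 = C\<^sup>2 * V * r powr (2 + (real CARD('n) + 1))"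
      using r by (simp add: powr_add power_mult_distrib power2_eq_square power3_eq_cube mult_ac)
    finally show ?thesis using low[of r] r by (simp add: \<rho>'_def)
  qed
  have "0 < \<rho>'" using \<rho> \<delta> by (simp add: \<rho>'_def)
  from powr_exponent_compare[OF c this cmp]
  have "2 + (real CARD('n) + 1) \<le> 2 * \<kappa>1 + (real CARD('n) + 1)" .
  then show ?thesis by simp
qed

definition lower_bound_near :: "'n pt \<Rightarrow> real \<Rightarrow> real \<Rightarrow> real \<Rightarrow> bool" where
  "lower_bound_near z \<kappa> \<epsilon> r1 \<longleftrightarrow> (\<forall>x\<in>thin_ball 1. dist x z < \<epsilon> \<longrightarrow> (\<forall>r. 0 < r \<and> r \<le> r1 \<longrightarrow>
     half_ball x r \<subseteq> Hb \<and> (\<exists>y\<in>half_ball x r. r powr \<kappa> \<le> \<bar>w y\<bar>)))"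

lemma half_ball_sub_near:
  assumes "x \<in> thin_ball 1" "dist x z < (1 - norm z) / 4" "r \<le> (1 - norm z) / 4"
  shows "half_ball x r \<subseteq> Hb"
proof (rule half_ball_sub)
  show "snd x = 0" using assms by (auto simp: thin_ball_eq T_def)
  have "norm x \<le> norm z + dist x z" using norm_triangle_sub[of x z] by (simp add: dist_norm)
  moreover have "0 \<le> 1 - norm z" using order.strict_trans1[OF zero_le_dist assms(2)] by simp
  ultimately show "norm x + r \<le> 1" using assms by argo
qed

lemma local_lower_bound:
  assumes z: "z \<in> thin_ball 1" and ord: "vanishing_order w z < ereal \<kappa>" and \<kappa>: "0 < \<kappa>"
  shows "\<exists>\<epsilon>>0. \<exists>r1>0. lower_bound_near z \<kappa> \<epsilon> r1"
proof -
  have sz: "snd z = 0" "norm z < 1" using z by (auto simp: thin_ball_eq T_def)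
  have zH: "z \<in> Hb" using z thin_sub_Hb by blast
  define \<epsilon>0 where "\<epsilon>0 = (1 - norm z) / 4"
  have \<epsilon>0: "0 < \<epsilon>0" using sz by (simp add: \<epsilon>0_def)
  show ?thesis
  proof (cases "w z = 0")
    case False
    define c where "c = \<bar>w z\<bar> / 2"
    have c: "0 < c" using False by (simp add: c_def)
    obtain \<delta> where \<delta>: "0 < \<delta>" "\<And>x. x \<in> Hb \<Longrightarrow> dist x z < \<delta> \<Longrightarrow> dist (w x) (w z) < c"
      using w_cont zH c unfolding continuous_on_iff by metis
    \<comment> \<open>For r up to c powr (1 / \<kappa>) the power r^\<kappa> is at most c, which
      bounds |w| from below at the center itself.\<close>
    define r1 where "r1 = min \<epsilon>0 (c powr (1 / \<kappa>))"
    have pos: "0 < min \<delta> \<epsilon>0" "0 < r1" using \<delta> \<epsilon>0 c by (auto simp: r1_def)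
    have "lower_bound_near z \<kappa> (min \<delta> \<epsilon>0) r1"
        unfolding lower_bound_near_def
      proof (intro ballI impI allI conjI)
        fix x r assume x: "x \<in> thin_ball 1" "dist x z < min \<delta> \<epsilon>0" and r: "0 < r \<and> r \<le> r1"
        show "half_ball x r \<subseteq> Hb"
          by (rule half_ball_sub_near[OF x(1), of z]) (use x r in \<open>auto simp: r1_def \<epsilon>0_def\<close>)
        have "x \<in> half_ball x r" using x r by (auto simp: half_ball_def thin_ball_eq T_def)
        moreover have "r powr \<kappa> \<le> \<bar>w x\<bar>"
        proof -
          have "r powr \<kappa> \<le> (c powr (1 / \<kappa>)) powr \<kappa>" using r \<kappa> by (intro powr_mono2) (auto simp: r1_def)
          also have "\<dots> = c" using c \<kappa> by (simp add: powr_powr)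
          also have "c \<le> \<bar>w x\<bar>"
          proof -
            have "x \<in> Hb" using x(1) thin_sub_Hb by blast
            moreover have "dist x z < \<delta>" using x(2) by simp
            ultimately have "\<bar>w x - w z\<bar> < \<bar>w z\<bar> / 2" using \<delta>(2)[of x] by (simp add: dist_real_def c_def)
            then show ?thesis unfolding c_def by linarith
          qed
          finally show ?thesis .
        qed
        ultimately show "\<exists>y\<in>half_ball x r. r powr \<kappa> \<le> \<bar>w y\<bar>" by blast
      qed
    then show ?thesis using pos by blast
  next
    case True
    define n1 where "n1 = real CARD('n) + 1"
    obtain \<kappa>1 c \<rho> where \<kappa>1: "\<kappa>1 < \<kappa>" and c: "0 < c" and \<rho>: "0 < \<rho>" "norm z + \<rho> \<le> 1"
      and low: "\<And>r. 0 < r \<Longrightarrow> r < \<rho> \<Longrightarrow> c * r powr (2 * \<kappa>1 + n1) \<le> (LINT x:half_annulus z (r / 2) r|lborel. (w x)\<^sup>2)"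
      using order_lower_bound[OF z ord] unfolding n1_def by blast
    have \<kappa>1_ge: "1 \<le> \<kappa>1" using order_ge_1_at_zero[OF z True c \<rho>] low unfolding n1_def by blast
    \<comment> \<open>The gap is cut into four: \<kappa>1 to \<kappa>2 is contradicted by the decay
      from \<open>growth_above\<close>, \<kappa>2 to \<kappa>3 is the loss inside that lemma,
      \<kappa>3 to \<kappa>0 absorbs the varying exponent, and \<kappa>0 to \<kappa> absorbs the
      constant of the lower bound.\<close>
    define h where "h = (\<kappa> - \<kappa>1) / 4"
    have h: "0 < h" using \<kappa>1 by (simp add: h_def)
    define \<kappa>2 where "\<kappa>2 = \<kappa>1 + h"
    define \<kappa>3 where "\<kappa>3 = \<kappa>1 + 2 * h"
    define \<kappa>0 where "\<kappa>0 = \<kappa>1 + 3 * h"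
    have ks: "\<kappa>1 < \<kappa>2" "\<kappa>2 < \<kappa>3" "1 < \<kappa>3" "1 < \<kappa>0" "\<kappa>0 - \<kappa>3 = h" "\<kappa>0 < \<kappa>" "0 \<le> \<kappa>2"
      using h \<kappa>1_ge by (auto simp: \<kappa>2_def \<kappa>3_def \<kappa>0_def h_def field_simps)
    obtain \<gamma> C0 where \<gamma>: "0 < \<gamma>" "0 \<le> C0" and cx: "\<And>z. z \<in> thin_ball 1 \<Longrightarrow> thin_center P (A z) (B z) (CARD('n) + 1) (\<lambda>y. A (z + y)) (\<lambda>y. w (z + y)) (\<lambda>y. g (z + y))
         T (\<lambda>y. snd (A (z + y) (g (z + y)))) ((1 - norm z) / 8) \<gamma> C0"
      using center_exists by blast
    define bb where "bb = 2 * C0 * (2 * \<kappa>0 + (CARD('n) + 1)) * \<kappa>0 / \<gamma>"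
    have bb: "0 \<le> bb" unfolding bb_def using \<gamma> ks by (intro divide_nonneg_pos mult_nonneg_nonneg) auto
    \<comment> \<open>Half of the admissible radius, and small enough that the exponent \<kappa>0 -
      bb * s^\<gamma> never drops below \<kappa>3.\<close>
    define R where "R = min ((1 - norm z) / 16) ((h / (bb + 1)) powr (1 / \<gamma>))"
    have R: "0 < R" "R < (1 - norm z) / 8" using sz h bb by (auto simp: R_def min_def)
    have bbR: "bb * s powr \<gamma> \<le> h" if "0 < s" "s \<le> R" for s
    proof -
      have "s powr \<gamma> \<le> ((h / (bb + 1)) powr (1 / \<gamma>)) powr \<gamma>" using that \<gamma> by (intro powr_mono2) (auto simp: R_def)
      also have "\<dots> = h / (bb + 1)" using \<gamma> h bb by (simp add: powr_powr)
      finally have "bb * s powr \<gamma> \<le> bb * (h / (bb + 1))" using bb by (rule mult_left_mono)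
      also have "\<dots> \<le> h" using bb h by (simp add: divide_simps)
      finally show ?thesis .
    qed
    \<comment> \<open>This radius is found at \<open>z\<close> alone and is then kept fixed:
      uniformity over nearby centers comes from continuity in the center at radius
      \<open>s\<close>.\<close>
    obtain s where s: "0 < s" "s \<le> R" and s_neg: "En s z < \<kappa>3 * Ht s z / s" and Ht_nn: "0 \<le> Ht s z"
    proof -
      interpret C: thin_center P "A z" "B z" "CARD('n) + 1" "\<lambda>y. A (z + y)" "\<lambda>y. w (z + y)" "\<lambda>y. g (z + y)" T
        "\<lambda>y. snd (A (z + y) (g (z + y)))" "(1 - norm z) / 8" \<gamma> C0 by (rule cx[OF z])
      have en: "C.energy s = En s z" for s
        by (simp add: C.energy_def C.I_def C.e_def C.E_def C.r_def En_def gauge_norm_def)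
      have ht: "C.height s = Ht s z" for s
        unfolding C.height_def C.\<sigma>_def C.E_def C.r_def Ht_def gauge_norm_def by simp
      have "\<exists>s. 0 < s \<and> s \<le> R \<and> C.energy s < \<kappa>3 * C.height s / s"
      proof (rule ccontr)
        assume "\<not> ?thesis"
        then have N: "\<kappa>3 * C.height s / s \<le> C.energy s" if "0 < s" "s \<le> R" for s using that by (meson not_le)
        from C.growth_above[OF R ks(7) ks(2) N] obtain R1 K where R1: "0 < R1" "R1 \<le> R"
          and K: "\<And>s. 0 < s \<Longrightarrow> s \<le> R1 \<Longrightarrow> C.I (\<lambda>y. (w (z + y))\<^sup>2) s - C.I (\<lambda>y. (w (z + y))\<^sup>2) (s / 8) \<le> K * s powr (2 * \<kappa>2 + (CARD('n) + 1))"
          by blast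
        have cmp: "c * r powr (2 * \<kappa>1 + n1) \<le> (K * 2 powr (2 * \<kappa>2 + n1)) * r powr (2 * \<kappa>2 + n1)" if r: "0 < r" "r < min \<rho> (R1 / 2)" for r
        proof -
          \<comment> \<open>A point at Euclidean distance in [r / 2, r) has gauge in [r / 4, 2 * r),
            that is, in [s / 8, s).\<close>
          define s where "s = 2 * r"
          have s: "0 < s" "s \<le> R1" "s < (1 - norm z) / 8" using r R1 R by (auto simp: s_def)
          have adm: "C.adm ((1 - norm z) / 8) (\<lambda>y. (w (z + y))\<^sup>2)"
            by (intro C.adm_continuous continuous_intros C.w_cont)
          have int: "set_integrable lborel (C.E s) (\<lambda>y. (w (z + y))\<^sup>2)" by (rule C.adm_set_integrable[OF adm s(3)])
          have "c * r powr (2 * \<kappa>1 + n1) \<le> (LINT x:half_annulus z (r / 2) r|lborel. (w x)\<^sup>2)" using low r by simp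
          also have "\<dots> = (\<integral>y. indicat_real (half_annulus z (r / 2) r) (z + y) *\<^sub>R (w (z + y))\<^sup>2 \<partial>lborel)"
            unfolding set_lebesgue_integral_def
            using lborel_integral_affine[of 1 "\<lambda>x. indicat_real (half_annulus z (r / 2) r) x *\<^sub>R (w x)\<^sup>2" z] by simp
          also have "\<dots> \<le> (LINT y:C.E s - C.E (s / 8)|lborel. (w (z + y))\<^sup>2)"
            unfolding set_lebesgue_integral_def
          proof (rule integral_mono')
            show "integrable lborel (\<lambda>y. indicat_real (C.E s - C.E (s / 8)) y *\<^sub>R (w (z + y))\<^sup>2)"
              using set_integrable_subset[OF int, of "C.E s - C.E (s / 8)"] by (simp add: set_integrable_def)
            fix y
            show "indicat_real (half_annulus z (r / 2) r) (z + y) *\<^sub>R (w (z + y))\<^sup>2 \<le> indicat_real (C.E s - C.E (s / 8)) y *\<^sub>R (w (z + y))\<^sup>2"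
            proof (cases "z + y \<in> half_annulus z (r / 2) r")
              case True
              then have y: "0 \<le> snd y" "norm y < r" "r / 2 \<le> norm y" using sz by (auto simp: half_annulus_def half_ball_def)
              then have "y \<in> P" "y \<noteq> 0" using r by (auto simp: P_def)
              moreover have "C.r y < s" "s / 8 \<le> C.r y" using y C.r_le_norm[of y] C.norm_le_r[of y] by (auto simp: s_def)
              ultimately have "y \<in> C.E s - C.E (s / 8)" by (simp add: C.E_def C.r_pos_iff)
              then show ?thesis using True by simp
            qed simp
          qed auto
          also have "\<dots> = C.I (\<lambda>y. (w (z + y))\<^sup>2) s - C.I (\<lambda>y. (w (z + y))\<^sup>2) (s / 8)"
            using s by (intro C.I_diff[symmetric] int) auto
          also have "\<dots> \<le> K * s powr (2 * \<kappa>2 + n1)" using K[OF s(1,2)] by (simp add: n1_def add_ac)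
          also have "\<dots> = (K * 2 powr (2 * \<kappa>2 + n1)) * r powr (2 * \<kappa>2 + n1)"
            using r by (simp add: s_def powr_mult)
          finally show ?thesis .
        qed
        have "0 < min \<rho> (R1 / 2)" using \<rho> R1 by simp
        from powr_exponent_compare[OF c this cmp] have "2 * \<kappa>2 + n1 \<le> 2 * \<kappa>1 + n1" .
        then show False using ks by simp
      qed
      then obtain s where s: "0 < s" "s \<le> R" "C.energy s < \<kappa>3 * C.height s / s" by blast
      moreover have "0 \<le> C.height s" using s R by (intro C.height_nonneg) auto
      ultimately show ?thesis using that[of s] unfolding en ht by blast
    qed
    define k where "k = \<kappa>0 - bb * s powr \<gamma>"
    have k: "\<kappa>3 \<le> k" "1 < k" using bbR[OF s] ks by (auto simp: k_def)
    define Q where "Q x = En s x - k * Ht s x / s" for x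
    have zc: "z \<in> centers s" using z s R by (simp add: centers_def)
    have Qz: "Q z < 0"
    proof -
      have "\<kappa>3 * Ht s z / s \<le> k * Ht s z / s" using k Ht_nn s by (intro divide_right_mono mult_right_mono) auto
      then show ?thesis using s_neg by (simp add: Q_def)
    qed
    have "continuous_on (centers s) Q" unfolding Q_def using s En_Ht_continuous[OF s(1)] by (intro continuous_intros) auto
    then obtain \<delta> where \<delta>: "0 < \<delta>" "\<And>x. x \<in> centers s \<Longrightarrow> dist x z < \<delta> \<Longrightarrow> dist (Q x) (Q z) < - Q z / 2"
      using zc Qz unfolding continuous_on_iff by (metis half_gt_zero neg_0_less_iff_less)
    define c0 where "c0 = - Q z / 2"
    have c0: "0 < c0" using Qz by (simp add: c0_def)
    \<comment> \<open>The last term keeps \<open>s\<close> below the admissible radius (1 - norm x)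
      / 8 of every nearby center x.\<close>
    define \<epsilon> where "\<epsilon> = min (min \<delta> \<epsilon>0) ((1 - norm z) / 8 - s)"
    have \<epsilon>: "0 < \<epsilon>" using \<delta> \<epsilon>0 s R by (auto simp: \<epsilon>_def)
    have near: "x \<in> centers s" "c0 \<le> - Q x" if "x \<in> thin_ball 1" "dist x z < \<epsilon>" for x
    proof -
      have "norm x \<le> norm z + dist x z" using norm_triangle_sub[of x z] by (simp add: dist_norm)
      moreover have "dist x z < (1 - norm z) / 8 - s" using that by (simp add: \<epsilon>_def)
      ultimately have "s < (1 - norm x) / 8" using zero_le_dist[of x z] by argo
      then show xc: "x \<in> centers s" using that by (simp add: centers_def)
      have "dist (Q x) (Q z) < - Q z / 2" using \<delta>(2)[OF xc] that by (simp add: \<epsilon>_def)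
      then show "c0 \<le> - Q x" unfolding c0_def dist_real_def by argo
    qed
    \<comment> \<open>Every unit gauge ball lies in the Euclidean ball of radius 2, so this volume
      serves all centers at once.\<close>
    define \<mu> where "\<mu> = measure lborel (cball (0 :: 'n pt) 2)"
    have \<mu>: "0 < \<mu>" unfolding \<mu>_def by (rule content_cball_pos) simp
    define M where "M = 2 * \<kappa>0 - 2 + (CARD('n) + 1)"
    define q where "q = c0 / (2 * \<kappa>0 * (CARD('n) + 1) * \<mu> * s powr M)"
    have q: "0 < q" unfolding q_def using c0 ks \<mu> s by (intro divide_pos_pos mult_pos_pos) auto
    have lower: "\<exists>y\<in>P. norm y \<le> 2 * t \<and> q * t powr (2 * \<kappa>0) \<le> (w (x + y))\<^sup>2"
      if x: "x \<in> thin_ball 1" "dist x z < \<epsilon>" and t: "0 < t" "t \<le> s" for x t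
    proof -
      note xc = near[OF x]
      interpret C: thin_center P "A x" "B x" "CARD('n) + 1" "\<lambda>y. A (x + y)" "\<lambda>y. w (x + y)" "\<lambda>y. g (x + y)" T
        "\<lambda>y. snd (A (x + y) (g (x + y)))" "(1 - norm x) / 8" \<gamma> C0 by (rule cx[OF x(1)])
      have en: "C.energy s = En s x"
        by (simp add: C.energy_def C.I_def C.e_def C.E_def C.r_def En_def gauge_norm_def)
      have ht: "C.height s = Ht s x"
        unfolding C.height_def C.\<sigma>_def C.E_def C.r_def Ht_def gauge_norm_def by simp
      have m1: "C.m1 \<le> \<mu>" unfolding C.m1_def \<mu>_def
      proof (rule measure_mono_fmeasurable)
        show "C.E 1 \<subseteq> cball 0 2"
        proof
          fix y assume "y \<in> C.E 1"
          then show "y \<in> cball 0 2" using C.norm_le_r[of y] by (simp add: C.E_def)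
        qed
        show "cball (0 :: 'n pt) 2 \<in> fmeasurable lborel" using emeasure_lborel_cball_finite[of "0 :: 'n pt" 2] by (simp add: fmeasurable_def)
      qed simp
      have sx: "s < (1 - norm x) / 8" using xc by (simp add: centers_def)
      have neg: "C.energy s - (\<kappa>0 - bb * s powr \<gamma>) * C.height s / s = - (- Q x)" unfolding en ht Q_def k_def by simp
      have "\<exists>y\<in>C.S t. (- Q x) / (2 * \<kappa>0 * real (CARD('n) + 1) * \<mu> * s powr (2 * \<kappa>0 - 2 + real (CARD('n) + 1))) * t powr (2 * \<kappa>0) \<le> (w (x + y))\<^sup>2"
        by (rule C.growth_below[OF ks(4) _ s(1) sx _ neg _ m1 \<mu> t]) (use k c0 xc in \<open>auto simp: k_def bb_def\<close>)
      then obtain y where y: "y \<in> C.S t" "(- Q x) / (2 * \<kappa>0 * real (CARD('n) + 1) * \<mu> * s powr M) * t powr (2 * \<kappa>0) \<le> (w (x + y))\<^sup>2"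
        unfolding M_def by auto
      have "q * t powr (2 * \<kappa>0) \<le> (- Q x) / (2 * \<kappa>0 * real (CARD('n) + 1) * \<mu> * s powr M) * t powr (2 * \<kappa>0)"
        unfolding q_def using xc ks \<mu> by (intro mult_right_mono divide_right_mono mult_nonneg_nonneg) auto
      then have "q * t powr (2 * \<kappa>0) \<le> (w (x + y))\<^sup>2" using y(2) by linarith
      moreover have "y \<in> P" "norm y \<le> 2 * t" using y(1) C.norm_le_r[of y] by (auto simp: C.S_def)
      ultimately show ?thesis by blast
    qed
    \<comment> \<open>The lower bound is used at gauge radius r / 3: that sphere lies within
      Euclidean distance 2 * r / 3 < r of the center. The factor 3 powr (2 * \<kappa>0) accounts for
      the change of radius.\<close>
    define q' where "q' = q / 3 powr (2 * \<kappa>0)"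
    have q': "0 < q'" using q by (simp add: q'_def)
    \<comment> \<open>The exponent is twice the remaining gap \<kappa> - \<kappa>0, because the
      lower bound concerns the square of \<open>w\<close>.\<close>
    define r1 where "r1 = min (min s \<epsilon>0) (q' powr (1 / (2 * (\<kappa> - \<kappa>0))))"
    have r1: "0 < r1" using s \<epsilon>0 q' by (simp add: r1_def)
    have "lower_bound_near z \<kappa> \<epsilon> r1"
      unfolding lower_bound_near_def
    proof (intro ballI impI allI conjI)
      fix x r assume x: "x \<in> thin_ball 1" "dist x z < \<epsilon>" and r: "0 < r \<and> r \<le> r1"
      show "half_ball x r \<subseteq> Hb"
        by (rule half_ball_sub_near[OF x(1), of z]) (use x r in \<open>auto simp: r1_def \<epsilon>0_def \<epsilon>_def\<close>)
      obtain y where y: "y \<in> P" "norm y \<le> 2 * (r / 3)" "q * (r / 3) powr (2 * \<kappa>0) \<le> (w (x + y))\<^sup>2"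
        using lower[OF x, of "r / 3"] r by (auto simp: r1_def)
      have "x + y \<in> half_ball x r" using y x r by (auto simp: half_ball_def P_def thin_ball_eq T_def)
      moreover have "r powr \<kappa> \<le> \<bar>w (x + y)\<bar>"
      proof (rule power2_le_imp_le)
        have "(r powr \<kappa>)\<^sup>2 = r powr (2 * (\<kappa> - \<kappa>0)) * r powr (2 * \<kappa>0)"
          using r by (simp add: power2_eq_square algebra_simps flip: powr_add)
        also have "r powr (2 * (\<kappa> - \<kappa>0)) \<le> (q' powr (1 / (2 * (\<kappa> - \<kappa>0)))) powr (2 * (\<kappa> - \<kappa>0))"
          using r ks by (intro powr_mono2) (auto simp: r1_def)
        also have "\<dots> = q'" using q' ks by (simp add: powr_powr)
        also have "q' * r powr (2 * \<kappa>0) = q * (r / 3) powr (2 * \<kappa>0)" using r by (simp add: q'_def powr_divide)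
        finally show "(r powr \<kappa>)\<^sup>2 \<le> \<bar>w (x + y)\<bar>\<^sup>2" using y(3) by (simp add: mult_right_mono)
      qed simp
      ultimately show "\<exists>y\<in>half_ball x r. r powr \<kappa> \<le> \<bar>w y\<bar>" by blast
    qed
    then show ?thesis using \<epsilon> r1 by blast
  qed
qed

end

theorem corollary4p1:
  fixes a :: "(real^'n::finite) \<times> real \<Rightarrow> (real^'n) \<times> real \<Rightarrow> (real^'n) \<times> real \<Rightarrow> real"
    and w :: "(real^'n) \<times> real \<Rightarrow> real"
    and K :: "((real^'n) \<times> real) set"
    and p :: ereal and \<alpha> \<kappa> :: real
  assumes coeffs: "admissible_coeffs p a"
    and alpha: "\<alpha> \<in> {0<..1/2}"
    and reg: "C1_holder_loc \<alpha> (half_ball 0 1) w"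
    and L2: "in_Lp 2 (half_ball 0 1) w"
    and normalized: "L2_norm_on (half_ball 0 1) w = 1"
    and sol: "thin_obstacle_solution a w"
    and K: "compact K" "K \<subseteq> thin_ball 1"
    and kappa: "\<kappa> > 0"
    and order: "\<forall>x\<in>K. vanishing_order w x < ereal \<kappa>"
  shows "\<exists>U r\<^sub>0. openin (top_of_set (thin_ball 1)) U \<and> K \<subseteq> U \<and> r\<^sub>0 > 0 \<and>
           (\<forall>x\<in>U. \<forall>r. 0 < r \<and> r \<le> r\<^sub>0 \<longrightarrow>
              half_ball x r \<subseteq> half_ball 0 1 \<and>
              ereal (r powr \<kappa>) \<le> (SUP y\<in>half_ball x r. ereal \<bar>w y\<bar>))"
proof -
  interpret thin_obstacle a w p \<alpha>
    by unfold_locales (use assms in auto)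
  have "\<exists>\<epsilon> r1. 0 < \<epsilon> \<and> 0 < r1 \<and> lower_bound_near z \<kappa> \<epsilon> r1" if "z \<in> K" for z
    using local_lower_bound[of z \<kappa>] that K order kappa by blast
  then obtain \<epsilon> r1 where er: "\<And>z. z \<in> K \<Longrightarrow> 0 < \<epsilon> z \<and> 0 < r1 z \<and> lower_bound_near z \<kappa> (\<epsilon> z) (r1 z)"
    by metis
  have "K \<subseteq> (\<Union>z\<in>K. ball z (\<epsilon> z))" using er by force
  then obtain D where D: "D \<subseteq> K" "finite D" "K \<subseteq> (\<Union>z\<in>D. ball z (\<epsilon> z))"
    using compactE_image[OF K(1), of K "\<lambda>z. ball z (\<epsilon> z)"] by auto
  \<comment> \<open>Inserting 1 gives the minimum a value also when the finite cover, and hence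
    \<open>K\<close>, is empty.\<close>
  define r0 where "r0 = Min (insert 1 (r1 ` D))"
  define U where "U = thin_ball 1 \<inter> (\<Union>z\<in>D. ball z (\<epsilon> z))"
  have "openin (top_of_set (thin_ball 1)) U" unfolding U_def by (intro openin_open_Int) auto
  moreover have "K \<subseteq> U" using K D by (auto simp: U_def)
  moreover have "0 < r0" unfolding r0_def using D er by (subst Min_gr_iff) auto
  moreover have "half_ball x r \<subseteq> half_ball 0 1 \<and> ereal (r powr \<kappa>) \<le> (SUP y\<in>half_ball x r. ereal \<bar>w y\<bar>)"
    if x: "x \<in> U" and r: "0 < r" "r \<le> r0" for x r
  proof -
    obtain z where z: "z \<in> D" "dist x z < \<epsilon> z" "x \<in> thin_ball 1" using x by (auto simp: U_def dist_commute)
    have "r0 \<le> r1 z" unfolding r0_def using z D by (intro Min_le) auto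
    then have "r \<le> r1 z" using r by simp
    then have *: "half_ball x r \<subseteq> Hb" "\<exists>y\<in>half_ball x r. r powr \<kappa> \<le> \<bar>w y\<bar>"
      using er[of z] z D(1) r unfolding lower_bound_near_def by blast+
    then obtain y where "y \<in> half_ball x r" "r powr \<kappa> \<le> \<bar>w y\<bar>" by blast
    then have "ereal (r powr \<kappa>) \<le> (SUP y\<in>half_ball x r. ereal \<bar>w y\<bar>)" by (intro SUP_upper2) auto
    then show ?thesis using *(1) by (simp add: Hb_def)
  qed
  ultimately show ?thesis by blast
qed

end
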